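(* Let $\mathcal{H}:\mathfrak{H}^1_K\to(\mathfrak{H}^1_K)^*$ be a bounded operator. Let $\Phi_0\in\mathfrak{H}^1_K$ be the reference determinant (so $\|\Phi_0\|=1$) and suppose that $\Psi\in\mathfrak{H}^1_K$ is such that $\langle\Psi,\Phi_0\rangle=1$. Then the following are equivalent. (i) There is a scalar $\mathcal{E}$ such that $\langle\mathcal{H}\Psi,\Phi\rangle=\mathcal{E}\langle\Psi,\Phi\rangle$ for all $\Phi\in\mathfrak{H}^1_K$. (ii) (Full CC) $\Psi=e^{T_*}\Phi_0$ for some $t_*\in\mathbb{V}$ such that $$\langle e^{-T_*}\mathcal{H}e^{T_*}\Phi_0,S\Phi_0\rangle=0\quad\text{for all } s\in\mathbb{V}.$$ Furthermore, $\mathcal{E}=\langle e^{-T_*}\mathcal{H}e^{T_*}\Phi_0,\Phi_0\rangle$. (iii) (Full CI) $\Psi=(I+C_* )\Phi_0$ for some $c_*\in\mathbb{V}$ such that $$\langle\mathcal{H}(I+C_* )\Phi_0,S\Phi_0\rangle=\mathcal{E}_{\mathrm{CI}}\langle(I+C_* )\Phi_0,S\Phi_0\rangle\quad\text{for all } s\in\mathbb{V},$$ where $\mathcal{E}_{\mathrm{CI}}=\langle\mathcal{H}(I+C_* )\Phi_0,\Phi_0\rangle$. Furthermore, $\mathcal{E}=\mathcal{E}_{\mathrm{CI}}$.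
   Context: Function spaces. All spaces are real. For a fixed particle number $N\ge1$ let $\mathfrak{L}^2=\bigwedge^N L^2(\mathbb{R}^3)$ (antisymmetric $L^2$ functions of $N$ variables in $\mathbb{R}^3$) with inner product $\langle\cdot,\cdot\rangle$ and norm $\|\cdot\|$, and $\mathfrak{H}^1=\mathfrak{L}^2\cap H^1(\mathbb{R}^{3N})$ with the $H^1$ inner product and norm. Let $N\le K\le\infty$ and let $\Lambda=\{1,\dots,K\}$ ($\Lambda=\{1,2,3,\dots\}$ if $K=\infty$). Let $\{\phi_p\}_{p\in\Lambda}\subset H^1(\mathbb{R}^3)$ be an $L^2$-orthonormal set. Let $S_N=\{\alpha\subset\Lambda:|\alpha|=N\}$ (the states), and for $\alpha=\{\alpha_1<\dots<\alpha_N\}\in S_N$ let $\Phi_\alpha(\mathbf{x}_1,\dots,\mathbf{x}_N)=N!^{-1/2}\det(\phi_{\alpha_i}(\mathbf{x}_j))_{1\le i,j\le N}$ (Slater determinants, which are $\mathfrak{L}^2$-orthonormal). $\mathfrak{H}^1_K$ is the subspace of $\mathfrak{H}^1$ spanned by $\{\Phi_\alpha\}_{\alpha\in S_N}$ (closed linear span in $\mathfrak{H}^1$ when $K=\infty$), and $(\mathfrak{H}^1_K)^*$ is its continuous dual. The symbol $\langle\cdot,\cdot\rangle$ denotes the $\mathfrak{L}^2$ inner product, or the duality pairing between $(\mathfrak{H}^1_K)^*$ and $\mathfrak{H}^1_K$ that extends it (functions are identified with functionals through the $\mathfrak{L}^2$ inner product). Excitation operators (single-reference, full excitation graph). The reference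 state is $0=\{1,\dots,N\}$, and $\Phi_0$ denotes the corresponding Slater determinant (the reference determinant). For $\alpha\in S_N$ put $\underline{\alpha}=\alpha\cap 0$ and $\overline{\alpha}=\alpha\setminus 0$, and for $\alpha,\beta\in S_N$ put $\alpha\vee\beta=(\underline{\alpha}\cap\underline{\beta})\cup(\overline{\alpha}\cup\overline{\beta})$. For $\alpha\in S_N\setminus\{0\}$ the excitation operator $X_\alpha:\mathfrak{H}^1_K\to\mathfrak{H}^1_K$ is the bounded linear operator determined by: $X_\alpha\Phi_\beta=\sigma(\alpha,\beta)\Phi_{\alpha\vee\beta}$ if $\underline{\alpha}\cup\underline{\beta}=0$ and $\overline{\alpha}\cap\overline{\beta}=\emptyset$ (in this case $\alpha\vee\beta\in S_N$), and $X_\alpha\Phi_\beta=0$ otherwise. Here $\sigma(\alpha,\beta)$ is the sign of the permutation that sorts into increasing order the tuple obtained by listing the elements of $\overline{\beta}$ in increasing order, followed by the elements of $\overline{\alpha}$ in increasing order. In particular $X_\alpha\Phi_0=\Phi_\alpha$. Cluster amplitudes and cluster operators. The amplitude space $\mathbb{V}$ (of the full excitation graph) is the set of square-summable real sequences $t=(t_\alpha)_{\alpha\in S_N\setminus\{0\}}$ such that $T\Phi_0:=\sum_\alpha t_\alpha\Phi_\alpha$ has finite $H^1$-norm, i.e. belongs to $\mathfrak{H}^1_K$. A small letter $t,s,c$ denotes an amplitude in $\mathbb{V}$ and the corresponding capital letter denotes the cluster operator $T=\sum_\alpha t_\alpha X_\alpha$ (similarly $S$, $C$). It is known that such a $T$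 and its $\mathfrak{L}^2$-adjoint $T^\dagger$ are bounded on $\mathfrak{H}^1_K$. One has $T^{N+1}=0$, so $e^{T}=\sum_{j=0}^N T^j/j!$. The operator $e^{-T}$ is extended to a bounded operator on $(\mathfrak{H}^1_K)^*$ by $\langle e^{-T}F,\Phi\rangle=\langle F,e^{-T^\dagger}\Phi\rangle$. *)

theory Defs
  imports "HOL-Analysis.Analysis" "HOL-Library.Extended_Nat"
begin

definition square_integrable :: "('a::euclidean_space \<Rightarrow> real) \<Rightarrow> bool" where
  "square_integrable f \<longleftrightarrow> f \<in> borel_measurable lborel \<and> integrable lborel (\<lambda>x. (f x)\<^sup>2)"

definition l2_rel :: "('a::euclidean_space \<Rightarrow> real) \<Rightarrow> ('a \<Rightarrow> real) \<Rightarrow> bool" where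
  "l2_rel f g \<longleftrightarrow> square_integrable f \<and> square_integrable g \<and> (AE x in lborel. f x = g x)"

lemma square_integrable_mult:
  assumes "square_integrable f" "square_integrable g"
  shows "integrable lborel (\<lambda>x. f x * g x)"
proof (rule Bochner_Integration.integrable_bound)
  show "integrable lborel (\<lambda>x. (f x)\<^sup>2 + (g x)\<^sup>2)"
    using assms by (auto simp: square_integrable_def)
  show "(\<lambda>x. f x * g x) \<in> borel_measurable lborel"
    using assms by (auto simp: square_integrable_def)
  have "\<bar>a * b\<bar> \<le> a\<^sup>2 + b\<^sup>2" for a b :: real
  proof -
    have "0 \<le> (\<bar>a\<bar> - \<bar>b\<bar>)\<^sup>2" by simp
    then have "2 * (\<bar>a\<bar> * \<bar>b\<bar>) \<le> a\<^sup>2 + b\<^sup>2"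
      by (simp add: power2_diff)
    moreover have "0 \<le> \<bar>a\<bar> * \<bar>b\<bar>" by simp
    ultimately show ?thesis unfolding abs_mult by linarith
  qed
  then show "AE x in lborel. norm (f x * g x) \<le> norm ((f x)\<^sup>2 + (g x)\<^sup>2)"
    by simp
qed

lemma square_integrable_zero: "square_integrable (\<lambda>_. 0)"
  by (simp add: square_integrable_def)

lemma square_integrable_scale:
  assumes "square_integrable f"
  shows "square_integrable (\<lambda>x. c * f x)"
  using assms by (auto simp: square_integrable_def power_mult_distrib)

lemma square_integrable_add:
  assumes "square_integrable f" "square_integrable g"
  shows "square_integrable (\<lambda>x. f x + g x)"
proof -
  have "integrable lborel (\<lambda>x. (f x)\<^sup>2 + (g x)\<^sup>2 + 2 * (f x * g x))"
    using assms square_integrable_mult[OF assms] by (auto simp: square_integrable_def)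
  then show ?thesis
    using assms by (auto simp: square_integrable_def power2_sum mult.assoc)
qed

quotient_type (overloaded) 'a l2 = "'a::euclidean_space \<Rightarrow> real" / partial: l2_rel
proof (rule part_equivpI)
  show "\<exists>f::'a \<Rightarrow> real. l2_rel f f"
    using square_integrable_zero by (auto simp: l2_rel_def)
  show "symp (l2_rel :: ('a \<Rightarrow> real) \<Rightarrow> _)"
    by (auto simp: symp_def l2_rel_def)
  show "transp (l2_rel :: ('a \<Rightarrow> real) \<Rightarrow> _)"
    unfolding transp_def l2_rel_def by (auto elim: AE_mp)
qed

instantiation l2 :: (euclidean_space) real_vector
begin

lift_definition zero_l2 :: "'a l2" is "\<lambda>_. 0"
  by (simp add: l2_rel_def square_integrable_zero)

lift_definition plus_l2 :: "'a l2 \<Rightarrow> 'a l2 \<Rightarrow> 'a l2" is "\<lambda>f g x. f x + g x"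
  by (auto simp: l2_rel_def square_integrable_add elim: AE_mp)

lift_definition scaleR_l2 :: "real \<Rightarrow> 'a l2 \<Rightarrow> 'a l2" is "\<lambda>c f x. c * f x"
  by (auto simp: l2_rel_def square_integrable_scale elim: AE_mp)

definition uminus_l2 :: "'a l2 \<Rightarrow> 'a l2" where "uminus_l2 u = scaleR (- 1) u"

definition minus_l2 :: "'a l2 \<Rightarrow> 'a l2 \<Rightarrow> 'a l2" where "minus_l2 u v = u + (- v)"

instance
proof
  fix u v w :: "'a l2" and a b :: real
  show "u + v + w = u + (v + w)"
    by transfer (auto simp: l2_rel_def square_integrable_add add.assoc)
  show "u + v = v + u"
    by transfer (auto simp: l2_rel_def square_integrable_add add.commute)
  show "0 + u = u"
    by transfer (auto simp: l2_rel_def)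
  show "- u + u = 0"
    unfolding uminus_l2_def
    by transfer (auto simp: l2_rel_def square_integrable_zero)
  show "u - v = u + - v"
    by (simp add: minus_l2_def)
  show "a *\<^sub>R (u + v) = a *\<^sub>R u + a *\<^sub>R v"
    by transfer
      (auto simp: l2_rel_def square_integrable_add square_integrable_scale distrib_left)
  show "(a + b) *\<^sub>R u = a *\<^sub>R u + b *\<^sub>R u"
    by transfer
      (auto simp: l2_rel_def square_integrable_add square_integrable_scale distrib_right)
  show "a *\<^sub>R b *\<^sub>R u = (a * b) *\<^sub>R u"
    by transfer (auto simp: l2_rel_def square_integrable_scale mult.assoc)
  show "1 *\<^sub>R u = u"
    by transfer (auto simp: l2_rel_def)
qed

end

instantiation l2 :: (euclidean_space) real_inner
begin

lift_definition inner_l2 :: "'a l2 \<Rightarrow> 'a l2 \<Rightarrow> real" is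
  "\<lambda>f g. integral\<^sup>L lborel (\<lambda>x. f x * g x)"
proof -
  fix f f' g g' :: "'a \<Rightarrow> real"
  assume f: "l2_rel f f'" and g: "l2_rel g g'"
  show "integral\<^sup>L lborel (\<lambda>x. f x * g x) = integral\<^sup>L lborel (\<lambda>x. f' x * g' x)"
    using f g by (intro integral_cong_AE) (auto simp: l2_rel_def square_integrable_def)
qed

definition norm_l2 :: "'a l2 \<Rightarrow> real" where "norm_l2 u = sqrt (inner u u)"

definition sgn_l2 :: "'a l2 \<Rightarrow> 'a l2" where "sgn_l2 u = inverse (norm u) *\<^sub>R u"

definition dist_l2 :: "'a l2 \<Rightarrow> 'a l2 \<Rightarrow> real" where "dist_l2 u v = norm (u - v)"

definition uniformity_l2 :: "('a l2 \<times> 'a l2) filter" where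
  "uniformity_l2 = (INF e\<in>{0<..}. principal {(u, v). dist u v < e})"

definition open_l2 :: "'a l2 set \<Rightarrow> bool" where
  "open_l2 U \<longleftrightarrow> (\<forall>u\<in>U. \<forall>\<^sub>F (u', v) in uniformity. u' = u \<longrightarrow> v \<in> U)"

instance
proof
  fix u v w :: "'a l2" and r :: real
  show "dist u v = norm (u - v)" by (simp add: dist_l2_def)
  show "sgn u = u /\<^sub>R norm u" by (simp add: sgn_l2_def)
  show "uniformity = (INF e\<in>{0<..}. principal {(u :: 'a l2, v). dist u v < e})"
    by (simp add: uniformity_l2_def)
  show "open U \<longleftrightarrow> (\<forall>u\<in>U. \<forall>\<^sub>F (u', v) in uniformity. u' = u \<longrightarrow> v \<in> U)" for U :: "'a l2 set"
    by (simp add: open_l2_def)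
  show "inner u v = inner v u"
    by transfer (simp add: mult.commute)
  show "inner (u + v) w = inner u w + inner v w"
  proof transfer
    fix f g h :: "'a \<Rightarrow> real"
    assume "l2_rel f f" "l2_rel g g" "l2_rel h h"
    then have "integrable lborel (\<lambda>x. f x * h x)" "integrable lborel (\<lambda>x. g x * h x)"
      by (auto simp: l2_rel_def intro: square_integrable_mult)
    then show "integral\<^sup>L lborel (\<lambda>x. (f x + g x) * h x) =
        integral\<^sup>L lborel (\<lambda>x. f x * h x) + integral\<^sup>L lborel (\<lambda>x. g x * h x)"
      by (simp add: distrib_right)
  qed
  show "inner (r *\<^sub>R u) v = r * inner u v"
    by transfer (simp add: mult.assoc)
  show "0 \<le> inner u u"
    by transfer simp
  show "inner u u = 0 \<longleftrightarrow> u = 0"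
  proof transfer
    fix f :: "'a \<Rightarrow> real"
    assume "l2_rel f f"
    then have f: "square_integrable f" by (simp add: l2_rel_def)
    then have "integrable lborel (\<lambda>x. f x * f x)" by (intro square_integrable_mult)
    then have "integral\<^sup>L lborel (\<lambda>x. f x * f x) = 0 \<longleftrightarrow> (AE x in lborel. f x * f x = 0)"
      by (intro integral_nonneg_eq_0_iff_AE) auto
    then show "integral\<^sup>L lborel (\<lambda>x. f x * f x) = 0 \<longleftrightarrow> l2_rel f (\<lambda>_. 0)"
      using f by (auto simp: l2_rel_def square_integrable_zero)
  qed
  show "norm u = sqrt (inner u u)" by (simp add: norm_l2_def)
qed

end

primrec Ck :: "nat \<Rightarrow> ('a::euclidean_space \<Rightarrow> real) \<Rightarrow> bool" where
  "Ck 0 f \<longleftrightarrow> continuous_on UNIV f"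
| "Ck (Suc k) f \<longleftrightarrow> (\<forall>x. f differentiable (at x)) \<and>
     (\<forall>b\<in>Basis. Ck k (\<lambda>x. frechet_derivative f (at x) b))"

definition test_function :: "('a::euclidean_space \<Rightarrow> real) \<Rightarrow> bool" where
  "test_function \<psi> \<longleftrightarrow> (\<forall>k. Ck k \<psi>) \<and> compact (closure {x. \<psi> x \<noteq> 0})"

text \<open>\<open>rep_l2\<close> selects a representative of a class in \<open>l2\<close>; the integrals do not depend on it.\<close>

definition has_weak_deriv :: "'a::euclidean_space \<Rightarrow> 'a l2 \<Rightarrow> 'a l2 \<Rightarrow> bool" where
  "has_weak_deriv b u g \<longleftrightarrow> (\<forall>\<psi>. test_function \<psi> \<longrightarrow>
     integral\<^sup>L lborel (\<lambda>x. rep_l2 u x * frechet_derivative \<psi> (at x) b) =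
     - integral\<^sup>L lborel (\<lambda>x. rep_l2 g x * \<psi> x))"

definition weak_deriv :: "'a::euclidean_space \<Rightarrow> 'a l2 \<Rightarrow> 'a l2" where
  "weak_deriv b u = (THE g. has_weak_deriv b u g)"

definition H1 :: "'a::euclidean_space l2 set" where
  "H1 = {u. \<forall>b\<in>Basis. \<exists>g. has_weak_deriv b u g}"

definition h1_inner :: "'a::euclidean_space l2 \<Rightarrow> 'a l2 \<Rightarrow> real" where
  "h1_inner u v = inner u v + (\<Sum>b\<in>Basis. inner (weak_deriv b u) (weak_deriv b v))"

definition h1_norm :: "'a::euclidean_space l2 \<Rightarrow> real" where
  "h1_norm u = sqrt (h1_inner u u)"

text \<open>The particles are indexed by a finite linearly ordered type, so \<open>N = CARD('n)\<close>.\<close>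

type_synonym 'n config = "(real^3)^'n"

definition antisym_L2 :: "('n::finite) config l2 set" where
  "antisym_L2 = {u. \<forall>p::'n \<Rightarrow> 'n. p permutes UNIV \<longrightarrow>
     (AE x in lborel. rep_l2 u (\<chi> j. x $ p j) = of_int (sign p) * rep_l2 u x)}"

definition antisym_H1 :: "('n::finite) config l2 set" where
  "antisym_H1 = antisym_L2 \<inter> H1"

definition orbitals :: "enat \<Rightarrow> nat set" where
  "orbitals K = {p. 1 \<le> p \<and> enat p \<le> K}"

definition states :: "nat \<Rightarrow> enat \<Rightarrow> nat set set" where
  "states N K = {\<alpha>. \<alpha> \<subseteq> orbitals K \<and> finite \<alpha> \<and> card \<alpha> = N}"

text \<open>The row with index \<open>i\<close> belongs to the element of \<open>\<alpha>\<close> having the same rank in \<open>\<alpha>\<close>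
  as \<open>i\<close> has in \<open>'n\<close>.\<close>

definition slater_fun ::
    "(nat \<Rightarrow> (real^3) l2) \<Rightarrow> nat set \<Rightarrow> 'n::{finite,linorder} config \<Rightarrow> real" where
  "slater_fun \<phi> \<alpha> x =
     det (\<chi> i j. rep_l2 (\<phi> (sorted_list_of_set \<alpha> ! card {k. k < i})) (x $ j))
       / sqrt (fact CARD('n))"

definition slater :: "(nat \<Rightarrow> (real^3) l2) \<Rightarrow> nat set \<Rightarrow> 'n::{finite,linorder} config l2" where
  "slater \<phi> \<alpha> = abs_l2 (slater_fun \<phi> \<alpha>)"

definition H1K ::
    "enat \<Rightarrow> (nat \<Rightarrow> (real^3) l2) \<Rightarrow> ('n::{finite,linorder}) config l2 set" where
  "H1K K \<phi> = (let W = span (slater \<phi> ` states CARD('n) K) in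
     if K = \<infinity> then {u \<in> antisym_H1. \<forall>e>0. \<exists>w\<in>W. h1_norm (u - w) < e} else W)"

definition linear_on_subspace :: "'a::real_vector set \<Rightarrow> ('a \<Rightarrow> 'b::real_vector) \<Rightarrow> bool" where
  "linear_on_subspace V f \<longleftrightarrow>
     (\<forall>u\<in>V. \<forall>v\<in>V. \<forall>a b. f (a *\<^sub>R u + b *\<^sub>R v) = a *\<^sub>R f u + b *\<^sub>R f v)"

definition bounded_operator_on ::
    "'a::euclidean_space l2 set \<Rightarrow> ('a l2 \<Rightarrow> 'a l2) \<Rightarrow> bool" where
  "bounded_operator_on V A \<longleftrightarrow> A \<in> V \<rightarrow> V \<and> linear_on_subspace V A \<and>
     (\<exists>C. \<forall>u\<in>V. h1_norm (A u) \<le> C * h1_norm u)"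

definition dual_space :: "'a::euclidean_space l2 set \<Rightarrow> ('a l2 \<Rightarrow> real) set" where
  "dual_space V = {F. linear_on_subspace V F \<and> (\<exists>C. \<forall>v\<in>V. \<bar>F v\<bar> \<le> C * h1_norm v)}"

definition dual_norm :: "'a::euclidean_space l2 set \<Rightarrow> ('a l2 \<Rightarrow> real) \<Rightarrow> real" where
  "dual_norm V F = (SUP v\<in>{v\<in>V. h1_norm v \<le> 1}. \<bar>F v\<bar>)"

text \<open>The duality pairing of \<open>F\<close> with \<open>v\<close> is \<open>F v\<close>. Only the values at elements of \<open>V\<close> matter.\<close>

definition bounded_operator_to_dual ::
    "'a::euclidean_space l2 set \<Rightarrow> ('a l2 \<Rightarrow> 'a l2 \<Rightarrow> real) \<Rightarrow> bool" where
  "bounded_operator_to_dual V H \<longleftrightarrow> H \<in> V \<rightarrow> dual_space V \<and>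
     (\<forall>v\<in>V. linear_on_subspace V (\<lambda>u. H u v)) \<and>
     (\<exists>C. \<forall>u\<in>V. dual_norm V (H u) \<le> C * h1_norm u)"

text \<open>Operators on \<open>V\<close> are taken to vanish outside \<open>V\<close>, so that they are unique as functions.\<close>

definition l2_adjoint_on ::
    "'a::euclidean_space l2 set \<Rightarrow> ('a l2 \<Rightarrow> 'a l2) \<Rightarrow> 'a l2 \<Rightarrow> 'a l2" where
  "l2_adjoint_on V A = (THE B. B \<in> V \<rightarrow> V \<and> (\<forall>v. v \<notin> V \<longrightarrow> B v = 0) \<and>
     (\<forall>u\<in>V. \<forall>v\<in>V. inner (A u) v = inner u (B v)))"

definition exp_nilpotent :: "nat \<Rightarrow> ('a::real_vector \<Rightarrow> 'a) \<Rightarrow> 'a \<Rightarrow> 'a" where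
  "exp_nilpotent N A u = (\<Sum>j\<le>N. (A ^^ j) u /\<^sub>R fact j)"

definition ref_state :: "nat \<Rightarrow> nat set" where
  "ref_state N = {1..N}"

definition occ :: "nat \<Rightarrow> nat set \<Rightarrow> nat set" where
  "occ N \<alpha> = \<alpha> \<inter> ref_state N"

definition virt :: "nat \<Rightarrow> nat set \<Rightarrow> nat set" where
  "virt N \<alpha> = \<alpha> - ref_state N"

definition state_join :: "nat \<Rightarrow> nat set \<Rightarrow> nat set \<Rightarrow> nat set" where
  "state_join N \<alpha> \<beta> = (occ N \<alpha> \<inter> occ N \<beta>) \<union> (virt N \<alpha> \<union> virt N \<beta>)"

definition sort_sign :: "nat list \<Rightarrow> int" where
  "sort_sign xs = sign (THE p. p permutes {..<length xs} \<and> permute_list p xs = sort xs)"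

definition excitation_sign :: "nat \<Rightarrow> nat set \<Rightarrow> nat set \<Rightarrow> int" where
  "excitation_sign N \<alpha> \<beta> =
     sort_sign (sorted_list_of_set (virt N \<beta>) @ sorted_list_of_set (virt N \<alpha>))"

definition excitation ::
    "enat \<Rightarrow> (nat \<Rightarrow> (real^3) l2) \<Rightarrow> nat set \<Rightarrow>
     ('n::{finite,linorder}) config l2 \<Rightarrow> 'n config l2" where
  "excitation K \<phi> \<alpha> = (THE X. bounded_operator_on (H1K K \<phi>) X \<and>
     (\<forall>u. u \<notin> H1K K \<phi> \<longrightarrow> X u = 0) \<and>
     (\<forall>\<beta>\<in>states CARD('n) K. X (slater \<phi> \<beta>) =
       (if occ CARD('n) \<alpha> \<union> occ CARD('n) \<beta> = ref_state CARD('n) \<and>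
           virt CARD('n) \<alpha> \<inter> virt CARD('n) \<beta> = {}
        then of_int (excitation_sign CARD('n) \<alpha> \<beta>) *\<^sub>R slater \<phi> (state_join CARD('n) \<alpha> \<beta>)
        else 0)))"

definition excited_states :: "nat \<Rightarrow> enat \<Rightarrow> nat set set" where
  "excited_states N K = states N K - {ref_state N}"

text \<open>The sums over excited states converge in L2; H1-convergence is not required.
  An amplitude is a function on all sets, but only its values on excited states matter.\<close>

definition amplitudes ::
    "'n::{finite,linorder} itself \<Rightarrow> enat \<Rightarrow> (nat \<Rightarrow> (real^3) l2) \<Rightarrow> (nat set \<Rightarrow> real) set" where
  "amplitudes _ K \<phi> = {t.
     (\<lambda>\<alpha>. (t \<alpha>)\<^sup>2) summable_on excited_states CARD('n) K \<and>
     (\<Sum>\<^sub>\<infinity>\<alpha>\<in>excited_states CARD('n) K. t \<alpha> *\<^sub>R slater \<phi> \<alpha>) \<in> (H1K K \<phi> :: 'n config l2 set)}"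

definition cluster ::
    "enat \<Rightarrow> (nat \<Rightarrow> (real^3) l2) \<Rightarrow> (nat set \<Rightarrow> real) \<Rightarrow>
     ('n::{finite,linorder}) config l2 \<Rightarrow> 'n config l2" where
  "cluster K \<phi> t u = (\<Sum>\<^sub>\<infinity>\<alpha>\<in>excited_states CARD('n) K. t \<alpha> *\<^sub>R excitation K \<phi> \<alpha> u)"

definition exp_cluster ::
    "enat \<Rightarrow> (nat \<Rightarrow> (real^3) l2) \<Rightarrow> (nat set \<Rightarrow> real) \<Rightarrow>
     ('n::{finite,linorder}) config l2 \<Rightarrow> 'n config l2" where
  "exp_cluster K \<phi> t = exp_nilpotent CARD('n) (cluster K \<phi> t)"

definition exp_neg_cluster_dual ::
    "enat \<Rightarrow> (nat \<Rightarrow> (real^3) l2) \<Rightarrow> (nat set \<Rightarrow> real) \<Rightarrow>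
     (('n::{finite,linorder}) config l2 \<Rightarrow> real) \<Rightarrow> 'n config l2 \<Rightarrow> real" where
  "exp_neg_cluster_dual K \<phi> t F =
     (\<lambda>\<Phi>. F (exp_nilpotent CARD('n) (\<lambda>u. - l2_adjoint_on (H1K K \<phi>) (cluster K \<phi> t) u) \<Phi>))"

definition full_CC ::
    "enat \<Rightarrow> (nat \<Rightarrow> (real^3) l2) \<Rightarrow>
     (('n::{finite,linorder}) config l2 \<Rightarrow> 'n config l2 \<Rightarrow> real) \<Rightarrow>
     'n config l2 \<Rightarrow> (nat set \<Rightarrow> real) \<Rightarrow> bool" where
  "full_CC K \<phi> H \<Psi> t \<longleftrightarrow> (let \<Phi>0 = slater \<phi> (ref_state CARD('n)) in
     t \<in> amplitudes TYPE('n) K \<phi> \<and> \<Psi> = exp_cluster K \<phi> t \<Phi>0 \<and>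
     (\<forall>s\<in>amplitudes TYPE('n) K \<phi>.
        exp_neg_cluster_dual K \<phi> t (H (exp_cluster K \<phi> t \<Phi>0)) (cluster K \<phi> s \<Phi>0) = 0))"

definition CC_energy ::
    "enat \<Rightarrow> (nat \<Rightarrow> (real^3) l2) \<Rightarrow>
     (('n::{finite,linorder}) config l2 \<Rightarrow> 'n config l2 \<Rightarrow> real) \<Rightarrow>
     (nat set \<Rightarrow> real) \<Rightarrow> real" where
  "CC_energy K \<phi> H t = (let \<Phi>0 = slater \<phi> (ref_state CARD('n)) in
     exp_neg_cluster_dual K \<phi> t (H (exp_cluster K \<phi> t \<Phi>0)) \<Phi>0)"

definition CI_energy ::
    "enat \<Rightarrow> (nat \<Rightarrow> (real^3) l2) \<Rightarrow>
     (('n::{finite,linorder}) config l2 \<Rightarrow> 'n config l2 \<Rightarrow> real) \<Rightarrow>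
     (nat set \<Rightarrow> real) \<Rightarrow> real" where
  "CI_energy K \<phi> H c = (let \<Phi>0 = slater \<phi> (ref_state CARD('n)) in
     H (\<Phi>0 + cluster K \<phi> c \<Phi>0) \<Phi>0)"

definition full_CI ::
    "enat \<Rightarrow> (nat \<Rightarrow> (real^3) l2) \<Rightarrow>
     (('n::{finite,linorder}) config l2 \<Rightarrow> 'n config l2 \<Rightarrow> real) \<Rightarrow>
     'n config l2 \<Rightarrow> (nat set \<Rightarrow> real) \<Rightarrow> bool" where
  "full_CI K \<phi> H \<Psi> c \<longleftrightarrow> (let \<Phi>0 = slater \<phi> (ref_state CARD('n)) in
     c \<in> amplitudes TYPE('n) K \<phi> \<and> \<Psi> = \<Phi>0 + cluster K \<phi> c \<Phi>0 \<and>
     (\<forall>s\<in>amplitudes TYPE('n) K \<phi>.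
        H (\<Phi>0 + cluster K \<phi> c \<Phi>0) (cluster K \<phi> s \<Phi>0) =
        CI_energy K \<phi> H c * inner (\<Phi>0 + cluster K \<phi> c \<Phi>0) (cluster K \<phi> s \<Phi>0)))"

end

theory Submission
  imports Defs
begin

text \<open>Write \<open>V\<close> for the space spanned by the determinants, \<open>\<Phi>\<^sub>0\<close> for the reference determinant and
\<open>V\<^sub>0\<close> for the vectors of \<open>V\<close> orthogonal to \<open>\<Phi>\<^sub>0\<close>.  Once three facts about cluster operators are
known, the equivalences are a short calculation.

\<^item> The map \<open>t \<mapsto> T \<Phi>\<^sub>0\<close> sends the amplitudes onto \<open>V\<^sub>0\<close> (\<open>state_of_excited\<close>,
\<open>excited_space_amplitudes\<close>).

\<^item> Every cluster operator \<open>T\<close> and its adjoint map \<open>V\<close> into itself and are nilpotent of order at most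
\<open>N + 1\<close> (\<open>nilpotent_mul\<close>, \<open>nilpotent_adj\<close>), so \<open>e\<^sup>T\<close> and the adjoint exponentials are invertible on \<open>V\<close>.

\<^item> Every vector \<open>\<Phi>\<^sub>0 + c\<close> with \<open>c \<in> V\<^sub>0\<close> is \<open>e\<^sup>T \<Phi>\<^sub>0\<close> for some amplitude (\<open>exp_logarithm\<close>).

If \<open>H \<Psi> = E \<Psi>\<close> and \<open>\<Psi> = e\<^sup>T \<Phi>\<^sub>0\<close>, moving the exponential to the other side of the pairing gives
\<open>\<langle>e\<^sup>-\<^sup>T H \<Psi>, v\<rangle> = E \<langle>e\<^sup>-\<^sup>T \<Psi>, v\<rangle> = E \<langle>\<Phi>\<^sub>0, v\<rangle>\<close>, which vanishes on \<open>V\<^sub>0\<close> and is \<open>E\<close> at \<open>\<Phi>\<^sub>0\<close>.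
Conversely each \<open>\<Phi> \<in> V\<close> is the image under the adjoint of \<open>e\<^sup>-\<^sup>T\<close> of some \<open>k \<Phi>\<^sub>0 + v\<close> with
\<open>v \<in> V\<^sub>0\<close> and \<open>k = \<langle>\<Psi>, \<Phi>\<rangle>\<close>, so the coupled cluster equations give
\<open>\<langle>H \<Psi>, \<Phi>\<rangle> = k \<langle>e\<^sup>-\<^sup>T H \<Psi>, \<Phi>\<^sub>0\<rangle>\<close>.  The configuration interaction equations are the same statement
with \<open>\<Phi> = k \<Phi>\<^sub>0 + v\<close> directly.

The three facts rest on an algebra.  Code a state by its holes and particles, that is by its symmetric
difference with the reference state.  Then \<open>X\<^sub>\<alpha> \<Phi>\<^sub>\<beta>\<close> is, up to sign, the determinant whose code is the disjoint union
of the two codes, and a cluster operator acts on coefficients as a signed subset convolution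
(\<open>conv\<close>).  The sign is a product over pairs of particles, hence multiplicative in disjoint
unions, and the convolution is associative with unit \<open>\<Phi>\<^sub>0\<close> (\<open>conv_assoc\<close>): \<open>V\<close> becomes an algebra in which
\<open>T\<close> is multiplication by \<open>T \<Phi>\<^sub>0\<close>.  With this sign two excitations of odd rank
anticommute, so the algebra is in general not commutative, but exponential and logarithm only involve powers of one element.

The analytic content is that the multiplication and its adjoint are bounded for the H1 norm.  The
Slater--Condon rule (\<open>slater_condon_gradient\<close>) writes the kinetic part of the H1 norm as
\<open>\<Sum>\<^sub>\<delta> \<parallel>\<Sum>\<^sub>p \<plusminus> u (\<delta> \<union> {p}) \<nabla>\<phi>\<^sub>p\<parallel>\<^sup>2\<close>, the sum running over the sets \<open>\<delta>\<close> of \<open>N - 1\<close> orbitals.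
For the infinitely many virtual orbitals \<open>p\<close> the removal of \<open>p\<close> is a graded derivation of
the convolution (\<open>contract_conv\<close>) and commutes, up to the grading, with the adjoint
(\<open>contract_adj_conv\<close>), so both operators are
bounded by Cauchy--Schwarz with constants that only depend on \<open>N\<close>; the \<open>N\<close> occupied orbitals only contribute
multiples of the L2 norm.  The bounds on finite combinations extend to \<open>V\<close> because H1 is complete, which needs
completeness of L2 (\<open>l2_Cauchy_limit\<close>) and uniqueness of weak derivatives
(\<open>orthogonal_test_functions_zero\<close>).\<close>

section \<open>Completeness of L2\<close>

lemma l2_rel_rep: "l2_rel (rep_l2 u) (rep_l2 u)"
  by (rule Quotient3_rep_reflp[OF Quotient3_l2])

lemma square_integrable_rep [simp]: "square_integrable (rep_l2 u)"
  using l2_rel_rep[of u] by (simp add: l2_rel_def)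

lemma abs_rep_l2 [simp]: "abs_l2 (rep_l2 u) = u"
  by (rule Quotient3_abs_rep[OF Quotient3_l2])

lemma l2_rel_refl: "square_integrable f \<Longrightarrow> l2_rel f f"
  by (simp add: l2_rel_def)

lemma rep_abs_l2: "square_integrable f \<Longrightarrow> AE x in lborel. rep_l2 (abs_l2 f) x = f x"
  using rep_abs_rsp_left[OF Quotient3_l2, of f f] by (simp add: l2_rel_def)

lemma abs_l2_cong:
  assumes "square_integrable f" "square_integrable g" "AE x in lborel. f x = g x"
  shows "abs_l2 f = abs_l2 g"
  using Quotient3_rel_abs[OF Quotient3_l2] assms by (auto simp: l2_rel_def)

lemma rep_borel_measurable [measurable]: "rep_l2 u \<in> borel_measurable borel"
  using square_integrable_rep[of u] by (simp add: square_integrable_def)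

lemma square_integrable_measurable: "square_integrable f \<Longrightarrow> f \<in> borel_measurable borel"
  by (simp add: square_integrable_def)

lemma abs_l2_add:
  "square_integrable f \<Longrightarrow> square_integrable g \<Longrightarrow> abs_l2 (\<lambda>x. f x + g x) = abs_l2 f + abs_l2 g"
  by (simp add: plus_l2.abs_eq l2_rel_refl)

lemma abs_l2_scale: "square_integrable f \<Longrightarrow> abs_l2 (\<lambda>x. c * f x) = c *\<^sub>R abs_l2 f"
  by (simp add: scaleR_l2.abs_eq l2_rel_refl)

lemma square_integrable_diff:
  assumes "square_integrable f" "square_integrable g"
  shows "square_integrable (\<lambda>x. f x - g x)"
  using square_integrable_add[OF assms(1) square_integrable_scale[OF assms(2), of "-1"]] by simp

lemma abs_l2_diff:
  assumes "square_integrable f" "square_integrable g"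
  shows "abs_l2 (\<lambda>x. f x - g x) = abs_l2 f - abs_l2 g"
  using abs_l2_add[OF assms(1) square_integrable_scale[OF assms(2), of "-1"]] abs_l2_scale[OF assms(2), of "-1"]
  by simp

lemma square_integrable_sum:
  "(\<And>i. i \<in> I \<Longrightarrow> square_integrable (f i)) \<Longrightarrow> square_integrable (\<lambda>x. \<Sum>i\<in>I. f i x)"
  by (induction I rule: infinite_finite_induct) (auto simp: square_integrable_zero square_integrable_add)

lemma abs_l2_zero: "abs_l2 (\<lambda>_. 0) = 0"
  by (simp add: zero_l2_def)

lemma abs_l2_sum:
  "(\<And>i. i \<in> I \<Longrightarrow> square_integrable (f i)) \<Longrightarrow> abs_l2 (\<lambda>x. \<Sum>i\<in>I. f i x) = (\<Sum>i\<in>I. abs_l2 (f i))"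
  by (induction I rule: infinite_finite_induct)
    (auto simp: abs_l2_zero abs_l2_add square_integrable_sum)

lemma inner_l2_rep: "inner u v = (\<integral>x. rep_l2 u x * rep_l2 v x \<partial>lborel)"
  by (simp add: inner_l2.rep_eq)

lemma inner_abs_l2:
  "square_integrable f \<Longrightarrow> square_integrable g \<Longrightarrow> inner (abs_l2 f) (abs_l2 g) = (\<integral>x. f x * g x \<partial>lborel)"
  by (simp add: inner_l2.abs_eq l2_rel_refl)

lemma norm_abs_l2: "square_integrable f \<Longrightarrow> (norm (abs_l2 f))\<^sup>2 = (\<integral>x. (f x)\<^sup>2 \<partial>lborel)"
  by (simp add: power2_norm_eq_inner inner_abs_l2) (simp add: power2_eq_square)

lemma square_integrable_abs: "square_integrable f \<Longrightarrow> square_integrable (\<lambda>x. \<bar>f x\<bar>)"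
  by (auto simp: square_integrable_def)

lemma square_integrableI_nn:
  assumes [measurable]: "f \<in> borel_measurable borel"
    and fin: "(\<integral>\<^sup>+x. ennreal ((f x)\<^sup>2) \<partial>lborel) \<le> ennreal c" and c: "0 \<le> c"
  shows "square_integrable f" "norm (abs_l2 f) \<le> sqrt c"
proof -
  have lt: "(\<integral>\<^sup>+x. ennreal ((f x)\<^sup>2) \<partial>lborel) < \<infinity>" 
    using fin by (simp add: le_less_trans)
  then have int: "integrable lborel (\<lambda>x. (f x)\<^sup>2)"
    by (intro integrableI_nonneg) auto
  then show sq: "square_integrable f" by (simp add: square_integrable_def)
  have "ennreal (\<integral>x. (f x)\<^sup>2 \<partial>lborel) \<le> ennreal c"
    using nn_integral_eq_integral[OF int] fin by simp
  then have "(norm (abs_l2 f))\<^sup>2 \<le> c"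
    using c by (simp add: norm_abs_l2[OF sq])
  then show "norm (abs_l2 f) \<le> sqrt c"
    by (simp add: real_le_rsqrt)
qed

lemma nn_integral_square:
  assumes "square_integrable f"
  shows "(\<integral>\<^sup>+x. ennreal ((f x)\<^sup>2) \<partial>lborel) = ennreal ((norm (abs_l2 f))\<^sup>2)"
  using assms by (subst nn_integral_eq_integral) (auto simp: square_integrable_def norm_abs_l2)

text \<open>Riesz--Fischer.  Along a subsequence with geometrically decreasing increments the partial sums of the
absolute increments are bounded in L2, so by monotone convergence they are finite almost
everywhere; Fatou's lemma then identifies the pointwise limit with the L2 limit.  The pointwise
convergence is part of the statement because antisymmetry is an almost-everywhere condition
that has to pass to the limit.\<close>

theorem l2_Cauchy_limit:
  fixes X :: "nat \<Rightarrow> 'a::euclidean_space l2"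
  assumes "Cauchy X"
  shows "\<exists>u r. X \<longlonglongrightarrow> u \<and> strict_mono r \<and> (AE x in lborel. (\<lambda>k. rep_l2 (X (r k)) x) \<longlonglongrightarrow> rep_l2 u x)"
proof -
  have "\<forall>k. \<exists>M. \<forall>m\<ge>M. \<forall>n\<ge>M. dist (X m) (X n) < (1/2)^k"
    using assms unfolding Cauchy_def by (metis zero_less_power half_gt_zero_iff zero_less_one)
  then obtain M where M: "\<And>k m n. m \<ge> M k \<Longrightarrow> n \<ge> M k \<Longrightarrow> dist (X m) (X n) < (1/2)^k"
    by metis
  \<comment> \<open>The sum makes \<open>r k\<close> at least \<open>M k\<close>, and the summand \<open>k\<close> makes \<open>r\<close> strictly increasing.\<close>
  define r where "r k = (\<Sum>i\<le>k. M i) + k" for k :: nat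
  have r: "strict_mono r"
    unfolding strict_mono_Suc_iff r_def by simp
  have rM: "r k \<ge> M k" for k
    unfolding r_def by (simp add: lessThan_Suc_atMost[symmetric])
  define Y where "Y k = X (r k)" for k
  have Yd: "norm (Y n - Y k) \<le> (1/2)^k" if "k \<le> n" for k n
  proof -
    have "r n \<ge> M k" using rM[of k] strict_mono_leD[OF r that] by simp
    then show ?thesis using M[OF _ rM[of k], of "r n"] by (simp add: Y_def dist_norm)
  qed
  define f where "f k = rep_l2 (Y k)" for k
  have f[simp]: "square_integrable (f k)" for k by (simp add: f_def)
  have fm[measurable]: "f k \<in> borel_measurable borel" for k by (simp add: f_def)
  have df: "abs_l2 (\<lambda>x. f n x - f k x) = Y n - Y k" for n k
    by (simp add: abs_l2_diff) (simp add: f_def)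
  define g where "g n x = (\<Sum>k<n. \<bar>f (Suc k) x - f k x\<bar>)" for n x
  have gs: "square_integrable (g n)" for n
    unfolding g_def by (intro square_integrable_sum square_integrable_abs square_integrable_diff f)
  have gn: "norm (abs_l2 (g n)) \<le> 2" for n
  proof -
    have "abs_l2 (g n) = (\<Sum>k<n. abs_l2 (\<lambda>x. \<bar>f (Suc k) x - f k x\<bar>))"
      unfolding g_def by (intro abs_l2_sum square_integrable_abs square_integrable_diff f)
    also have "norm \<dots> \<le> (\<Sum>k<n. norm (abs_l2 (\<lambda>x. \<bar>f (Suc k) x - f k x\<bar>)))"
      by (rule norm_sum)
    also have "\<dots> \<le> (\<Sum>k<n. (1/2)^k)"
    proof (intro sum_mono)
      fix k
      have "(norm (abs_l2 (\<lambda>x. \<bar>f (Suc k) x - f k x\<bar>)))\<^sup>2 = (norm (abs_l2 (\<lambda>x. f (Suc k) x - f k x)))\<^sup>2"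
        by (simp add: norm_abs_l2 square_integrable_abs square_integrable_diff)
      then have "norm (abs_l2 (\<lambda>x. \<bar>f (Suc k) x - f k x\<bar>)) = norm (Y (Suc k) - Y k)"
        by (simp add: df)
      then show "norm (abs_l2 (\<lambda>x. \<bar>f (Suc k) x - f k x\<bar>)) \<le> (1/2)^k"
        using Yd[of k "Suc k"] by simp
    qed
    also have "\<dots> \<le> (\<Sum>k. (1/2::real)^k)"
      by (intro sum_le_suminf) auto
    also have "\<dots> = 2" by (simp add: suminf_geometric)
    finally show ?thesis .
  qed
  have gm[measurable]: "g n \<in> borel_measurable borel" for n
    using gs square_integrable_measurable by blast
  have g0: "0 \<le> g n x" for n x by (auto simp: g_def intro: sum_nonneg)
  have ginc: "incseq (\<lambda>n x. ennreal ((g n x)\<^sup>2))"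
    unfolding incseq_Suc_iff le_fun_def
    by (auto intro!: ennreal_leI power_mono g0) (auto simp: g_def)
  have "(\<integral>\<^sup>+x. (SUP n. ennreal ((g n x)\<^sup>2)) \<partial>lborel) = (SUP n. \<integral>\<^sup>+x. ennreal ((g n x)\<^sup>2) \<partial>lborel)"
    by (intro nn_integral_monotone_convergence_SUP ginc) auto
  also have "\<dots> \<le> ennreal 4"
  proof (intro SUP_least)
    fix n
    have "(norm (abs_l2 (g n)))\<^sup>2 \<le> 2\<^sup>2" using gn[of n] by (intro power_mono) auto
    then show "(\<integral>\<^sup>+x. ennreal ((g n x)\<^sup>2) \<partial>lborel) \<le> ennreal 4"
      by (subst nn_integral_square[OF gs], intro ennreal_leI) simp
  qed
  finally have "(\<integral>\<^sup>+x. (SUP n. ennreal ((g n x)\<^sup>2)) \<partial>lborel) \<noteq> \<infinity>"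
    by (auto simp: top_unique)
  then have "AE x in lborel. (SUP n. ennreal ((g n x)\<^sup>2)) \<noteq> \<infinity>"
    by (intro nn_integral_noteq_infinite) auto
  then have conv: "AE x in lborel. convergent (\<lambda>n. f n x)"
  proof (rule AE_mp, intro AE_I2 impI)
    fix x assume "(SUP n. ennreal ((g n x)\<^sup>2)) \<noteq> \<infinity>"
    then obtain c where c: "0 \<le> c" "(SUP n. ennreal ((g n x)\<^sup>2)) = ennreal c"
      by (cases "SUP n. ennreal ((g n x)\<^sup>2)") auto
    have "g n x \<le> sqrt c" for n
    proof -
      have "ennreal ((g n x)\<^sup>2) \<le> ennreal c"
        unfolding c(2)[symmetric] by (rule SUP_upper) simp
      then show ?thesis using c(1) by (simp add: real_le_rsqrt)
    qed
    then have "summable (\<lambda>k. \<bar>f (Suc k) x - f k x\<bar>)"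
      by (intro summableI_nonneg_bounded[where x = "sqrt c"]) (auto simp: g_def)
    then have "summable (\<lambda>k. f (Suc k) x - f k x)"
      by (rule summable_rabs_cancel)
    then show "convergent (\<lambda>n. f n x)"
      using telescope_summable' summable_iff_convergent sum_lessThan_telescope
      by (metis (no_types, lifting) convergent_diff_const_right_iff summable_iff_convergent sum_lessThan_telescope ext)
  qed
  define h where "h x = lim (\<lambda>n. f n x)" for x
  have hm[measurable]: "h \<in> borel_measurable borel"
    unfolding h_def by (rule borel_measurable_lim_metric) simp
  have lim: "AE x in lborel. (\<lambda>n. f n x) \<longlonglongrightarrow> h x"
    using conv by (rule AE_mp) (auto simp: h_def convergent_LIMSEQ_iff)
  have bd: "(\<integral>\<^sup>+x. ennreal ((h x - f k x)\<^sup>2) \<partial>lborel) \<le> ennreal (((1/2)^k)\<^sup>2)" for k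
  proof -
    have "(\<integral>\<^sup>+x. ennreal ((h x - f k x)\<^sup>2) \<partial>lborel)
        = (\<integral>\<^sup>+x. liminf (\<lambda>n. ennreal ((f n x - f k x)\<^sup>2)) \<partial>lborel)"
    proof (rule nn_integral_cong_AE, rule AE_mp[OF lim], intro AE_I2 impI)
      fix x assume "(\<lambda>n. f n x) \<longlonglongrightarrow> h x"
      then have "(\<lambda>n. ennreal ((f n x - f k x)\<^sup>2)) \<longlonglongrightarrow> ennreal ((h x - f k x)\<^sup>2)"
        by (intro tendsto_intros)
      from lim_imp_Liminf[OF trivial_limit_sequentially this]
      show "ennreal ((h x - f k x)\<^sup>2) = liminf (\<lambda>n. ennreal ((f n x - f k x)\<^sup>2))"
        by (rule sym)
    qed
    also have "\<dots> \<le> liminf (\<lambda>n. \<integral>\<^sup>+x. ennreal ((f n x - f k x)\<^sup>2) \<partial>lborel)"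
      by (rule nn_integral_liminf) simp
    also have "\<dots> \<le> liminf (\<lambda>n. ennreal (((1/2)^k)\<^sup>2))"
    proof (rule Liminf_mono, rule eventually_sequentiallyI[of k])
      fix n assume "k \<le> n"
      have "(norm (Y n - Y k))\<^sup>2 \<le> ((1/2)^k)\<^sup>2" using Yd[OF \<open>k \<le> n\<close>] by (intro power_mono) auto
      then show "(\<integral>\<^sup>+x. ennreal ((f n x - f k x)\<^sup>2) \<partial>lborel) \<le> ennreal (((1/2)^k)\<^sup>2)"
        by (subst nn_integral_square) (auto simp: df square_integrable_diff intro!: ennreal_leI)
    qed
    also have "\<dots> = ennreal (((1/2)^k)\<^sup>2)" by (simp add: Liminf_const)
    finally show ?thesis .
  qed
  have hk: "square_integrable (\<lambda>x. h x - f k x)" "norm (abs_l2 (\<lambda>x. h x - f k x)) \<le> (1/2)^k" for k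
    using square_integrableI_nn[OF _ bd[of k]] by auto
  have hs: "square_integrable h"
    using square_integrable_add[OF hk(1)[of 0] f[of 0]] by simp
  define u where "u = abs_l2 h"
  have uY: "norm (Y k - u) \<le> (1/2)^k" for k
  proof -
    have "abs_l2 (\<lambda>x. h x - f k x) = u - Y k"
      using abs_l2_diff[OF hs f[of k]] by (simp add: u_def f_def)
    then show ?thesis using hk(2)[of k] by (simp add: norm_minus_commute)
  qed
  have "(\<lambda>k. (1/2::real)^k) \<longlonglongrightarrow> 0" by (rule LIMSEQ_power_zero) simp
  then have "(\<lambda>k. norm (Y k - u)) \<longlonglongrightarrow> 0"
    by (rule Lim_null_comparison[rotated]) (auto simp: uY)
  then have "(X \<circ> r) \<longlonglongrightarrow> u"
    using LIM_zero_cancel tendsto_norm_zero_iff by (fastforce simp: Y_def comp_def)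
  then have Xu: "X \<longlonglongrightarrow> u"
    using Cauchy_converges_subseq[OF assms r] by simp
  have "AE x in lborel. (\<lambda>k. rep_l2 (X (r k)) x) \<longlonglongrightarrow> rep_l2 u x"
    using lim rep_abs_l2[OF hs] by eventually_elim (simp add: f_def Y_def u_def)
  then show ?thesis using Xu r by blast
qed

instance l2 :: (euclidean_space) banach
proof
  fix X :: "nat \<Rightarrow> 'a l2" assume "Cauchy X"
  then show "convergent X" using l2_Cauchy_limit convergentI by blast
qed

section \<open>Test functions and weak derivatives\<close>

lemma frechet_derivative_eq: "(f has_derivative F) (at x) \<Longrightarrow> frechet_derivative f (at x) b = F b"
  using frechet_derivative_at by metis

lemma has_frechet_derivative:
  "f differentiable (at x) \<Longrightarrow> (f has_derivative frechet_derivative f (at x)) (at x)"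
  using frechet_derivative_works by blast

lemma Ck_const: "Ck k (\<lambda>_. c)"
  by (induction k arbitrary: c) (auto simp: frechet_derivative_const)

lemma Ck_Suc_D: "Ck (Suc k) f \<Longrightarrow> Ck k f"
proof (induction k arbitrary: f)
  case 0
  then show ?case
    by (auto intro!: continuous_at_imp_continuous_on differentiable_imp_continuous_within)
qed auto

lemma Ck_add: "Ck k f \<Longrightarrow> Ck k g \<Longrightarrow> Ck k (\<lambda>x. f x + g x)"
proof (induction k arbitrary: f g)
  case 0
  then show ?case by (auto intro: continuous_intros)
next
  case (Suc k)
  have "frechet_derivative (\<lambda>x. f x + g x) (at x) b
      = frechet_derivative f (at x) b + frechet_derivative g (at x) b" for x b
    using Suc.prems by (intro frechet_derivative_eq has_derivative_add has_frechet_derivative) auto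
  then show ?case using Suc by auto
qed

lemma Ck_mult: "Ck k f \<Longrightarrow> Ck k g \<Longrightarrow> Ck k (\<lambda>x. f x * g x)"
proof (induction k arbitrary: f g)
  case 0
  then show ?case by (auto intro: continuous_intros)
next
  case (Suc k)
  have "frechet_derivative (\<lambda>x. f x * g x) (at x) b
      = f x * frechet_derivative g (at x) b + frechet_derivative f (at x) b * g x" for x b
    using Suc.prems by (intro frechet_derivative_eq has_derivative_mult has_frechet_derivative) auto
  moreover have "Ck k f" "Ck k g"
    using Suc.prems Ck_Suc_D by blast+
  ultimately show ?case using Suc by (auto intro!: Ck_add)
qed

lemma Ck_prod: "(\<And>i. i \<in> I \<Longrightarrow> Ck k (f i)) \<Longrightarrow> Ck k (\<lambda>x. \<Prod>i\<in>I. f i x)"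
  by (induction I rule: infinite_finite_induct) (auto simp: Ck_const Ck_mult)

text \<open>For restricting a test function to a slice: the linear part is required to map basis vectors to basis vectors because
\<open>Ck\<close> is defined through derivatives along the basis.\<close>

lemma Ck_affine:
  fixes A :: "'a::euclidean_space \<Rightarrow> 'b::euclidean_space"
  assumes A: "\<And>x. (A has_derivative L) (at x)"
    and LB: "\<And>b. b \<in> Basis \<Longrightarrow> L b \<in> Basis"
  shows "Ck k f \<Longrightarrow> Ck k (\<lambda>x. f (A x))"
proof (induction k arbitrary: f)
  case 0
  have "continuous_on UNIV A"
    using A by (intro continuous_at_imp_continuous_on) (auto intro: has_derivative_continuous)
  then show ?case using 0 by (auto intro: continuous_on_compose2)
next
  case (Suc k)
  have D: "((\<lambda>x. f (A x)) has_derivative (\<lambda>h. frechet_derivative f (at (A x)) (L h))) (at x)" for x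
    using Suc.prems by (intro has_derivative_compose[OF A] has_frechet_derivative) auto
  have "frechet_derivative (\<lambda>x. f (A x)) (at x) b = frechet_derivative f (at (A x)) (L b)" for x b
    by (rule frechet_derivative_eq[OF D])
  moreover have "Ck k (\<lambda>x. frechet_derivative f (at (A x)) (L b))" if "b \<in> Basis" for b
    using Suc.IH[of "\<lambda>y. frechet_derivative f (at y) (L b)"] Suc.prems LB[OF that] by simp
  moreover have "(\<lambda>x. f (A x)) differentiable (at x)" for x
    using D differentiable_def by blast
  ultimately show ?case by simp
qed

text \<open>The powers in the denominator make the family closed under differentiation, so that smoothness of all members
is a single induction.\<close>

definition flat_exp :: "nat \<Rightarrow> real \<Rightarrow> real" where
  "flat_exp m t = (if t > 0 then exp (- 1 / t) / t ^ m else 0)"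

lemma flat_exp_tendsto_0: "(flat_exp m \<longlongrightarrow> 0) (at 0)"
proof -
  have "((\<lambda>t. (inverse t) ^ m / exp (inverse t)) \<longlongrightarrow> (0::real)) (at_right 0)"
    by (rule filterlim_compose[OF tendsto_power_div_exp_0 filterlim_inverse_at_top_right])
  moreover have "\<forall>\<^sub>F t in at_right 0. (inverse t) ^ m / exp (inverse t) = flat_exp m t"
    by (rule eventually_at_rightI[of 0 1])
      (auto simp: flat_exp_def exp_minus field_simps power_inverse)
  ultimately have R: "(flat_exp m \<longlongrightarrow> 0) (at_right 0)"
    by (rule Lim_transform_eventually)
  have L: "(flat_exp m \<longlongrightarrow> 0) (at_left 0)"
    by (rule tendsto_eventually, rule eventually_at_leftI[of "-1"]) (auto simp: flat_exp_def)
  show ?thesis using L R by (simp add: filterlim_at_split)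
qed

lemma flat_exp_deriv:
  "(flat_exp m has_real_derivative (flat_exp (m + 2) t - real m * flat_exp (m + 1) t)) (at t)"
proof -
  consider "t > 0" | "t < 0" | "t = 0" by linarith
  then show ?thesis
  proof cases
    case 1
    have "((\<lambda>t. exp (- 1 / t) / t ^ m) has_real_derivative
        (flat_exp (m + 2) t - real m * flat_exp (m + 1) t)) (at t)"
      using 1 by (cases m)
        (auto intro!: derivative_eq_intros simp: flat_exp_def field_simps power2_eq_square, metis One_nat_def power_eq_if)
    then show ?thesis
      by (rule has_field_derivative_transform_within_open[of _ _ _ "{0<..}"])
        (use 1 in \<open>auto simp: flat_exp_def\<close>)
  next
    case 2
    have "((\<lambda>t. 0) has_real_derivative (flat_exp (m + 2) t - real m * flat_exp (m + 1) t)) (at t)"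
      using 2 by (auto simp: flat_exp_def)
    then show ?thesis
      by (rule has_field_derivative_transform_within_open[of _ _ _ "{..<0}"])
        (use 2 in \<open>auto simp: flat_exp_def\<close>)
  next
    case 3
    have "(\<lambda>h. (flat_exp m (0 + h) - flat_exp m 0) / h) = flat_exp (m + 1)"
      by (auto simp: flat_exp_def fun_eq_iff field_simps)
    then show ?thesis using 3 flat_exp_tendsto_0[of "m+1"]
      by (simp add: DERIV_def flat_exp_def)
  qed
qed

lemma Ck_flat_exp: "Ck k (\<lambda>x::'a::euclidean_space. flat_exp m (c * (x \<bullet> i) + d))"
proof (induction k arbitrary: m)
  have D: "((\<lambda>x::'a. flat_exp m (c * (x \<bullet> i) + d)) has_derivative
      (\<lambda>b. c * (b \<bullet> i) * (flat_exp (m + 2) (c * (x \<bullet> i) + d) - real m * flat_exp (m + 1) (c * (x \<bullet> i) + d))))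
      (at x)" for x m
  proof -
    have "((\<lambda>x::'a. c * (x \<bullet> i) + d) has_derivative (\<lambda>b. c * (b \<bullet> i))) (at x)"
      by (auto intro!: derivative_eq_intros)
    from has_derivative_compose[OF this has_field_derivative_imp_has_derivative[OF flat_exp_deriv[of m "c * (x \<bullet> i) + d"]]]
    show ?thesis by (simp add: mult_ac)
  qed
  {
    case 0
    have "continuous (at x) (\<lambda>x::'a. flat_exp m (c * (x \<bullet> i) + d))" for x
      using D has_derivative_continuous by blast
    then show ?case by (simp add: continuous_at_imp_continuous_on)
  next
    case (Suc k)
    have "frechet_derivative (\<lambda>x::'a. flat_exp m (c * (x \<bullet> i) + d)) (at x) b
      = c * (b \<bullet> i) * (flat_exp (m + 2) (c * (x \<bullet> i) + d) + (- real m) * flat_exp (m + 1) (c * (x \<bullet> i) + d))" for x b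
      using frechet_derivative_eq[OF D] by simp
    moreover have "Ck k (\<lambda>x. c * (b \<bullet> i) * (flat_exp (m + 2) (c * (x \<bullet> i) + d) + (- real m) * flat_exp (m + 1) (c * (x \<bullet> i) + d)))" for b
      by (intro Ck_mult Ck_add Ck_const Suc)
    moreover have "(\<lambda>x. flat_exp m (c * (x \<bullet> i) + d)) differentiable at x" for x
      using D by (auto simp: differentiable_def)
    ultimately show ?case by simp
  }
qed

text \<open>A smooth function that is positive exactly on the open box.  The growing scale \<open>n + 1\<close> makes it
converge pointwise to the indicator of the box; the arguments are written in the form
\<open>c * (x \<bullet> i) + d\<close> of \<open>Ck_flat_exp\<close>.\<close>

definition bump :: "nat \<Rightarrow> 'a::euclidean_space \<Rightarrow> 'a \<Rightarrow> 'a \<Rightarrow> real" where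
  "bump n a b x = (\<Prod>i\<in>Basis. flat_exp 0 (real (Suc n) * (x \<bullet> i) + (- real (Suc n) * (a \<bullet> i)))
      * flat_exp 0 (- real (Suc n) * (x \<bullet> i) + real (Suc n) * (b \<bullet> i)))"

lemma bump_eq: "bump n a b x = (\<Prod>i\<in>Basis. flat_exp 0 (real (Suc n) * (x \<bullet> i - a \<bullet> i))
      * flat_exp 0 (real (Suc n) * (b \<bullet> i - x \<bullet> i)))"
proof -
  have "real (Suc n) * (x \<bullet> i - a \<bullet> i) = real (Suc n) * (x \<bullet> i) + (- real (Suc n) * (a \<bullet> i))"
    "real (Suc n) * (b \<bullet> i - x \<bullet> i) = - real (Suc n) * (x \<bullet> i) + real (Suc n) * (b \<bullet> i)" for i
    by (simp_all add: algebra_simps)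
  then show ?thesis unfolding bump_def by simp
qed

lemma flat_exp_0_bounds: "0 \<le> flat_exp 0 t" "flat_exp 0 t \<le> 1" "t \<le> 0 \<Longrightarrow> flat_exp 0 t = 0"
  by (auto simp: flat_exp_def)

lemma bump_outside: "x \<notin> box a b \<Longrightarrow> bump n a b x = 0"
proof -
  assume "x \<notin> box a b"
  then obtain i where i: "i \<in> Basis" "x \<bullet> i - a \<bullet> i \<le> 0 \<or> b \<bullet> i - x \<bullet> i \<le> 0"
    by (force simp: mem_box)
  then have "real (Suc n) * (x \<bullet> i - a \<bullet> i) \<le> 0 \<or> real (Suc n) * (b \<bullet> i - x \<bullet> i) \<le> 0"
    by (metis mult_nonneg_nonpos of_nat_0_le_iff)
  then have "flat_exp 0 (real (Suc n) * (x \<bullet> i - a \<bullet> i)) * flat_exp 0 (real (Suc n) * (b \<bullet> i - x \<bullet> i)) = 0"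
    using flat_exp_0_bounds(3) by auto
  then show ?thesis unfolding bump_eq using i(1) by (auto intro!: prod_zero)
qed

lemma bump_bounds: "0 \<le> bump n a b x" "bump n a b x \<le> 1"
  unfolding bump_eq
  by (auto intro!: prod_nonneg prod_le_1 mult_nonneg_nonneg mult_le_one simp: flat_exp_0_bounds)

lemma test_function_bump: "test_function (bump n a b)"
  unfolding test_function_def
proof (intro conjI allI)
  show "Ck k (bump n a b)" for k
    unfolding bump_def[abs_def] by (intro Ck_prod Ck_mult Ck_flat_exp)
  have "{x. bump n a b x \<noteq> 0} \<subseteq> cbox a b"
    using bump_outside box_subset_cbox by fastforce
  then have "closure {x. bump n a b x \<noteq> 0} \<subseteq> cbox a b"
    by (simp add: closure_minimal closed_cbox)
  then show "compact (closure {x. bump n a b x \<noteq> 0})"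
    using compact_cbox compact_closure bounded_subset bounded_cbox closure_subset
    by (metis compact_Int_closed closed_closure inf.absorb2)
qed

lemma bump_tendsto:
  fixes a b x :: "'a::euclidean_space"
  shows "(\<lambda>n. bump n a b x) \<longlonglongrightarrow> indicator (box a b) x"
proof (cases "x \<in> box a b")
  case True
  have F: "(\<lambda>n. flat_exp 0 (real (Suc n) * t)) \<longlonglongrightarrow> 1" if "t > 0" for t
  proof -
    have "(\<lambda>n. exp (- (1 / t) * (1 / real (Suc n)))) \<longlonglongrightarrow> exp (- (1 / t) * 0)"
      by (intro tendsto_intros LIMSEQ_Suc[OF lim_1_over_n])
    then show ?thesis using that by (simp add: flat_exp_def mult_ac del: of_nat_Suc)
  qed
  have "(\<lambda>n. bump n a b x) \<longlonglongrightarrow> (\<Prod>i\<in>(Basis :: 'a set). 1 * 1)"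
    unfolding bump_eq by (rule Limits.tendsto_prod, rule tendsto_mult; rule F; use True in \<open>simp add: mem_box\<close>)
  then show ?thesis using True by simp
qed (simp add: bump_outside)

lemma square_integrable_continuous_compact:
  fixes f :: "'a::euclidean_space \<Rightarrow> real"
  assumes f: "continuous_on UNIV f" and S: "compact S" and z: "\<And>x. x \<notin> S \<Longrightarrow> f x = 0"
  shows "square_integrable f"
proof -
  have "integrable lborel (\<lambda>x. indicator S x *\<^sub>R (f x)\<^sup>2)"
    using f by (intro borel_integrable_compact S continuous_intros) (rule continuous_on_subset, auto)
  moreover have "(\<lambda>x. indicator S x *\<^sub>R (f x)\<^sup>2) = (\<lambda>x. (f x)\<^sup>2)"
    using z by (auto simp: fun_eq_iff indicator_def)
  ultimately show ?thesis
    using f by (simp add: square_integrable_def borel_measurable_continuous_onI)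
qed

lemma test_function_deriv_continuous:
  assumes "test_function \<psi>" "b \<in> Basis"
  shows "continuous_on UNIV (\<lambda>x. frechet_derivative \<psi> (at x) b)"
proof -
  have "Ck (Suc 0) \<psi>" using assms by (simp only: test_function_def)
  then show ?thesis using assms by simp
qed

lemma test_function_continuous: "test_function \<psi> \<Longrightarrow> continuous_on UNIV \<psi>"
proof -
  assume "test_function \<psi>"
  then have "Ck 0 \<psi>" by (simp only: test_function_def)
  then show ?thesis by simp
qed

lemma test_function_differentiable: "test_function \<psi> \<Longrightarrow> \<psi> differentiable (at x)"
proof -
  assume "test_function \<psi>"
  then have "Ck (Suc 0) \<psi>" by (simp only: test_function_def)
  then show ?thesis by simp
qed

lemma test_function_deriv_outside:
  assumes "x \<notin> closure {x. \<psi> x \<noteq> 0}"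
  shows "frechet_derivative \<psi> (at x) b = 0"
proof -
  have "(\<psi> has_derivative (\<lambda>_. 0)) (at x)"
  proof (rule has_derivative_transform_within_open)
    show "((\<lambda>_. 0) has_derivative (\<lambda>_. 0)) (at x)" by simp
    show "open (- closure {x. \<psi> x \<noteq> 0})" using closed_closure by (rule open_Compl)
    show "x \<in> - closure {x. \<psi> x \<noteq> 0}" using assms by simp
    show "\<And>y. y \<in> - closure {x. \<psi> x \<noteq> 0} \<Longrightarrow> 0 = \<psi> y"
      using closure_subset[of "{x. \<psi> x \<noteq> 0}"] by auto
  qed
  then show ?thesis by (simp add: frechet_derivative_eq)
qed

lemma test_function_outside: "x \<notin> closure {x. \<psi> x \<noteq> 0} \<Longrightarrow> \<psi> x = 0"
  using closure_subset[of "{x. \<psi> x \<noteq> 0}"] by auto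

lemma square_integrable_test [simp]: "test_function \<psi> \<Longrightarrow> square_integrable \<psi>"
  by (rule square_integrable_continuous_compact[where S = "closure {x. \<psi> x \<noteq> 0}"])
    (use test_function_continuous test_function_outside in \<open>auto simp: test_function_def\<close>)

lemma square_integrable_test_deriv [simp]:
  "test_function \<psi> \<Longrightarrow> b \<in> Basis \<Longrightarrow> square_integrable (\<lambda>x. frechet_derivative \<psi> (at x) b)"
  by (rule square_integrable_continuous_compact[where S = "closure {x. \<psi> x \<noteq> 0}"])
    (use test_function_deriv_continuous test_function_deriv_outside in \<open>auto simp: test_function_def\<close>)

lemma inner_abs_l2_right:
  assumes "square_integrable h"
  shows "inner u (abs_l2 h) = (\<integral>x. rep_l2 u x * h x \<partial>lborel)"
  using inner_abs_l2[OF square_integrable_rep assms] by simp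

text \<open>Boxes form an intersection-stable generator of the Borel sets, so inside a fixed box the integral of \<open>f\<close> vanishes
over every Borel set, in particular over the sets where \<open>f\<close> has a sign.\<close>

lemma box_integrals_zero_imp_AE_zero:
  fixes f :: "'a::euclidean_space \<Rightarrow> real"
  assumes fint: "\<And>a b. integrable lborel (\<lambda>x. f x * indicator (box a b) x)"
    and f0: "\<And>a b. (\<integral>x. f x * indicator (box a b) x \<partial>lborel) = 0"
    and [measurable]: "f \<in> borel_measurable borel"
  shows "AE x in lborel. f x = 0"
proof -
  have step: "AE x in lborel. x \<in> B \<longrightarrow> f x = 0" if B: "B = box c d" for B c d
  proof -
    have Bm[measurable]: "B \<in> sets borel" by (simp add: B)
    have ints: "integrable lborel (\<lambda>x. f x * indicator (A \<inter> B) x)" if [measurable]: "A \<in> sets borel" for A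
      by (rule Bochner_Integration.integrable_bound[OF fint[of c d]]) (auto simp: B indicator_def)
    have zero: "(\<integral>x. f x * indicator (A \<inter> B) x \<partial>lborel) = 0" if "A \<in> sets borel" for A
    proof -
      have "A \<in> sigma_sets UNIV (range (\<lambda>(a, b). box a b :: 'a set))"
        using that by (simp add: borel_eq_box sets_measure_of_conv)
      then show ?thesis
      proof (rule sigma_sets_induct_disjoint[rotated 2])
        show "Int_stable (range (\<lambda>(a, b). box a b :: 'a set))"
          by (auto simp: Int_stable_def box_Int_box)
        show "range (\<lambda>(a, b). box a b :: 'a set) \<subseteq> Pow UNIV" by simp
        show "(\<integral>x. f x * indicator (A \<inter> B) x \<partial>lborel) = 0"
          if "A \<in> range (\<lambda>(a, b). box a b)" for A
          using that f0 by (auto simp: B box_Int_box)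
        show "(\<integral>x. f x * indicator ({} \<inter> B) x \<partial>lborel) = 0" by simp
      next
        fix A assume A: "A \<in> sigma_sets UNIV (range (\<lambda>(a, b). box a b :: 'a set))"
          and IH: "(\<integral>x. f x * indicator (A \<inter> B) x \<partial>lborel) = 0"
        have Am: "A \<in> sets borel" using A by (simp add: borel_eq_box sets_measure_of_conv)
        have "(\<integral>x. f x * indicator ((UNIV - A) \<inter> B) x \<partial>lborel)
          = (\<integral>x. f x * indicator (UNIV \<inter> B) x - f x * indicator (A \<inter> B) x \<partial>lborel)"
          by (rule Bochner_Integration.integral_cong) (auto simp: indicator_def)
        also have "\<dots> = (\<integral>x. f x * indicator (UNIV \<inter> B) x \<partial>lborel) - (\<integral>x. f x * indicator (A \<inter> B) x \<partial>lborel)"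
          using Am by (intro Bochner_Integration.integral_diff ints) auto
        also have "\<dots> = 0" using IH f0[of c d] by (simp add: B)
        finally show "(\<integral>x. f x * indicator ((UNIV - A) \<inter> B) x \<partial>lborel) = 0" .
      next
        fix A :: "nat \<Rightarrow> 'a set"
        assume d: "disjoint_family A"
          and A: "range A \<subseteq> sigma_sets UNIV (range (\<lambda>(a, b). box a b :: 'a set))"
          and IH: "\<And>i. (\<integral>x. f x * indicator (A i \<inter> B) x \<partial>lborel) = 0"
        have Am[measurable]: "A i \<in> sets borel" for i
          using A by (auto simp: borel_eq_box sets_measure_of_conv)
        have "(LINT x:(\<Union>i. A i \<inter> B)|lborel. f x) = (\<Sum>i. LINT x:(A i \<inter> B)|lborel. f x)"
        proof (rule lebesgue_integral_countable_add)
          show "A i \<inter> B \<in> sets lborel" for i by simp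
          show "\<And>i j. i \<noteq> j \<Longrightarrow> (A i \<inter> B) \<inter> (A j \<inter> B) = {}"
            using d by (auto simp: disjoint_family_on_def)
          have "(\<Union>i. A i \<inter> B) = (\<Union>i. A i) \<inter> B" by auto
          then show "set_integrable lborel (\<Union>i. A i \<inter> B) f"
            using ints[of "\<Union>i. A i"] by (simp add: set_integrable_def mult.commute)
        qed
        also have "\<dots> = 0" using IH by (simp add: set_lebesgue_integral_def mult.commute)
        also have "(\<Union>i. A i \<inter> B) = (\<Union>i. A i) \<inter> B" by auto
        finally show "(\<integral>x. f x * indicator (\<Union>(range A) \<inter> B) x \<partial>lborel) = 0"
          by (simp add: set_lebesgue_integral_def mult.commute)
      qed
    qed
    have half: "AE x in lborel. f x * indicator (A \<inter> B) x = 0"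
      if A[measurable]: "A \<in> sets borel" and s: "(\<forall>x\<in>A. 0 \<le> f x) \<or> (\<forall>x\<in>A. f x \<le> 0)" for A
    proof -
      have "AE x in lborel. \<bar>f x * indicator (A \<inter> B) x\<bar> = 0"
      proof (subst integral_nonneg_eq_0_iff_AE[symmetric])
        show "integrable lborel (\<lambda>x. \<bar>f x * indicator (A \<inter> B) x\<bar>)" using ints by simp
        have "(\<integral>x. \<bar>f x * indicator (A \<inter> B) x\<bar> \<partial>lborel) = (\<integral>x. f x * indicator (A \<inter> B) x \<partial>lborel)
            \<or> (\<integral>x. \<bar>f x * indicator (A \<inter> B) x\<bar> \<partial>lborel) = (\<integral>x. - (f x * indicator (A \<inter> B) x) \<partial>lborel)"
          using s by (auto intro!: Bochner_Integration.integral_cong simp: indicator_def)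
        then show "(\<integral>x. \<bar>f x * indicator (A \<inter> B) x\<bar> \<partial>lborel) = 0" using zero[OF A] by auto
      qed simp
      then show ?thesis by simp
    qed
    have "AE x in lborel. f x * indicator ({x. 0 \<le> f x} \<inter> B) x = 0"
      "AE x in lborel. f x * indicator ({x. f x \<le> 0} \<inter> B) x = 0"
      by (rule half; (measurable | auto))+
    then show ?thesis by eventually_elim (auto simp: indicator_def split: if_splits)
  qed
  have "AE x in lborel. \<forall>n::nat. x \<in> box (- real n *\<^sub>R One) (real n *\<^sub>R One) \<longrightarrow> f x = 0"
    unfolding AE_all_countable by (intro allI step[OF refl])
  then show ?thesis
  proof (rule AE_mp, intro AE_I2 impI)
    fix x :: 'a assume *: "\<forall>n::nat. x \<in> box (- real n *\<^sub>R One) (real n *\<^sub>R One) \<longrightarrow> f x = 0"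
    obtain n :: nat where n: "norm x < real n" using reals_Archimedean2 by blast
    have "x \<in> box (- real n *\<^sub>R One) (real n *\<^sub>R One)"
      using n Basis_le_norm[of _ x] by (force simp: mem_box)
    then show "f x = 0" using * by blast
  qed
qed

text \<open>The fundamental lemma of the calculus of variations: bumps approximate indicators of boxes.\<close>

lemma orthogonal_test_functions_zero:
  fixes u :: "'a::euclidean_space l2"
  assumes orth: "\<And>\<psi>. test_function \<psi> \<Longrightarrow> inner u (abs_l2 \<psi>) = 0"
  shows "u = 0"
proof -
  have ind: "square_integrable (indicator (box a b) :: 'a \<Rightarrow> real)" for a b :: 'a
  proof -
    have "(\<lambda>x. (indicator (box a b) x :: real)\<^sup>2) = indicator (box a b)"
      by (auto simp: indicator_def fun_eq_iff)
    then show ?thesis unfolding square_integrable_def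
      using emeasure_lborel_box_finite[of a b] by (auto simp: infinity_ennreal_def)
  qed
  have int: "integrable lborel (\<lambda>x. rep_l2 u x * indicator (box a b) x)" for a b
    by (rule square_integrable_mult[OF square_integrable_rep ind])
  have "AE x in lborel. rep_l2 u x = 0"
  proof (rule box_integrals_zero_imp_AE_zero[OF int])
    fix a b :: 'a
    have [measurable]: "bump n a b \<in> borel_measurable borel" for n
      using square_integrable_measurable[OF square_integrable_test[OF test_function_bump]] .
    have "(\<lambda>n. \<integral>x. rep_l2 u x * bump n a b x \<partial>lborel) \<longlonglongrightarrow> (\<integral>x. rep_l2 u x * indicator (box a b) x \<partial>lborel)"
    proof (rule integral_dominated_convergence[where w = "\<lambda>x. \<bar>rep_l2 u x * indicator (box a b) x\<bar>"])
      show "(\<lambda>x. rep_l2 u x * bump n a b x) \<in> borel_measurable lborel" for n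
        by measurable
      show "integrable lborel (\<lambda>x. \<bar>rep_l2 u x * indicator (box a b) x\<bar>)" using int by simp
      show "AE x in lborel. (\<lambda>n. rep_l2 u x * bump n a b x) \<longlonglongrightarrow> rep_l2 u x * indicator (box a b) x"
        by (intro AE_I2 tendsto_mult tendsto_const bump_tendsto)
      show "AE x in lborel. norm (rep_l2 u x * bump n a b x) \<le> \<bar>rep_l2 u x * indicator (box a b) x\<bar>" for n
        using bump_bounds[of n a b] by (intro AE_I2) (auto simp: indicator_def abs_mult bump_outside mult_left_le)
    qed simp
    moreover have "(\<integral>x. rep_l2 u x * bump n a b x \<partial>lborel) = 0" for n
      using orth[OF test_function_bump] by (simp add: inner_abs_l2_right test_function_bump)
    ultimately show "(\<integral>x. rep_l2 u x * indicator (box a b) x \<partial>lborel) = 0"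
      by (simp add: LIMSEQ_const_iff)
  qed simp
  then have "abs_l2 (rep_l2 u) = abs_l2 (\<lambda>_. 0)"
    by (intro abs_l2_cong) (auto simp: square_integrable_zero)
  then show ?thesis by (simp add: abs_l2_zero)
qed

text \<open>In this form weak differentiability is a family of linear conditions that are continuous in L2, whence linearity and
closedness of weak derivatives.\<close>

lemma has_weak_deriv_iff:
  assumes "b \<in> Basis"
  shows "has_weak_deriv b u g \<longleftrightarrow>
    (\<forall>\<psi>. test_function \<psi> \<longrightarrow>
      inner u (abs_l2 (\<lambda>x. frechet_derivative \<psi> (at x) b)) = - inner g (abs_l2 \<psi>))"
  using assms by (simp add: has_weak_deriv_def inner_abs_l2_right)

lemma has_weak_deriv_unique:
  assumes "b \<in> Basis" "has_weak_deriv b u g" "has_weak_deriv b u g'"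
  shows "g = g'"
proof -
  have "g - g' = 0"
    using assms by (intro orthogonal_test_functions_zero) (auto simp: has_weak_deriv_iff inner_diff_left)
  then show ?thesis by simp
qed

lemma weak_deriv_eq:
  assumes "b \<in> Basis" "has_weak_deriv b u g"
  shows "weak_deriv b u = g"
  unfolding weak_deriv_def using assms has_weak_deriv_unique by blast

lemma H1_I: "(\<And>b. b \<in> Basis \<Longrightarrow> has_weak_deriv b u (g b)) \<Longrightarrow> u \<in> H1"
  unfolding H1_def by blast

lemma H1_has_weak_deriv: "u \<in> H1 \<Longrightarrow> b \<in> Basis \<Longrightarrow> has_weak_deriv b u (weak_deriv b u)"
  unfolding H1_def using weak_deriv_eq by fastforce

lemma has_weak_deriv_0: "b \<in> Basis \<Longrightarrow> has_weak_deriv b 0 0"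
  by (simp add: has_weak_deriv_iff)

lemma has_weak_deriv_add:
  "b \<in> Basis \<Longrightarrow> has_weak_deriv b u g \<Longrightarrow> has_weak_deriv b v h \<Longrightarrow> has_weak_deriv b (u + v) (g + h)"
  by (auto simp: has_weak_deriv_iff inner_add_left)

lemma has_weak_deriv_scaleR:
  "b \<in> Basis \<Longrightarrow> has_weak_deriv b u g \<Longrightarrow> has_weak_deriv b (c *\<^sub>R u) (c *\<^sub>R g)"
  by (auto simp: has_weak_deriv_iff)

lemma subspace_H1: "subspace H1"
proof (rule subspaceI)
  show "0 \<in> H1" by (rule H1_I[OF has_weak_deriv_0])
  show "u + v \<in> H1" if "u \<in> H1" "v \<in> H1" for u v :: "'a::euclidean_space l2"
    by (rule H1_I[OF has_weak_deriv_add]) (use that in \<open>auto intro: H1_has_weak_deriv\<close>)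
  show "c *\<^sub>R u \<in> H1" if "u \<in> H1" for c and u :: "'a::euclidean_space l2"
    by (rule H1_I[OF has_weak_deriv_scaleR]) (use that in \<open>auto intro: H1_has_weak_deriv\<close>)
qed

lemma weak_deriv_add: "u \<in> H1 \<Longrightarrow> v \<in> H1 \<Longrightarrow> b \<in> Basis \<Longrightarrow> weak_deriv b (u + v) = weak_deriv b u + weak_deriv b v"
  by (intro weak_deriv_eq has_weak_deriv_add H1_has_weak_deriv)

lemma weak_deriv_scaleR: "u \<in> H1 \<Longrightarrow> b \<in> Basis \<Longrightarrow> weak_deriv b (c *\<^sub>R u) = c *\<^sub>R weak_deriv b u"
  by (intro weak_deriv_eq has_weak_deriv_scaleR H1_has_weak_deriv)

lemma weak_deriv_diff:
  assumes "u \<in> H1" "v \<in> H1" "b \<in> Basis"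
  shows "weak_deriv b (u - v) = weak_deriv b u - weak_deriv b v"
  using weak_deriv_add[OF assms(1) subspace_scale[OF subspace_H1 assms(2), of "-1"] assms(3)]
    weak_deriv_scaleR[OF assms(2,3), of "-1"] by simp

lemma weak_deriv_sum:
  assumes "\<And>i. i \<in> I \<Longrightarrow> f i \<in> H1" "b \<in> Basis"
  shows "weak_deriv b (\<Sum>i\<in>I. f i) = (\<Sum>i\<in>I. weak_deriv b (f i))"
  using assms(1)
proof (induction I rule: infinite_finite_induct)
  case (insert x F)
  then show ?case by (simp add: weak_deriv_add subspace_sum[OF subspace_H1] assms(2))
qed (auto intro!: weak_deriv_eq has_weak_deriv_0 assms(2))

lemma has_weak_deriv_limit:
  assumes b: "b \<in> Basis" and X: "X \<longlonglongrightarrow> u" and D: "D \<longlonglongrightarrow> g" and XD: "\<And>n. has_weak_deriv b (X n) (D n)"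
  shows "has_weak_deriv b u g"
  unfolding has_weak_deriv_iff[OF b]
proof (intro allI impI)
  fix \<psi> :: "'a \<Rightarrow> real" assume \<psi>: "test_function \<psi>"
  have "(\<lambda>n. inner (X n) (abs_l2 (\<lambda>x. frechet_derivative \<psi> (at x) b))) \<longlonglongrightarrow>
      inner u (abs_l2 (\<lambda>x. frechet_derivative \<psi> (at x) b))"
    by (intro tendsto_intros X)
  moreover have "(\<lambda>n. - inner (D n) (abs_l2 \<psi>)) \<longlonglongrightarrow> - inner g (abs_l2 \<psi>)"
    by (intro tendsto_intros D)
  moreover have "inner (X n) (abs_l2 (\<lambda>x. frechet_derivative \<psi> (at x) b)) = - inner (D n) (abs_l2 \<psi>)" for n
    using XD[of n] \<psi> by (simp add: has_weak_deriv_iff[OF b])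
  ultimately show "inner u (abs_l2 (\<lambda>x. frechet_derivative \<psi> (at x) b)) = - inner g (abs_l2 \<psi>)"
    using LIMSEQ_unique by fastforce
qed

text \<open>The vector \<open>0\<close> is not in \<open>Basis\<close>, so it can serve as the index of the function itself.  The H1 norm is then
the Euclidean norm of the family of L2 norms of the jet, from which it inherits the triangle inequality.\<close>

definition jet :: "'a::euclidean_space l2 \<Rightarrow> 'a \<Rightarrow> 'a l2" where
  "jet u b = (if b = 0 then u else weak_deriv b u)"

lemma h1_inner_self: "h1_inner u u = (norm u)\<^sup>2 + (\<Sum>b\<in>Basis. (norm (weak_deriv b u))\<^sup>2)"
  by (simp add: h1_inner_def power2_norm_eq_inner)

lemma h1_norm_sq: "(h1_norm u)\<^sup>2 = (norm u)\<^sup>2 + (\<Sum>b\<in>Basis. (norm (weak_deriv b u))\<^sup>2)"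
  by (simp add: h1_norm_def h1_inner_self sum_nonneg)

lemma h1_norm_jet: "h1_norm u = L2_set (\<lambda>b. norm (jet u b)) (insert 0 Basis)"
proof -
  have "(\<Sum>b\<in>Basis. (norm (jet u b))\<^sup>2) = (\<Sum>b\<in>Basis. (norm (weak_deriv b u))\<^sup>2)"
    by (intro sum.cong) (auto simp: jet_def)
  then show ?thesis
    by (simp add: h1_norm_def h1_inner_self L2_set_def) (simp add: jet_def)
qed

lemma h1_norm_nonneg: "0 \<le> h1_norm u"
  by (simp add: h1_norm_jet L2_set_nonneg)

lemma norm_jet_le: "b \<in> insert 0 Basis \<Longrightarrow> norm (jet u b) \<le> h1_norm u"
  unfolding h1_norm_jet by (rule member_le_L2_set) auto

lemma norm_le_h1_norm: "norm u \<le> h1_norm u"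
  using norm_jet_le[of 0 u] by (simp add: jet_def)

lemma jet_add: "u \<in> H1 \<Longrightarrow> v \<in> H1 \<Longrightarrow> b \<in> insert 0 Basis \<Longrightarrow> jet (u + v) b = jet u b + jet v b"
  by (auto simp: jet_def weak_deriv_add)

lemma jet_diff: "u \<in> H1 \<Longrightarrow> v \<in> H1 \<Longrightarrow> b \<in> insert 0 Basis \<Longrightarrow> jet (u - v) b = jet u b - jet v b"
  by (auto simp: jet_def weak_deriv_diff)

lemma jet_scaleR: "u \<in> H1 \<Longrightarrow> b \<in> insert 0 Basis \<Longrightarrow> jet (c *\<^sub>R u) b = c *\<^sub>R jet u b"
  by (auto simp: jet_def weak_deriv_scaleR)

lemma h1_norm_triangle:
  assumes "u \<in> H1" "v \<in> H1"
  shows "h1_norm (u + v) \<le> h1_norm u + h1_norm v"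
proof -
  have "h1_norm (u + v) \<le> L2_set (\<lambda>b. norm (jet u b) + norm (jet v b)) (insert 0 Basis)"
    unfolding h1_norm_jet using assms
    by (intro L2_set_mono) (auto simp: jet_add intro: norm_triangle_ineq)
  also have "\<dots> \<le> h1_norm u + h1_norm v"
    unfolding h1_norm_jet by (rule L2_set_triangle_ineq)
  finally show ?thesis .
qed

lemma h1_norm_scaleR:
  assumes "u \<in> H1" shows "h1_norm (c *\<^sub>R u) = \<bar>c\<bar> * h1_norm u"
proof -
  have "h1_norm (c *\<^sub>R u) = L2_set (\<lambda>b. \<bar>c\<bar> * norm (jet u b)) (insert 0 Basis)"
    unfolding h1_norm_jet using assms by (intro L2_set_cong) (auto simp: jet_scaleR)
  then show ?thesis by (simp add: h1_norm_jet L2_set_right_distrib[symmetric])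
qed

lemma h1_norm_0 [simp]: "h1_norm 0 = 0"
  using h1_norm_scaleR[OF subspace_0[OF subspace_H1], of 0] by simp

lemma h1_norm_minus_commute:
  assumes "u \<in> H1" "v \<in> H1" shows "h1_norm (u - v) = h1_norm (v - u)"
  using h1_norm_scaleR[OF subspace_diff[OF subspace_H1 assms], of "-1"] by simp

lemma h1_norm_diff_triangle:
  assumes "u \<in> H1" "v \<in> H1" "w \<in> H1"
  shows "h1_norm (u - w) \<le> h1_norm (u - v) + h1_norm (v - w)"
  using h1_norm_triangle[of "u - v" "v - w"] assms by (simp add: subspace_diff[OF subspace_H1])

lemma H1_complete:
  fixes X :: "nat \<Rightarrow> 'a::euclidean_space l2"
  assumes X: "\<And>n. X n \<in> H1"
    and C: "\<And>e. e > 0 \<Longrightarrow> \<exists>M. \<forall>m\<ge>M. \<forall>n\<ge>M. h1_norm (X m - X n) < e"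
  shows "\<exists>u\<in>H1. (\<lambda>n. h1_norm (X n - u)) \<longlonglongrightarrow> 0"
proof -
  have "convergent (\<lambda>n. jet (X n) b)" if b: "b \<in> insert 0 Basis" for b
  proof -
    have "Cauchy (\<lambda>n. jet (X n) b)"
      unfolding Cauchy_def dist_norm
    proof (intro allI impI)
      fix e :: real assume "e > 0"
      then obtain M where M: "\<forall>m\<ge>M. \<forall>n\<ge>M. h1_norm (X m - X n) < e" using C by blast
      have "norm (jet (X m) b - jet (X n) b) \<le> h1_norm (X m - X n)" for m n
        using norm_jet_le[OF b, of "X m - X n"] by (simp add: jet_diff[OF X X b])
      then show "\<exists>M. \<forall>m\<ge>M. \<forall>n\<ge>M. norm (jet (X m) b - jet (X n) b) < e"
        using M by (meson le_less_trans)
    qed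
    then show ?thesis by (rule Cauchy_convergent)
  qed
  then obtain g where g: "\<And>b. b \<in> insert 0 Basis \<Longrightarrow> (\<lambda>n. jet (X n) b) \<longlonglongrightarrow> g b"
    unfolding convergent_def by metis
  define u where "u = g 0"
  have Xu: "X \<longlonglongrightarrow> u" using g[of 0] by (simp add: jet_def u_def)
  have wd: "has_weak_deriv b u (g b)" if "b \<in> Basis" for b
  proof (rule has_weak_deriv_limit[OF that Xu])
    show "(\<lambda>n. jet (X n) b) \<longlonglongrightarrow> g b" using g that by simp
    show "has_weak_deriv b (X n) (jet (X n) b)" for n
      using H1_has_weak_deriv[OF X that] that nonzero_Basis by (auto simp: jet_def)
  qed
  have u: "u \<in> H1" using wd by (rule H1_I)
  have ju: "jet u b = g b" if "b \<in> insert 0 Basis" for b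
    using that weak_deriv_eq[OF _ wd] by (auto simp: jet_def u_def)
  have "(\<lambda>n. \<Sum>b\<in>insert 0 Basis. norm (jet (X n - u) b)) \<longlonglongrightarrow> (\<Sum>b\<in>insert (0::'a) Basis. 0)"
  proof (intro tendsto_sum)
    fix b :: 'a assume b: "b \<in> insert 0 Basis"
    have "(\<lambda>n. norm (jet (X n) b - g b)) \<longlonglongrightarrow> 0"
      using g[OF b] by (simp add: LIM_zero tendsto_norm_zero)
    then show "(\<lambda>n. norm (jet (X n - u) b)) \<longlonglongrightarrow> 0"
      by (simp add: jet_diff[OF X u b] ju[OF b])
  qed
  then have lim: "(\<lambda>n. \<Sum>b\<in>insert 0 Basis. norm (jet (X n - u) b)) \<longlonglongrightarrow> 0"
    by simp
  have "norm (h1_norm (X n - u)) \<le> (\<Sum>b\<in>insert 0 Basis. norm (jet (X n - u) b))" for n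
    using L2_set_le_sum_abs[of "\<lambda>b. norm (jet (X n - u) b)" "insert 0 Basis"] h1_norm_nonneg[of "X n - u"]
    by (simp only: h1_norm_jet[symmetric] real_norm_def abs_of_nonneg abs_norm_cancel)
  then have "(\<lambda>n. h1_norm (X n - u)) \<longlonglongrightarrow> 0"
    by (intro Lim_null_comparison[OF _ lim] always_eventually allI)
  then show ?thesis using u by blast
qed

section \<open>Tensor products of one-particle functions\<close>

lemma axis_Basis: "e \<in> Basis \<Longrightarrow> axis j e \<in> Basis"
  by (auto simp: Basis_vec_def)

lemma Basis_vec_bij: "bij_betw (\<lambda>(i, b). axis i b) (UNIV \<times> Basis) (Basis :: ('a::euclidean_space ^ 'n::finite) set)"
proof (rule bij_betwI')
  fix x y :: "'n \<times> 'a" assume "x \<in> UNIV \<times> Basis" "y \<in> UNIV \<times> Basis"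
  then show "((case x of (i, b) \<Rightarrow> axis i b) = (case y of (i, b) \<Rightarrow> axis i b)) = (x = y)"
    using nonzero_Basis by (auto simp: axis_eq_axis)
qed (auto simp: Basis_vec_def)

lemma sum_Basis_vec:
  "(\<Sum>b\<in>(Basis :: ('a::euclidean_space ^ 'n::finite) set). F b) = (\<Sum>j\<in>UNIV. \<Sum>e\<in>Basis. F (axis j e))"
  by (subst sum.reindex_bij_betw[OF Basis_vec_bij, symmetric]) (simp add: sum.cartesian_product case_prod_unfold)

lemma prod_Basis_vec:
  "(\<Prod>b\<in>(Basis :: ('a::euclidean_space ^ 'n::finite) set). F b) = (\<Prod>j\<in>UNIV. \<Prod>e\<in>Basis. F (axis j e))"
  by (subst prod.reindex_bij_betw[OF Basis_vec_bij, symmetric]) (simp add: prod.cartesian_product case_prod_unfold)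

lemma box_vec: "box l u = {x :: 'a::euclidean_space ^ 'n::finite. \<forall>i. x $ i \<in> box (l $ i) (u $ i)}"
  by (auto simp: mem_box Basis_vec_def inner_axis)

lemma measurable_vec_nth [measurable]: "(\<lambda>x :: 'a::euclidean_space ^ 'n::finite. x $ i) \<in> borel_measurable borel"
  by (intro borel_measurable_continuous_onI continuous_intros)

lemma measurable_vec_lambda [measurable]:
  "(\<lambda>f. \<chi> i. f i) \<in> borel_measurable (\<Pi>\<^sub>M i\<in>(UNIV :: 'n::finite set). (lborel :: 'a::euclidean_space measure))"
  by (subst borel_measurable_euclidean_space) (auto simp: Basis_vec_def inner_axis)

text \<open>Lebesgue measure on configurations is the product of the Lebesgue measures of the particles; this makes Fubini's theorem
available particle by particle.\<close>

lemma lborel_vec: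
  "(lborel :: ('a::euclidean_space ^ 'n::finite) measure)
    = distr (\<Pi>\<^sub>M i\<in>(UNIV :: 'n set). (lborel :: 'a measure)) borel (\<lambda>f. \<chi> i. f i)"
proof (rule lborel_eqI)
  interpret product_sigma_finite "\<lambda>_ :: 'n. lborel :: 'a measure" by standard
  fix l u :: "'a ^ 'n" assume lu: "\<And>b. b \<in> Basis \<Longrightarrow> l \<bullet> b \<le> u \<bullet> b"
  have le: "l $ i \<bullet> b \<le> u $ i \<bullet> b" if "b \<in> Basis" for i b
    using lu[OF axis_Basis[OF that, of i]] by (simp add: inner_axis)
  have "(\<lambda>f. \<chi> i. f i) -` box l u \<inter> space (\<Pi>\<^sub>M i\<in>(UNIV :: 'n set). (lborel :: 'a measure))
      = (\<Pi>\<^sub>E i\<in>UNIV. box (l $ i) (u $ i))"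
    by (auto simp: box_vec space_PiM)
  then have "emeasure (distr (\<Pi>\<^sub>M i\<in>(UNIV :: 'n set). (lborel :: 'a measure)) borel (\<lambda>f. \<chi> i. f i)) (box l u)
      = (\<Prod>i\<in>UNIV. emeasure lborel (box (l $ i) (u $ i)))"
    by (simp add: emeasure_distr emeasure_PiM)
  also have "\<dots> = (\<Prod>i\<in>UNIV. ennreal (\<Prod>b\<in>Basis. (u $ i - l $ i) \<bullet> b))"
    using le by (simp add: emeasure_lborel_box)
  also have "\<dots> = ennreal (\<Prod>i\<in>UNIV. \<Prod>b\<in>Basis. (u $ i - l $ i) \<bullet> b)"
    using le by (intro prod_ennreal prod_nonneg) (auto simp: inner_diff_left)
  finally show "emeasure (distr (\<Pi>\<^sub>M i\<in>(UNIV :: 'n set). (lborel :: 'a measure)) borel (\<lambda>f. \<chi> i. f i)) (box l u)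
      = ennreal (\<Prod>b\<in>Basis. (u - l) \<bullet> b)"
    by (simp add: prod_Basis_vec inner_axis)
qed simp

lemma integral_lborel_vec:
  fixes f :: "'a::euclidean_space ^ 'n::finite \<Rightarrow> real"
  assumes [measurable]: "f \<in> borel_measurable borel"
  shows "(\<integral>x. f x \<partial>lborel) = (\<integral>g. f (\<chi> i. g i) \<partial>(\<Pi>\<^sub>M i\<in>(UNIV :: 'n set). (lborel :: 'a measure)))"
  by (subst lborel_vec) (simp add: integral_distr)

lemma integrable_lborel_vec:
  fixes f :: "'a::euclidean_space ^ 'n::finite \<Rightarrow> real"
  assumes [measurable]: "f \<in> borel_measurable borel"
  shows "integrable lborel f \<longleftrightarrow> integrable (\<Pi>\<^sub>M i\<in>(UNIV :: 'n set). (lborel :: 'a measure)) (\<lambda>g. f (\<chi> i. g i))"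
  by (subst lborel_vec) (simp add: integrable_distr_eq)

lemma integral_prod_vec:
  fixes f :: "'n::finite \<Rightarrow> 'a::euclidean_space \<Rightarrow> real"
  assumes f: "\<And>i. integrable lborel (f i)"
  shows "integrable lborel (\<lambda>x. \<Prod>i\<in>UNIV. f i (x $ i))"
    and "(\<integral>x. (\<Prod>i\<in>UNIV. f i (x $ i)) \<partial>lborel) = (\<Prod>i\<in>UNIV. \<integral>x. f i x \<partial>lborel)"
proof -
  interpret product_sigma_finite "\<lambda>_ :: 'n. lborel :: 'a measure" by standard
  have [measurable]: "f i \<in> borel_measurable borel" for i using f[of i] by auto
  show "integrable lborel (\<lambda>x. \<Prod>i\<in>UNIV. f i (x $ i))"
    by (subst integrable_lborel_vec) (auto intro!: product_integrable_prod f)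
  show "(\<integral>x. (\<Prod>i\<in>UNIV. f i (x $ i)) \<partial>lborel) = (\<Prod>i\<in>UNIV. \<integral>x. f i x \<partial>lborel)"
    by (subst integral_lborel_vec) (auto intro!: product_integral_prod f)
qed

definition tensor :: "('n::finite \<Rightarrow> 'a::euclidean_space l2) \<Rightarrow> ('a ^ 'n) l2" where
  "tensor F = abs_l2 (\<lambda>x. \<Prod>i\<in>UNIV. rep_l2 (F i) (x $ i))"

lemma square_integrable_prod_vec:
  fixes f :: "'n::finite \<Rightarrow> 'a::euclidean_space \<Rightarrow> real"
  assumes "\<And>i. square_integrable (f i)"
  shows "square_integrable (\<lambda>x. \<Prod>i\<in>UNIV. f i (x $ i))"
proof -
  have [measurable]: "f i \<in> borel_measurable borel" for i
    using assms square_integrable_measurable by blast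
  have "integrable lborel (\<lambda>x :: 'a ^ 'n. \<Prod>i\<in>UNIV. (f i (x $ i))\<^sup>2)"
    using assms by (intro integral_prod_vec(1)) (simp add: square_integrable_def)
  then show ?thesis by (simp add: square_integrable_def prod_power_distrib)
qed

lemma square_integrable_tensor [simp]:
  "square_integrable (\<lambda>x. \<Prod>i\<in>UNIV. rep_l2 (F i) (x $ i))"
  by (rule square_integrable_prod_vec[where f = "\<lambda>i. rep_l2 (F i)"]) simp

lemma inner_tensor: "inner (tensor F) (tensor G) = (\<Prod>i\<in>UNIV. inner (F i) (G i))"
proof -
  have "inner (tensor F) (tensor G)
      = (\<integral>x. (\<Prod>i\<in>UNIV. rep_l2 (F i) (x $ i) * rep_l2 (G i) (x $ i)) \<partial>lborel)"
    by (simp add: tensor_def inner_abs_l2 prod.distrib)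
  also have "\<dots> = (\<Prod>i\<in>UNIV. inner (F i) (G i))"
    by (subst integral_prod_vec(2)) (auto intro: square_integrable_mult simp: inner_l2_rep)
  finally show ?thesis .
qed

lemma test_function_slice:
  fixes \<psi> :: "'a::euclidean_space ^ 'n::finite \<Rightarrow> real"
  assumes \<psi>: "test_function \<psi>"
  shows "test_function (\<lambda>z. \<psi> (\<chi> i. (y(j := z)) i))"
    and "frechet_derivative (\<lambda>z. \<psi> (\<chi> i. (y(j := z)) i)) (at z) e
      = frechet_derivative \<psi> (at (\<chi> i. (y(j := z)) i)) (axis j e)"
proof -
  define A :: "'a \<Rightarrow> 'a ^ 'n" where "A z = (\<chi> i. (y(j := z)) i)" for z
  have A_eq: "A = (\<lambda>z. A 0 + axis j z)"
    by (auto simp: A_def vec_eq_iff axis_def fun_eq_iff)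
  have lin: "linear (\<lambda>z::'a. axis j z :: 'a ^ 'n)"
    by (auto intro!: linearI simp: vec_eq_iff axis_def)
  have D: "(A has_derivative (\<lambda>z. axis j z)) (at z)" for z
    by (subst A_eq) (auto intro!: derivative_eq_intros linear_imp_has_derivative lin)
  have dpsi: "\<psi> differentiable (at x)" for x using \<psi> by (rule test_function_differentiable)
  have "((\<lambda>z. \<psi> (A z)) has_derivative (\<lambda>h. frechet_derivative \<psi> (at (A z)) (axis j h))) (at z)" for z
    by (rule has_derivative_compose[OF D has_frechet_derivative[OF dpsi]])
  then show "frechet_derivative (\<lambda>z. \<psi> (\<chi> i. (y(j := z)) i)) (at z) e
      = frechet_derivative \<psi> (at (\<chi> i. (y(j := z)) i)) (axis j e)"
    unfolding A_def by (rule frechet_derivative_eq)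
  have "Ck k (\<lambda>z. \<psi> (A z))" for k
    by (rule Ck_affine[OF D axis_Basis]) (use \<psi> in \<open>auto simp: test_function_def\<close>)
  moreover have "compact (closure {z. \<psi> (A z) \<noteq> 0})"
  proof -
    let ?S = "(\<lambda>x. x $ j) ` closure {x. \<psi> x \<noteq> 0}"
    have c: "compact ?S"
      using \<psi> by (intro compact_continuous_image continuous_intros) (auto simp: test_function_def)
    have "{z. \<psi> (A z) \<noteq> 0} \<subseteq> ?S"
    proof
      fix z assume "z \<in> {z. \<psi> (A z) \<noteq> 0}"
      then have "A z \<in> closure {x. \<psi> x \<noteq> 0}" using closure_subset by force
      moreover have "z = A z $ j" by (simp add: A_def)
      ultimately show "z \<in> ?S" by blast
    qed
    then show ?thesis
      using bounded_subset[OF compact_imp_bounded[OF c]] by simp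
  qed
  ultimately show "test_function (\<lambda>z. \<psi> (\<chi> i. (y(j := z)) i))"
    by (simp add: test_function_def A_def)
qed

text \<open>Fubini in the form that singles out particle \<open>j\<close>.\<close>

lemma integral_tensor_slice:
  fixes F :: "'n::finite \<Rightarrow> 'a::euclidean_space l2" and h :: "'a ^ 'n \<Rightarrow> real"
  assumes h: "square_integrable h"
  shows "(\<integral>x. rep_l2 (tensor F) x * h x \<partial>lborel)
    = (\<integral>y. (\<Prod>i\<in>UNIV-{j}. rep_l2 (F i) (y i)) *
        (\<integral>z. rep_l2 (F j) z * h (\<chi> i. (y(j := z)) i) \<partial>lborel)
        \<partial>(\<Pi>\<^sub>M i\<in>UNIV-{j}. lborel))"
proof -
  interpret product_sigma_finite "\<lambda>_ :: 'n. lborel :: 'a measure" by standard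
  let ?f = "\<lambda>x :: 'a ^ 'n. (\<Prod>i\<in>UNIV. rep_l2 (F i) (x $ i)) * h x"
  have [measurable]: "h \<in> borel_measurable borel" using h by (rule square_integrable_measurable)
  have sq: "square_integrable (\<lambda>x. \<Prod>i\<in>UNIV. rep_l2 (F i) (x $ i))"
    by (rule square_integrable_tensor)
  have int: "integrable lborel ?f" by (rule square_integrable_mult[OF sq h])
  have ins: "insert j (UNIV - {j}) = (UNIV :: 'n set)" by auto
  have int': "integrable (\<Pi>\<^sub>M i\<in>insert j (UNIV - {j}). (lborel :: 'a measure)) (\<lambda>g. ?f (\<chi> i. g i))"
    using int unfolding ins by (subst (asm) integrable_lborel_vec) auto
  have "(\<integral>x. rep_l2 (tensor F) x * h x \<partial>lborel) = (\<integral>x. ?f x \<partial>lborel)"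
    using rep_abs_l2[OF sq] by (intro integral_cong_AE) (auto simp: tensor_def)
  also have "\<dots> = (\<integral>g. ?f (\<chi> i. g i) \<partial>(\<Pi>\<^sub>M i\<in>insert j (UNIV - {j}). (lborel :: 'a measure)))"
    unfolding ins by (rule integral_lborel_vec) measurable
  also have "\<dots> = (\<integral>y. \<integral>z. ?f (\<chi> i. (y(j := z)) i) \<partial>lborel \<partial>(\<Pi>\<^sub>M i\<in>UNIV-{j}. lborel))"
    by (rule product_integral_insert[OF _ _ int']) auto
  also have "\<dots> = (\<integral>y. (\<Prod>i\<in>UNIV-{j}. rep_l2 (F i) (y i)) *
        (\<integral>z. rep_l2 (F j) z * h (\<chi> i. (y(j := z)) i) \<partial>lborel) \<partial>(\<Pi>\<^sub>M i\<in>UNIV-{j}. lborel))"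
  proof (rule Bochner_Integration.integral_cong[OF refl])
    fix y :: "'n \<Rightarrow> 'a"
    have "(\<Prod>i\<in>UNIV. rep_l2 (F i) ((y(j := z)) i))
        = rep_l2 (F j) z * (\<Prod>i\<in>UNIV-{j}. rep_l2 (F i) (y i))" for z
      by (subst prod.remove[of _ j]) auto
    then have "(\<integral>z. ?f (\<chi> i. (y(j := z)) i) \<partial>lborel)
      = (\<integral>z. (\<Prod>i\<in>UNIV-{j}. rep_l2 (F i) (y i)) * (rep_l2 (F j) z * h (\<chi> i. (y(j := z)) i)) \<partial>lborel)"
      by (intro Bochner_Integration.integral_cong) (simp_all add: mult_ac)
    then show "(\<integral>z. ?f (\<chi> i. (y(j := z)) i) \<partial>lborel) = (\<Prod>i\<in>UNIV-{j}. rep_l2 (F i) (y i)) *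
        (\<integral>z. rep_l2 (F j) z * h (\<chi> i. (y(j := z)) i) \<partial>lborel)"
      by simp
  qed
  finally show ?thesis .
qed

text \<open>On each slice the test function is a test function of particle \<open>j\<close> alone, so the one-particle
integration by parts applies under the integral over the other particles.\<close>

lemma has_weak_deriv_tensor:
  fixes F :: "'n::finite \<Rightarrow> 'a::euclidean_space l2"
  assumes e: "e \<in> Basis" and d: "has_weak_deriv e (F j) d"
  shows "has_weak_deriv (axis j e) (tensor F) (tensor (F(j := d)))"
  unfolding has_weak_deriv_def
proof (intro allI impI)
  fix \<psi> :: "'a ^ 'n \<Rightarrow> real" assume \<psi>: "test_function \<psi>"
  have slice: "(\<integral>z. rep_l2 (F j) z * frechet_derivative \<psi> (at (\<chi> i. (y(j := z)) i)) (axis j e) \<partial>lborel)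
      = - (\<integral>z. rep_l2 d z * \<psi> (\<chi> i. (y(j := z)) i) \<partial>lborel)" for y
    using d[unfolded has_weak_deriv_def, rule_format, OF test_function_slice(1)[OF \<psi>, of y j]]
    unfolding test_function_slice(2)[OF \<psi>] .
  have "(\<integral>x. rep_l2 (tensor F) x * frechet_derivative \<psi> (at x) (axis j e) \<partial>lborel)
    = - (\<integral>y. (\<Prod>i\<in>UNIV-{j}. rep_l2 (F i) (y i)) *
        (\<integral>z. rep_l2 d z * \<psi> (\<chi> i. (y(j := z)) i) \<partial>lborel) \<partial>(\<Pi>\<^sub>M i\<in>UNIV-{j}. lborel))"
    by (subst integral_tensor_slice[where j = j])
      (simp_all only: slice mult_minus_right Bochner_Integration.integral_minus square_integrable_test_deriv[OF \<psi> axis_Basis[OF e]])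
  also have "\<dots> = - (\<integral>x. rep_l2 (tensor (F(j := d))) x * \<psi> x \<partial>lborel)"
    by (subst integral_tensor_slice[where j = j]) (simp_all add: \<psi> fun_upd_def)
  finally show "(\<integral>x. rep_l2 (tensor F) x * frechet_derivative \<psi> (at x) (axis j e) \<partial>lborel)
    = - (\<integral>x. rep_l2 (tensor (F(j := d))) x * \<psi> x \<partial>lborel)" .
qed

text \<open>Relabelling the particles preserves Lebesgue measure.\<close>

lemma AE_lborel_permute:
  fixes P :: "'a::euclidean_space ^ 'n::finite \<Rightarrow> bool"
  assumes p: "p permutes UNIV" and P: "AE x in lborel. P x"
  shows "AE x in lborel. P (\<chi> j. x $ p j)"
proof -
  have [measurable]: "(\<lambda>x :: 'a ^ 'n. \<chi> j. x $ p j) \<in> borel_measurable borel"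
    by (subst borel_measurable_euclidean_space) (auto simp: Basis_vec_def inner_axis)
  have eq: "(lborel :: ('a ^ 'n) measure) = distr lborel borel (\<lambda>x. \<chi> j. x $ p j)"
  proof (rule lborel_eqI)
    fix l u :: "'a ^ 'n" assume lu: "\<And>b. b \<in> Basis \<Longrightarrow> l \<bullet> b \<le> u \<bullet> b"
    define l' u' :: "'a ^ 'n" where "l' = (\<chi> k. l $ inv p k)" and "u' = (\<chi> k. u $ inv p k)"
    have pre: "(\<lambda>x. \<chi> j. x $ p j) -` box l u = box l' u'"
    proof -
      have "(\<forall>i. x $ p i \<in> box (l $ i) (u $ i)) \<longleftrightarrow> (\<forall>k. x $ k \<in> box (l $ inv p k) (u $ inv p k))" for x :: "'a ^ 'n"
        using permutes_inverses[OF p] by metis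
      then show ?thesis by (auto simp: box_vec l'_def u'_def)
    qed
    have le: "l' \<bullet> b \<le> u' \<bullet> b" if "b \<in> Basis" for b
    proof -
      obtain k e where b: "b = axis k e" "e \<in> Basis" using \<open>b \<in> Basis\<close> by (auto simp: Basis_vec_def)
      show ?thesis using lu[OF axis_Basis[OF b(2), of "inv p k"]] by (simp add: b inner_axis l'_def u'_def)
    qed
    have "(\<Prod>b\<in>Basis. (u' - l') \<bullet> b) = (\<Prod>k\<in>UNIV. \<Prod>e\<in>Basis. (u $ inv p k - l $ inv p k) \<bullet> e)"
      by (simp add: prod_Basis_vec inner_axis l'_def u'_def)
    also have "\<dots> = (\<Prod>k\<in>UNIV. \<Prod>e\<in>Basis. (u $ k - l $ k) \<bullet> e)"
      using prod.permute[OF permutes_inv[OF p], of "\<lambda>k. \<Prod>e\<in>Basis. (u $ k - l $ k) \<bullet> e"]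
      by (simp add: comp_def)
    also have "\<dots> = (\<Prod>b\<in>Basis. (u - l) \<bullet> b)"
      by (simp add: prod_Basis_vec inner_axis)
    finally show "emeasure (distr lborel borel (\<lambda>x. \<chi> j. x $ p j)) (box l u) = ennreal (\<Prod>b\<in>Basis. (u - l) \<bullet> b)"
      using le by (simp add: emeasure_distr pre emeasure_lborel_box)
  qed simp
  have "AE x in distr lborel borel (\<lambda>x. \<chi> j. x $ p j). P x"
    unfolding eq[symmetric] by (rule P)
  then show ?thesis by (rule AE_distrD[rotated]) simp
qed

lemma antisym_L2_I:
  fixes f :: "('n::finite) config \<Rightarrow> real"
  assumes f: "square_integrable f"
    and s: "\<And>p. p permutes (UNIV :: 'n set) \<Longrightarrow> AE x in lborel. f (\<chi> j. x $ p j) = of_int (sign p) * f x"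
  shows "abs_l2 f \<in> antisym_L2"
  unfolding antisym_L2_def mem_Collect_eq
proof (intro allI impI)
  fix p :: "'n \<Rightarrow> 'n" assume p: "p permutes UNIV"
  show "AE x in lborel. rep_l2 (abs_l2 f) (\<chi> j. x $ p j) = of_int (sign p) * rep_l2 (abs_l2 f) x"
    using AE_lborel_permute[OF p rep_abs_l2[OF f]] rep_abs_l2[OF f] s[OF p] by eventually_elim simp
qed

lemma subspace_antisym_L2: "subspace (antisym_L2 :: ('n::finite) config l2 set)"
proof (rule subspaceI)
  have "(abs_l2 (\<lambda>_. 0) :: 'n config l2) \<in> antisym_L2"
    by (rule antisym_L2_I) (auto simp: square_integrable_zero)
  then show "(0 :: 'n config l2) \<in> antisym_L2"
    by (simp add: abs_l2_zero)
  fix u v :: "'n config l2" assume u: "u \<in> antisym_L2" and v: "v \<in> antisym_L2"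
  have "abs_l2 (\<lambda>x. rep_l2 u x + rep_l2 v x) \<in> antisym_L2"
  proof (rule antisym_L2_I)
    fix p :: "'n \<Rightarrow> 'n" assume p: "p permutes UNIV"
    have "AE x in lborel. rep_l2 u (\<chi> j. x $ p j) = of_int (sign p) * rep_l2 u x"
      "AE x in lborel. rep_l2 v (\<chi> j. x $ p j) = of_int (sign p) * rep_l2 v x"
      using u v p by (auto simp: antisym_L2_def)
    then show "AE x in lborel. rep_l2 u (\<chi> j. x $ p j) + rep_l2 v (\<chi> j. x $ p j)
        = of_int (sign p) * (rep_l2 u x + rep_l2 v x)"
      by eventually_elim (simp add: algebra_simps)
  qed (simp add: square_integrable_add)
  then show "u + v \<in> antisym_L2" by (simp add: abs_l2_add)
  fix c
  have "abs_l2 (\<lambda>x. c * rep_l2 u x) \<in> antisym_L2"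
  proof (rule antisym_L2_I)
    fix p :: "'n \<Rightarrow> 'n" assume p: "p permutes UNIV"
    have "AE x in lborel. rep_l2 u (\<chi> j. x $ p j) = of_int (sign p) * rep_l2 u x"
      using u p by (auto simp: antisym_L2_def)
    then show "AE x in lborel. c * rep_l2 u (\<chi> j. x $ p j) = of_int (sign p) * (c * rep_l2 u x)"
      by eventually_elim simp
  qed (simp add: square_integrable_scale)
  then show "c *\<^sub>R u \<in> antisym_L2" by (simp add: abs_l2_scale)
qed

lemma antisym_L2_closed:
  fixes X :: "nat \<Rightarrow> 'n::finite config l2"
  assumes X: "X \<longlonglongrightarrow> u" and a: "\<And>n. X n \<in> antisym_L2"
  shows "u \<in> antisym_L2"
proof -
  obtain v r where v: "X \<longlonglongrightarrow> v" and r: "strict_mono (r :: nat \<Rightarrow> nat)"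
    and lim: "AE x in lborel. (\<lambda>k. rep_l2 (X (r k)) x) \<longlonglongrightarrow> rep_l2 v x"
    using l2_Cauchy_limit[OF LIMSEQ_imp_Cauchy[OF X]] by blast
  have uv: "u = v" using X v LIMSEQ_unique by blast
  have "AE x in lborel. rep_l2 u (\<chi> j. x $ p j) = of_int (sign p) * rep_l2 u x"
    if p: "p permutes UNIV" for p :: "'n \<Rightarrow> 'n"
  proof -
    have "AE x in lborel. \<forall>k. rep_l2 (X (r k)) (\<chi> j. x $ p j) = of_int (sign p) * rep_l2 (X (r k)) x"
      unfolding AE_all_countable using a p by (auto simp: antisym_L2_def)
    then show ?thesis using lim AE_lborel_permute[OF p lim]
    proof eventually_elim
      fix x :: "'n config"
      assume 1: "\<forall>k. rep_l2 (X (r k)) (\<chi> j. x $ p j) = of_int (sign p) * rep_l2 (X (r k)) x"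
        and 2: "(\<lambda>k. rep_l2 (X (r k)) x) \<longlonglongrightarrow> rep_l2 v x"
        and 3: "(\<lambda>k. rep_l2 (X (r k)) (\<chi> j. x $ p j)) \<longlonglongrightarrow> rep_l2 v (\<chi> j. x $ p j)"
      have "(\<lambda>k. of_int (sign p) * rep_l2 (X (r k)) x) \<longlonglongrightarrow> of_int (sign p) * rep_l2 v x"
        by (intro tendsto_intros 2)
      then have "(\<lambda>k. rep_l2 (X (r k)) (\<chi> j. x $ p j)) \<longlonglongrightarrow> of_int (sign p) * rep_l2 v x"
        by (simp only: 1[rule_format])
      from LIMSEQ_unique[OF 3 this]
      show "rep_l2 u (\<chi> j. x $ p j) = of_int (sign p) * rep_l2 u x"
        by (simp add: uv)
    qed
  qed
  then show ?thesis by (simp add: antisym_L2_def)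
qed

section \<open>Permutation signs and Slater determinants\<close>

definition ord_sign :: "'b::linorder \<Rightarrow> 'b \<Rightarrow> real" where
  "ord_sign a b = (if a < b then 1 else - 1)"

lemma ord_sign_square [simp]: "ord_sign a b * ord_sign a b = 1"
  by (simp add: ord_sign_def)

lemma ord_sign_swap: "a \<noteq> b \<Longrightarrow> ord_sign b a = - ord_sign a b"
  by (auto simp: ord_sign_def)

definition ordered_pairs :: "'a::linorder set \<Rightarrow> ('a \<times> 'a) set" where
  "ordered_pairs S = {(i, k). i \<in> S \<and> k \<in> S \<and> i < k}"

lemma finite_ordered_pairs [simp]: "finite S \<Longrightarrow> finite (ordered_pairs S)"
  by (rule finite_subset[of _ "S \<times> S"]) (auto simp: ordered_pairs_def)

text \<open>For injective \<open>f\<close>, the parity of its number of inversions.  All signs are brought into this form, because a product over pairs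
can be split along any decomposition of the index set.\<close>

definition pair_sign :: "'a::linorder set \<Rightarrow> ('a \<Rightarrow> 'b::linorder) \<Rightarrow> real" where
  "pair_sign S f = (\<Prod>(i, k)\<in>ordered_pairs S. ord_sign (f i) (f k))"

lemma pair_sign_square [simp]: "pair_sign S f * pair_sign S f = 1"
  unfolding pair_sign_def prod.distrib[symmetric]
  by (intro prod.neutral) auto

lemma pair_sign_strict_mono:
  "(\<And>i k. i \<in> S \<Longrightarrow> k \<in> S \<Longrightarrow> i < k \<Longrightarrow> f i < f k) \<Longrightarrow> pair_sign S f = 1"
  unfolding pair_sign_def by (intro prod.neutral) (auto simp: ordered_pairs_def ord_sign_def)

text \<open>Sorting each transposed pair permutes the set of pairs, so the quotient of the two signs is the parity of the inversions of
the transposition: the pair \<open>(a, b)\<close> and two pairs for each point strictly in between.\<close>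

lemma pair_sign_transpose:
  assumes S: "finite S" and f: "inj_on f S" and ab: "a \<in> S" "b \<in> S" "a < b"
  shows "pair_sign S (f \<circ> Transposition.transpose a b) = - pair_sign S f"
proof -
  let ?t = "Transposition.transpose a b" and ?Q = "ordered_pairs S"
  \<comment> \<open>The involution that transposes a pair and sorts it again.\<close>
  define m where "m = (\<lambda>(i, k). (min (?t i) (?t k), max (?t i) (?t k)))"
  have tS: "?t i \<in> S \<longleftrightarrow> i \<in> S" for i using ab by (auto simp: Transposition.transpose_def)
  have mQ: "m q \<in> ?Q" "m (m q) = q" if "q \<in> ?Q" for q
    using that ab by (auto simp: m_def ordered_pairs_def Transposition.transpose_def min_def max_def split: if_splits)
  have bij: "bij_betw m ?Q ?Q"
    using mQ by (intro bij_betw_byWitness[where f' = m]) auto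
  have split: "ord_sign (f (?t i)) (f (?t k)) =
      (case m (i, k) of (i', k') \<Rightarrow> ord_sign (f i') (f k')) * ord_sign (?t i) (?t k)"
    if "(i, k) \<in> ?Q" for i k
  proof -
    have "i \<in> S" "k \<in> S" "i \<noteq> k" using that by (auto simp: ordered_pairs_def)
    then have "?t i \<noteq> ?t k" using ab by (auto simp: Transposition.transpose_def)
    then have ne: "f (?t i) \<noteq> f (?t k)"
      using f \<open>i \<in> S\<close> \<open>k \<in> S\<close> tS by (auto dest: inj_onD)
    show ?thesis
    proof (cases "?t i < ?t k")
      case True
      then show ?thesis by (simp add: m_def ord_sign_def)
    next
      case False
      then have "?t k < ?t i" using \<open>?t i \<noteq> ?t k\<close> by simp
      then have "min (?t i) (?t k) = ?t k" "max (?t i) (?t k) = ?t i" "ord_sign (?t i) (?t k) = - 1"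
        by (simp_all add: ord_sign_def)
      then show ?thesis using ord_sign_swap[OF ne] by (simp only: m_def prod.case)
    qed
  qed
  let ?M = "{k \<in> S. a < k \<and> k < b}"
  have "pair_sign S (f \<circ> ?t) = (\<Prod>q\<in>?Q. (case m q of (i', k') \<Rightarrow> ord_sign (f i') (f k')) *
      (case q of (i, k) \<Rightarrow> ord_sign (?t i) (?t k)))"
    unfolding pair_sign_def by (intro prod.cong) (auto simp: split)
  also have "\<dots> = pair_sign S f * (\<Prod>(i, k)\<in>?Q. ord_sign (?t i) (?t k))"
    unfolding prod.distrib pair_sign_def
    by (subst prod.reindex_bij_betw[OF bij, of "\<lambda>q. case q of (i', k') \<Rightarrow> ord_sign (f i') (f k')"]) simp
  also have "(\<Prod>(i, k)\<in>?Q. ord_sign (?t i) (?t k)) = (- 1) ^ card {q \<in> ?Q. \<not> (case q of (i, k) \<Rightarrow> ?t i < ?t k)}"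
  proof -
    have "(\<Prod>(i, k)\<in>?Q. ord_sign (?t i) (?t k)) = (\<Prod>q\<in>?Q. if \<not> (case q of (i, k) \<Rightarrow> ?t i < ?t k) then - 1 else 1)"
      by (intro prod.cong) (auto simp: ord_sign_def)
    also have "\<dots> = (\<Prod>q\<in>{q \<in> ?Q. \<not> (case q of (i, k) \<Rightarrow> ?t i < ?t k)}. - 1)"
      by (rule prod.inter_filter[symmetric]) (simp add: S)
    finally show ?thesis by simp
  qed
  also have "{q \<in> ?Q. \<not> (case q of (i, k) \<Rightarrow> ?t i < ?t k)}
      = insert (a, b) ((\<lambda>k. (a, k)) ` ?M \<union> (\<lambda>k. (k, b)) ` ?M)"
    using ab by (auto simp: ordered_pairs_def Transposition.transpose_def split: if_splits)
  also have "card \<dots> = Suc (card ?M + card ?M)"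
  proof -
    have "card ((\<lambda>k. (a, k)) ` ?M \<union> (\<lambda>k. (k, b)) ` ?M) = card ?M + card ?M"
      using S by (subst card_Un_disjoint) (auto simp: card_image inj_on_def)
    then show ?thesis using S by (subst card_insert_disjoint) auto
  qed
  finally show ?thesis by (simp add: comp_def power_add[symmetric] mult_2[symmetric])
qed

lemma pair_sign_permute:
  fixes f :: "'a::linorder \<Rightarrow> 'b::linorder"
  assumes "finite S" "p permutes S" "inj_on f S"
  shows "pair_sign S (f \<circ> p) = of_int (sign p) * pair_sign S f"
proof -
  have "\<forall>f :: 'a \<Rightarrow> 'b. inj_on f S \<longrightarrow> pair_sign S (f \<circ> p) = of_int (sign p) * pair_sign S f"
    using assms(2,1)
  proof (induction rule: permutes_induct)
    case (swap a b p)
    have "permutation p" using swap(4) assms(1) permutation_permutes by blast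
    then have sg: "sign (Transposition.transpose a b \<circ> p) = - sign p"
      using swap(3) by (subst sign_compose) (auto simp: permutation_swap_id sign_swap_id)
    show ?case
    proof (intro allI impI)
      fix f :: "'a \<Rightarrow> 'b" assume f: "inj_on f S"
      let ?g = "f \<circ> Transposition.transpose a b"
      have "inj_on ?g S"
        using permutes_swap_id[OF swap(1,2)] f
        by (intro comp_inj_on) (simp_all add: permutes_inj_on permutes_image)
      then have "pair_sign S (?g \<circ> p) = of_int (sign p) * pair_sign S ?g"
        using swap by blast
      also have "pair_sign S ?g = - pair_sign S f"
      proof (cases "a < b")
        case True
        then show ?thesis using pair_sign_transpose[OF assms(1) f] swap by blast
      next
        case False
        then have "b < a" using swap by simp
        then show ?thesis using pair_sign_transpose[OF assms(1) f, of b a] swap by (simp add: transpose_commute)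
      qed
      finally show "pair_sign S (f \<circ> (Transposition.transpose a b \<circ> p)) = of_int (sign (Transposition.transpose a b \<circ> p)) * pair_sign S f"
        unfolding sg by (simp add: comp_def)
    qed
  qed auto
  then show ?thesis using assms by blast
qed

text \<open>Only the pairs that contain \<open>j\<close> contribute to the product.  Writing them with \<open>j\<close> in second place reverses
the same pairs for \<open>f\<close> and for \<open>g\<close>, so the position of \<open>j\<close> drops out.\<close>

lemma pair_sign_agree_off:
  fixes f g :: "'a::{finite,linorder} \<Rightarrow> 'b::linorder"
  assumes f: "inj f" and g: "inj g" and fg: "\<And>i. i \<noteq> j \<Longrightarrow> f i = g i"
  shows "pair_sign UNIV f * pair_sign UNIV g
    = (\<Prod>i\<in>UNIV-{j}. ord_sign (f i) (f j)) * (\<Prod>i\<in>UNIV-{j}. ord_sign (g i) (g j))"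
proof -
  let ?Q = "ordered_pairs (UNIV :: 'a set)"
  let ?w = "\<lambda>i. ord_sign (f i) (f j) * ord_sign (g i) (g j)"
  let ?h = "\<lambda>(i, k). ord_sign (f i) (f k) * ord_sign (g i) (g k)"
  define e where "e i = (min i j, max i j)" for i
  have "pair_sign UNIV f * pair_sign UNIV g = (\<Prod>q\<in>?Q. ?h q)"
    by (simp add: pair_sign_def prod.distrib[symmetric] case_prod_unfold)
  also have "\<dots> = (\<Prod>q\<in>e ` (UNIV - {j}). ?h q)"
  proof (rule prod.mono_neutral_right)
    show "e ` (UNIV - {j}) \<subseteq> ?Q" by (auto simp: e_def ordered_pairs_def min_def max_def)
    show "\<forall>q\<in>?Q - e ` (UNIV - {j}). ?h q = 1"
    proof
      fix q assume q: "q \<in> ?Q - e ` (UNIV - {j})"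
      obtain i k where ik: "q = (i, k)" "i < k" using q by (auto simp: ordered_pairs_def)
      have "q \<noteq> e i \<or> i = j" "q \<noteq> e k \<or> k = j" using q by auto
      then have "i \<noteq> j" "k \<noteq> j" using ik by (auto simp: e_def min_def max_def split: if_splits)
      then show "?h q = 1" by (simp add: ik fg)
    qed
  qed simp
  also have "\<dots> = (\<Prod>i\<in>UNIV-{j}. ?h (e i))"
    by (rule prod.reindex_cong[OF _ refl refl]) (auto simp: inj_on_def e_def min_def max_def split: if_splits)
  also have "\<dots> = (\<Prod>i\<in>UNIV-{j}. ?w i)"
  proof (rule prod.cong[OF refl])
    fix i assume i: "i \<in> UNIV - {j}"
    have "f i \<noteq> f j" "g i \<noteq> g j" using i f g by (auto dest: injD)
    then show "?h (e i) = ?w i"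
      using i ord_sign_swap[of "f i" "f j"] ord_sign_swap[of "g i" "g j"]
      by (cases "i < j") (auto simp: e_def min_def max_def)
  qed
  finally show ?thesis by (simp add: prod.distrib)
qed

lemma sort_sign_eq_pair_sign:
  assumes d: "distinct xs"
  shows "of_int (sort_sign xs) = pair_sign {..<length xs} ((!) xs)"
proof -
  let ?n = "length xs"
  let ?P = "\<lambda>p. p permutes {..<?n} \<and> permute_list p xs = sort xs"
  have ex: "\<exists>p. ?P p"
    by (rule mset_eq_permutation[of "sort xs" xs]) auto
  have uniq: "p = q" if "?P p" "?P q" for p q
  proof
    fix i
    show "p i = q i"
    proof (cases "i < ?n")
      case True
      have "xs ! p i = xs ! q i"
        using that True permute_list_nth by metis
      moreover have "p i < ?n" "q i < ?n"
        using that True permutes_in_image by (metis lessThan_iff)+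
      ultimately show ?thesis using d nth_eq_iff_index_eq by blast
    next
      case False
      then show ?thesis using that by (metis lessThan_iff permutes_not_in)
    qed
  qed
  define p where "p = (THE p. ?P p)"
  have p: "?P p" unfolding p_def using ex uniq by (metis (mono_tags, lifting) theI)
  have srt: "sorted_wrt (<) (sort xs)" using d by (simp add: strict_sorted_iff)
  have "pair_sign {..<?n} ((!) xs \<circ> p) = 1"
  proof (rule pair_sign_strict_mono)
    fix i k assume ik: "i \<in> {..<?n}" "k \<in> {..<?n}" "i < k"
    have "sort xs ! i < sort xs ! k" using srt ik by (simp add: sorted_wrt_nth_less)
    then show "((!) xs \<circ> p) i < ((!) xs \<circ> p) k"
      using p ik by (metis comp_apply lessThan_iff permute_list_nth)
  qed
  moreover have "pair_sign {..<?n} ((!) xs \<circ> p) = of_int (sign p) * pair_sign {..<?n} ((!) xs)"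
    using p d by (intro pair_sign_permute) (auto simp: inj_on_nth)
  ultimately have "of_int (sign p) * pair_sign {..<?n} ((!) xs) = 1" by simp
  then have "of_int (sign p) * (of_int (sign p) * pair_sign {..<?n} ((!) xs)) = (of_int (sign p) :: real)"
    by simp
  then have "pair_sign {..<?n} ((!) xs) = of_int (sign p)"
    by (simp add: mult.assoc[symmetric] of_int_mult[symmetric] del: of_int_mult)
  then show ?thesis by (simp add: sort_sign_def p_def)
qed

text \<open>Two increasing lists have no inversions inside, only between them.\<close>

lemma sort_sign_append:
  assumes A: "finite A" and B: "finite B" and AB: "A \<inter> B = {}"
  shows "of_int (sort_sign (sorted_list_of_set A @ sorted_list_of_set B)) = (\<Prod>a\<in>A. \<Prod>b\<in>B. ord_sign a b)"
proof -
  define xs ys where "xs = sorted_list_of_set A" and "ys = sorted_list_of_set B"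
  have xs: "set xs = A" "distinct xs" "sorted_wrt (<) xs" and ys: "set ys = B" "distinct ys" "sorted_wrt (<) ys"
    using A B by (auto simp: xs_def ys_def)
  let ?n = "length xs" and ?m = "length ys"
  let ?zs = "xs @ ys"
  let ?h = "\<lambda>(i, k). ord_sign (?zs ! i) (?zs ! k)"
  have "of_int (sort_sign ?zs) = pair_sign {..<length ?zs} ((!) ?zs)"
    using xs ys AB by (intro sort_sign_eq_pair_sign) auto
  also have "\<dots> = (\<Prod>q\<in>ordered_pairs {..<?n + ?m}. ?h q)"
    by (simp add: pair_sign_def case_prod_unfold)
  also have "\<dots> = (\<Prod>q\<in>{..<?n} \<times> {?n..<?n + ?m}. ?h q)"
  proof (rule prod.mono_neutral_right)
    show "\<forall>q\<in>ordered_pairs {..<?n + ?m} - {..<?n} \<times> {?n..<?n + ?m}. ?h q = 1"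
    proof
      fix q assume q: "q \<in> ordered_pairs {..<?n + ?m} - {..<?n} \<times> {?n..<?n + ?m}"
      then obtain i k where ik: "q = (i, k)" "i < k" "k < ?n + ?m" by (auto simp: ordered_pairs_def)
      consider "k < ?n" | "?n \<le> i" using q ik by force
      then have "?zs ! i < ?zs ! k"
        using ik xs(3) ys(3) by cases (auto simp: nth_append sorted_wrt_nth_less)
      then show "?h q = 1" by (simp add: ik ord_sign_def)
    qed
    show "finite (ordered_pairs {..<?n + ?m})" by simp
  qed (auto simp: ordered_pairs_def)
  also have "\<dots> = (\<Prod>i<?n. \<Prod>k\<in>{?n..<?n + ?m}. ord_sign (?zs ! i) (?zs ! k))"
    by (simp add: prod.cartesian_product case_prod_unfold)
  also have "\<dots> = (\<Prod>i<?n. \<Prod>k<?m. ord_sign (xs ! i) (ys ! k))"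
  proof (rule prod.cong[OF refl])
    fix i assume "i \<in> {..<?n}"
    then show "(\<Prod>k\<in>{?n..<?n + ?m}. ord_sign (?zs ! i) (?zs ! k)) = (\<Prod>k<?m. ord_sign (xs ! i) (ys ! k))"
      by (intro prod.reindex_bij_witness[where i = "\<lambda>k. k + ?n" and j = "\<lambda>k. k - ?n"]) (auto simp: nth_append)
  qed
  also have "\<dots> = (\<Prod>a\<in>A. \<Prod>b\<in>B. ord_sign a b)"
    by (simp add: prod.reindex_bij_betw[OF bij_betw_nth[OF ys(2) refl ys(1)[symmetric]], of "ord_sign _"]
       prod.reindex_bij_betw[OF bij_betw_nth[OF xs(2) refl xs(1)[symmetric]], of "\<lambda>a. \<Prod>b\<in>B. ord_sign a b"])
  finally show ?thesis by (simp add: xs_def ys_def)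
qed

definition enum_state :: "nat set \<Rightarrow> 'n::{finite,linorder} \<Rightarrow> nat" where
  "enum_state \<alpha> i = sorted_list_of_set \<alpha> ! card {k. k < i}"

lemma rank_mono: "i < k \<Longrightarrow> card {l. l < i} < card {l. l < (k :: 'n::{finite,linorder})}"
  by (intro psubset_card_mono) auto

lemma rank_less: "card {l. l < (i :: 'n::{finite,linorder})} < CARD('n)"
  by (intro psubset_card_mono) auto

lemma enum_state:
  assumes \<alpha>: "finite \<alpha>" "card \<alpha> = CARD('n::{finite,linorder})"
  shows "strict_mono (enum_state \<alpha> :: 'n \<Rightarrow> nat)" "bij_betw (enum_state \<alpha> :: 'n \<Rightarrow> nat) UNIV \<alpha>"
proof -
  show m: "strict_mono (enum_state \<alpha> :: 'n \<Rightarrow> nat)"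
  proof (rule strict_monoI)
    fix i k :: 'n assume "i < k"
    have "sorted_wrt (<) (sorted_list_of_set \<alpha>)" by simp
    then show "enum_state \<alpha> i < enum_state \<alpha> k"
      using sorted_wrt_nth_less[of "(<)" "sorted_list_of_set \<alpha>" "card {l. l < i}" "card {l. l < k}"]
        rank_mono[OF \<open>i < k\<close>] rank_less[of k] \<alpha>
      by (simp add: enum_state_def)
  qed
  have inj: "inj (enum_state \<alpha> :: 'n \<Rightarrow> nat)" using m by (rule strict_mono_imp_inj_on)
  have "range (enum_state \<alpha> :: 'n \<Rightarrow> nat) \<subseteq> \<alpha>"
  proof (clarify)
    fix i :: 'n
    have "card {l. l < i} < length (sorted_list_of_set \<alpha>)" using \<alpha> rank_less[of i] by simp
    then show "enum_state \<alpha> i \<in> \<alpha>"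
      using nth_mem \<alpha>(1) unfolding enum_state_def by (metis set_sorted_list_of_set)
  qed
  moreover have "card (range (enum_state \<alpha> :: 'n \<Rightarrow> nat)) = card \<alpha>"
    using inj \<alpha> by (simp add: card_image)
  ultimately show "bij_betw (enum_state \<alpha> :: 'n \<Rightarrow> nat) UNIV \<alpha>"
    using inj \<alpha> by (simp add: bij_betw_def card_subset_eq)
qed

text \<open>A determinant is an alternating sum over all ways to put its orbitals on the particles.  Indexing by these bijections
instead of permutations removes the dependence on the order of the orbitals.\<close>

definition labellings :: "nat set \<Rightarrow> ('n::finite \<Rightarrow> nat) set" where
  "labellings \<alpha> = {f. bij_betw f UNIV \<alpha>}"

lemma labellings_permutations:
  assumes \<alpha>: "finite \<alpha>" "card \<alpha> = CARD('n::{finite,linorder})"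
  shows "bij_betw (\<lambda>p. enum_state \<alpha> \<circ> p) {p :: 'n \<Rightarrow> 'n. p permutes UNIV} (labellings \<alpha>)"
proof -
  let ?a = "enum_state \<alpha> :: 'n \<Rightarrow> nat"
  have a: "bij_betw ?a UNIV \<alpha>" by (rule enum_state(2)[OF \<alpha>])
  have ia: "inj ?a" using a by (simp add: bij_betw_def)
  show ?thesis
  proof (rule bij_betw_byWitness[where f' = "\<lambda>f. inv_into UNIV ?a \<circ> f"])
    show "\<forall>p\<in>{p. p permutes UNIV}. inv ?a \<circ> (?a \<circ> p) = p"
      using ia by (auto simp: fun_eq_iff)
    show "\<forall>f\<in>labellings \<alpha>. ?a \<circ> (inv ?a \<circ> f) = f"
      using a by (auto simp: labellings_def fun_eq_iff bij_betw_def intro!: f_inv_into_f)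
    show "(\<circ>) ?a ` {p. p permutes UNIV} \<subseteq> labellings \<alpha>"
      using a by (auto simp: labellings_def intro: bij_betw_trans permutes_imp_bij)
    show "(\<lambda>f. inv ?a \<circ> f) ` labellings \<alpha> \<subseteq> {p. p permutes UNIV}"
      using bij_betw_inv_into[OF a]
      by (auto simp: labellings_def intro!: bij_imp_permutes intro: bij_betw_trans)
  qed
qed

lemma card_labellings:
  assumes "finite \<alpha>" "card \<alpha> = CARD('n::{finite,linorder})"
  shows "card (labellings \<alpha> :: ('n \<Rightarrow> nat) set) = fact CARD('n)"
  using bij_betw_same_card[OF labellings_permutations[OF assms]] card_permutations[of "UNIV :: 'n set"]
  by simp

lemma finite_labellings:
  assumes "finite \<alpha>" "card \<alpha> = CARD('n::{finite,linorder})"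
  shows "finite (labellings \<alpha> :: ('n \<Rightarrow> nat) set)"
  using card_labellings[OF assms] by (metis card.infinite fact_nonzero)

lemma labelling_inj: "f \<in> labellings \<alpha> \<Longrightarrow> inj f" and labelling_range: "f \<in> labellings \<alpha> \<Longrightarrow> range f = \<alpha>"
  by (auto simp: labellings_def bij_betw_def)

lemma slater_fun_expand:
  fixes x :: "'n::{finite,linorder} config"
  assumes \<alpha>: "finite \<alpha>" "card \<alpha> = CARD('n)"
  shows "slater_fun \<phi> \<alpha> x = (1 / sqrt (fact CARD('n))) *
    (\<Sum>f\<in>labellings \<alpha>. pair_sign UNIV f * (\<Prod>i\<in>UNIV. rep_l2 (\<phi> (f i)) (x $ i)))"
proof -
  let ?a = "enum_state \<alpha> :: 'n \<Rightarrow> nat"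
  have ps: "pair_sign UNIV (?a \<circ> p) = of_int (sign p)" if "p permutes UNIV" for p :: "'n \<Rightarrow> 'n"
  proof -
    have "pair_sign UNIV ?a = 1"
      using enum_state(1)[OF \<alpha>] by (intro pair_sign_strict_mono) (auto simp: strict_mono_def)
    then show ?thesis
      using pair_sign_permute[OF _ that, of ?a] enum_state(1)[OF \<alpha>] by (simp add: strict_mono_imp_inj_on)
  qed
  have "(\<Sum>f\<in>labellings \<alpha>. pair_sign UNIV f * (\<Prod>i\<in>UNIV. rep_l2 (\<phi> (f i)) (x $ i)))
      = (\<Sum>p | p permutes UNIV. pair_sign UNIV (?a \<circ> p) * (\<Prod>i\<in>UNIV. rep_l2 (\<phi> ((?a \<circ> p) i)) (x $ i)))"
    by (rule sum.reindex_bij_betw[OF labellings_permutations[OF \<alpha>], symmetric])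
  also have "\<dots> = det (Finite_Cartesian_Product.transpose (\<chi> i j. rep_l2 (\<phi> (?a i)) (x $ j)))"
    by (simp add: det_def Finite_Cartesian_Product.transpose_def ps)
  also have "\<dots> = det (\<chi> i j. rep_l2 (\<phi> (?a i)) (x $ j))"
    by (rule det_transpose)
  finally show ?thesis by (simp add: slater_fun_def enum_state_def)
qed

lemma square_integrable_slater_fun:
  assumes \<alpha>: "finite \<alpha>" "card \<alpha> = CARD('n::{finite,linorder})"
  shows "square_integrable (slater_fun \<phi> \<alpha> :: 'n config \<Rightarrow> real)"
proof -
  have "square_integrable (\<lambda>x :: 'n config. (1 / sqrt (fact CARD('n))) *
    (\<Sum>f\<in>labellings \<alpha>. pair_sign UNIV f * (\<Prod>i\<in>UNIV. rep_l2 ((\<phi> \<circ> f) i) (x $ i))))"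
    by (intro square_integrable_scale square_integrable_sum square_integrable_tensor)
  then show ?thesis by (subst ext[OF slater_fun_expand[OF \<alpha>]]) simp
qed

lemma slater_expand:
  assumes \<alpha>: "finite \<alpha>" "card \<alpha> = CARD('n::{finite,linorder})"
  shows "(slater \<phi> \<alpha> :: 'n config l2) = (1 / sqrt (fact CARD('n))) *\<^sub>R
    (\<Sum>f\<in>labellings \<alpha>. pair_sign UNIV f *\<^sub>R tensor (\<phi> \<circ> f))"
proof -
  have "(slater \<phi> \<alpha> :: 'n config l2) = abs_l2 (\<lambda>x. (1 / sqrt (fact CARD('n))) *
    (\<Sum>f\<in>labellings \<alpha>. pair_sign UNIV f * (\<Prod>i\<in>UNIV. rep_l2 ((\<phi> \<circ> f) i) (x $ i))))"
    unfolding slater_def by (subst ext[OF slater_fun_expand[OF \<alpha>]]) simp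
  also have "\<dots> = (1 / sqrt (fact CARD('n))) *\<^sub>R
    (\<Sum>f\<in>labellings \<alpha>. abs_l2 (\<lambda>x. pair_sign UNIV f * (\<Prod>i\<in>UNIV. rep_l2 ((\<phi> \<circ> f) i) (x $ i))))"
    by (subst abs_l2_scale, intro square_integrable_sum square_integrable_scale square_integrable_tensor,
      subst abs_l2_sum, intro square_integrable_scale square_integrable_tensor, rule refl)
  also have "\<dots> = (1 / sqrt (fact CARD('n))) *\<^sub>R (\<Sum>f\<in>labellings \<alpha>. pair_sign UNIV f *\<^sub>R tensor (\<phi> \<circ> f))"
    unfolding tensor_def by (subst abs_l2_scale) (rule square_integrable_tensor refl)+
  finally show ?thesis .
qed

lemma slater_antisym:
  assumes \<alpha>: "finite \<alpha>" "card \<alpha> = CARD('n::{finite,linorder})"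
  shows "(slater \<phi> \<alpha> :: 'n config l2) \<in> antisym_L2"
  unfolding slater_def
proof (rule antisym_L2_I[OF square_integrable_slater_fun[OF \<alpha>]], intro AE_I2)
  fix p :: "'n \<Rightarrow> 'n" and x :: "'n config" assume p: "p permutes UNIV"
  show "slater_fun \<phi> \<alpha> (\<chi> j. x $ p j) = of_int (sign p) * slater_fun \<phi> \<alpha> x"
    using det_permute_columns[OF p, of "\<chi> i j. rep_l2 (\<phi> (enum_state \<alpha> i)) (x $ j)"]
    by (simp add: slater_fun_def enum_state_def)
qed

section \<open>Overlaps of determinants and of their gradients\<close>

lemma orthonormal_tensor:
  assumes on: "\<And>p q. p \<in> L \<Longrightarrow> q \<in> L \<Longrightarrow> inner (\<phi> p) (\<phi> q) = (if p = q then 1 else 0)"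
    and f: "range f \<subseteq> L" and g: "range g \<subseteq> L"
  shows "inner (tensor (\<phi> \<circ> f)) (tensor (\<phi> \<circ> g)) = (if f = g then 1 else 0)"
proof -
  have "f i \<in> L" "g i \<in> L" for i using f g by auto
  then have "inner (tensor (\<phi> \<circ> f)) (tensor (\<phi> \<circ> g)) = (\<Prod>i\<in>UNIV. if f i = g i then 1 else 0)"
    unfolding inner_tensor by (intro prod.cong) (auto simp: on)
  then show ?thesis by (auto simp: fun_eq_iff)
qed

lemma inner_tensor_update:
  assumes on: "\<And>p q. p \<in> L \<Longrightarrow> q \<in> L \<Longrightarrow> inner (\<phi> p) (\<phi> q) = (if p = q then 1 else 0)"
    and f: "range f \<subseteq> L" and g: "range g \<subseteq> L"
  shows "inner (tensor ((\<phi> \<circ> f)(j := d))) (tensor ((\<phi> \<circ> g)(j := d')))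
    = (if \<forall>i. i \<noteq> j \<longrightarrow> f i = g i then inner d d' else 0)"
proof -
  have L: "f i \<in> L" "g i \<in> L" for i using f g by auto
  have "inner (tensor ((\<phi> \<circ> f)(j := d))) (tensor ((\<phi> \<circ> g)(j := d')))
      = inner d d' * (\<Prod>i\<in>UNIV-{j}. inner (((\<phi> \<circ> f)(j := d)) i) (((\<phi> \<circ> g)(j := d')) i))"
    unfolding inner_tensor by (subst prod.remove[of _ j]) auto
  also have "(\<Prod>i\<in>UNIV-{j}. inner (((\<phi> \<circ> f)(j := d)) i) (((\<phi> \<circ> g)(j := d')) i))
      = (\<Prod>i\<in>UNIV-{j}. if f i = g i then 1 else 0)"
    using L by (intro prod.cong) (auto simp: on)
  also have "inner d d' * (\<Prod>i\<in>UNIV-{j}. if f i = g i then 1 else 0)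
      = (if \<forall>i. i \<noteq> j \<longrightarrow> f i = g i then inner d d' else 0)" by auto
  finally show ?thesis .
qed

lemma inner_scaled_sums:
  fixes u :: "'i \<Rightarrow> 'v::real_inner"
  shows "inner (c *\<^sub>R (\<Sum>f\<in>A. a f *\<^sub>R u f)) (c *\<^sub>R (\<Sum>g\<in>B. b g *\<^sub>R v g))
    = c\<^sup>2 * (\<Sum>f\<in>A. \<Sum>g\<in>B. a f * (b g * inner (u f) (v g)))"
proof -
  have "inner (\<Sum>f\<in>A. a f *\<^sub>R u f) (\<Sum>g\<in>B. b g *\<^sub>R v g) = (\<Sum>f\<in>A. \<Sum>g\<in>B. a f * (b g * inner (u f) (v g)))"
    by (simp only: inner_sum_left) (simp add: inner_sum_right sum_distrib_left mult_ac)
  then show ?thesis by (simp add: power2_eq_square)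
qed

lemma inner_slater:
  assumes on: "\<And>p q. p \<in> L \<Longrightarrow> q \<in> L \<Longrightarrow> inner (\<phi> p) (\<phi> q) = (if p = q then 1 else 0)"
    and \<alpha>: "\<alpha> \<subseteq> L" "finite \<alpha>" "card \<alpha> = CARD('n)" and \<beta>: "\<beta> \<subseteq> L" "finite \<beta>" "card \<beta> = CARD('n)"
  shows "inner (slater \<phi> \<alpha> :: ('n::{finite,linorder}) config l2) (slater \<phi> \<beta>) = (if \<alpha> = \<beta> then 1 else 0)"
proof -
  have c2: "(1 / sqrt (fact CARD('n)))\<^sup>2 = 1 / (fact CARD('n) :: real)"
    by (simp add: power_divide)
  let ?A = "labellings \<alpha> :: ('n \<Rightarrow> nat) set" and ?B = "labellings \<beta> :: ('n \<Rightarrow> nat) set"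
  have r: "range f \<subseteq> L" if "f \<in> ?A \<union> ?B" for f using that \<alpha>(1) \<beta>(1) labelling_range by blast
  have "inner (slater \<phi> \<alpha> :: 'n config l2) (slater \<phi> \<beta>)
      = (1 / fact CARD('n)) * (\<Sum>f\<in>?A. \<Sum>g\<in>?B. pair_sign UNIV f * (pair_sign UNIV g * inner (tensor (\<phi> \<circ> f)) (tensor (\<phi> \<circ> g))))"
    unfolding slater_expand[OF \<alpha>(2,3)] slater_expand[OF \<beta>(2,3)]
    by (simp only: inner_scaled_sums c2)
  also have "(\<Sum>f\<in>?A. \<Sum>g\<in>?B. pair_sign UNIV f * (pair_sign UNIV g * inner (tensor (\<phi> \<circ> f)) (tensor (\<phi> \<circ> g))))
      = (\<Sum>f\<in>?A. \<Sum>g\<in>?B. if f = g then 1 else 0)"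
    using r by (intro sum.cong refl) (auto simp: orthonormal_tensor[OF on, where L = L])
  also have "\<dots> = (\<Sum>f\<in>?A. if f \<in> ?B then 1 else 0)"
    using finite_labellings[OF \<beta>(2,3)] by (simp add: sum.delta)
  also have "\<dots> = (if \<alpha> = \<beta> then fact CARD('n) else 0)"
  proof (cases "\<alpha> = \<beta>")
    case True
    then show ?thesis by (simp add: card_labellings[OF \<beta>(2,3)])
  next
    case False
    then have "f \<notin> ?B" if "f \<in> ?A" for f using that labelling_range by blast
    then show ?thesis using False by simp
  qed
  finally show ?thesis by simp
qed

lemma tensor_H1:
  assumes "\<And>i. F i \<in> H1"
  shows "tensor F \<in> H1"
    and "e \<in> Basis \<Longrightarrow> weak_deriv (axis j e) (tensor F) = tensor (F(j := weak_deriv e (F j)))"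
proof -
  have wd: "has_weak_deriv (axis j e) (tensor F) (tensor (F(j := weak_deriv e (F j))))"
    if "e \<in> Basis" for j e
    by (intro has_weak_deriv_tensor H1_has_weak_deriv assms that)
  then show "tensor F \<in> H1"
    unfolding H1_def Basis_vec_def by blast
  show "weak_deriv (axis j e) (tensor F) = tensor (F(j := weak_deriv e (F j)))" if "e \<in> Basis"
    by (intro weak_deriv_eq axis_Basis wd that)
qed

lemma slater_H1:
  assumes \<phi>: "\<And>p. p \<in> \<alpha> \<Longrightarrow> \<phi> p \<in> H1" and \<alpha>: "finite \<alpha>" "card \<alpha> = CARD('n)"
  shows "(slater \<phi> \<alpha> :: ('n::{finite,linorder}) config l2) \<in> H1"
    and "e \<in> Basis \<Longrightarrow> weak_deriv (axis j e) (slater \<phi> \<alpha> :: 'n config l2) = (1 / sqrt (fact CARD('n))) *\<^sub>R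
      (\<Sum>f\<in>labellings \<alpha>. pair_sign UNIV f *\<^sub>R tensor ((\<phi> \<circ> f)(j := weak_deriv e (\<phi> (f j)))))"
proof -
  have H: "(\<phi> \<circ> f) i \<in> H1" if "f \<in> labellings \<alpha>" for f :: "'n \<Rightarrow> nat" and i
    using \<phi> labelling_range[OF that] by auto
  have T: "tensor (\<phi> \<circ> f) \<in> H1" if "f \<in> labellings \<alpha>" for f :: "'n \<Rightarrow> nat"
    by (rule tensor_H1(1)[OF H[OF that]])
  note sub = subspace_scale[OF subspace_H1] subspace_sum[OF subspace_H1]
  show "(slater \<phi> \<alpha> :: 'n config l2) \<in> H1"
    unfolding slater_expand[OF \<alpha>] by (intro sub T)
  assume e: "e \<in> Basis"
  have W: "weak_deriv (axis j e) (tensor (\<phi> \<circ> f)) = tensor ((\<phi> \<circ> f)(j := weak_deriv e (\<phi> (f j))))"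
    if "f \<in> labellings \<alpha>" for f :: "'n \<Rightarrow> nat"
    using tensor_H1(2)[of "\<phi> \<circ> f" e j, OF H[OF that] e] unfolding comp_apply .
  have "weak_deriv (axis j e) (slater \<phi> \<alpha> :: 'n config l2) = (1 / sqrt (fact CARD('n))) *\<^sub>R
      (\<Sum>f\<in>labellings \<alpha>. pair_sign UNIV f *\<^sub>R weak_deriv (axis j e) (tensor (\<phi> \<circ> f)))"
    unfolding slater_expand[OF \<alpha>]
    by (subst weak_deriv_scaleR, intro sub T, assumption, rule axis_Basis[OF e],
      subst weak_deriv_sum, intro sub T, assumption, rule axis_Basis[OF e])
      (intro arg_cong[where f = "\<lambda>x. _ *\<^sub>R x"] sum.cong refl weak_deriv_scaleR T axis_Basis e)
  also have "\<dots> = (1 / sqrt (fact CARD('n))) *\<^sub>R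
      (\<Sum>f\<in>labellings \<alpha>. pair_sign UNIV f *\<^sub>R tensor ((\<phi> \<circ> f)(j := weak_deriv e (\<phi> (f j)))))"
    by (intro arg_cong[where f = "\<lambda>x. _ *\<^sub>R x"] sum.cong refl) (simp only: W)
  finally show "weak_deriv (axis j e) (slater \<phi> \<alpha> :: 'n config l2) = (1 / sqrt (fact CARD('n))) *\<^sub>R
      (\<Sum>f\<in>labellings \<alpha>. pair_sign UNIV f *\<^sub>R tensor ((\<phi> \<circ> f)(j := weak_deriv e (\<phi> (f j)))))" .
qed

definition orbital_grad :: "(nat \<Rightarrow> (real^3) l2) \<Rightarrow> nat \<Rightarrow> (real^3) l2 ^ 3" where
  "orbital_grad \<phi> p = (\<chi> k. weak_deriv (axis k 1) (\<phi> p))"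

lemma inner_orbital_grad:
  "inner (orbital_grad \<phi> p) (orbital_grad \<phi> q) = (\<Sum>e\<in>Basis. inner (weak_deriv e (\<phi> p)) (weak_deriv e (\<phi> q)))"
  by (simp add: orbital_grad_def inner_vec_def sum_Basis_vec)

text \<open>The sign of removing \<open>p\<close> from \<open>insert p \<delta>\<close>.\<close>

definition insert_sign :: "nat set \<Rightarrow> nat \<Rightarrow> real" where
  "insert_sign \<delta> p = (\<Prod>r\<in>\<delta>. ord_sign r p)"

lemma labelling_remove:
  assumes "f \<in> labellings \<alpha>"
  shows "f ` (UNIV - {j}) = \<alpha> - {f j}"
  using labelling_range[OF assms] labelling_inj[OF assms] by (auto dest: injD)

lemma labelling_insert_sign:
  assumes "f \<in> labellings \<alpha>"
  shows "(\<Prod>i\<in>UNIV-{j}. ord_sign (f i) (f j)) = insert_sign (\<alpha> - {f j}) (f j)"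
  unfolding insert_sign_def labelling_remove[OF assms, symmetric]
  by (subst prod.reindex) (auto intro: inj_on_subset[OF labelling_inj[OF assms]])

text \<open>A labelling that agrees with \<open>f\<close> away from \<open>j\<close> is determined by the orbital \<open>q\<close> it puts on \<open>j\<close>.\<close>

lemma sum_labellings_agree_off:
  fixes R :: "nat \<Rightarrow> nat \<Rightarrow> real"
  assumes f: "f \<in> labellings \<alpha>" and \<beta>: "finite \<beta>" "card \<beta> = CARD('n::{finite,linorder})"
  shows "(\<Sum>g\<in>labellings \<beta>. if \<forall>i::'n. i \<noteq> j \<longrightarrow> f i = g i
        then pair_sign UNIV f * pair_sign UNIV g * R (f j) (g j) else 0)
    = (\<Sum>q\<in>\<beta>. if \<alpha> - {f j} = \<beta> - {q}
        then insert_sign (\<alpha> - {f j}) (f j) * insert_sign (\<beta> - {q}) q * R (f j) q else 0)"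
proof -
  let ?G = "{g \<in> labellings \<beta>. \<forall>i::'n. i \<noteq> j \<longrightarrow> f i = g i}"
  have "(\<Sum>g\<in>labellings \<beta>. if \<forall>i::'n. i \<noteq> j \<longrightarrow> f i = g i
        then pair_sign UNIV f * pair_sign UNIV g * R (f j) (g j) else 0)
      = (\<Sum>g\<in>?G. pair_sign UNIV f * pair_sign UNIV g * R (f j) (g j))"
    by (rule sum.inter_filter[symmetric, OF finite_labellings[OF \<beta>]])
  also have "\<dots> = (\<Sum>q\<in>{q \<in> \<beta>. \<alpha> - {f j} = \<beta> - {q}}.
      insert_sign (\<alpha> - {f j}) (f j) * insert_sign (\<beta> - {q}) q * R (f j) q)"
  proof (rule sum.reindex_bij_witness[where i = "\<lambda>q. f(j := q)" and j = "\<lambda>g. g j"])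
    fix g assume "g \<in> ?G"
    then have g: "g \<in> labellings \<beta>" and fg: "\<And>i. i \<noteq> j \<Longrightarrow> f i = g i" by auto
    show "f(j := g j) = g" using fg by auto
    have "f ` (UNIV - {j}) = g ` (UNIV - {j})" using fg by (intro image_cong) auto
    then show "g j \<in> {q \<in> \<beta>. \<alpha> - {f j} = \<beta> - {q}}"
      using labelling_remove[OF f, of j] labelling_remove[OF g, of j] labelling_range[OF g] by auto
    show "insert_sign (\<alpha> - {f j}) (f j) * insert_sign (\<beta> - {g j}) (g j) * R (f j) (g j)
        = pair_sign UNIV f * pair_sign UNIV g * R (f j) (g j)"
      using pair_sign_agree_off[OF labelling_inj[OF f] labelling_inj[OF g] fg]
      by (simp add: labelling_insert_sign[OF f] labelling_insert_sign[OF g])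
  next
    fix q assume q: "q \<in> {q \<in> \<beta>. \<alpha> - {f j} = \<beta> - {q}}"
    let ?g = "f(j := q)"
    have im: "?g ` (UNIV - {j}) = \<beta> - {q}"
      using labelling_remove[OF f, of j] q by auto
    have "range ?g = insert q (?g ` (UNIV - {j}))" by auto
    then have r: "range ?g = \<beta>" using im q by auto
    then have "inj ?g"
      using \<beta> by (intro eq_card_imp_inj_on) auto
    then show "?g \<in> ?G" using r by (auto simp: labellings_def bij_betw_def)
    show "?g j = q" by simp
  qed
  also have "\<dots> = (\<Sum>q\<in>\<beta>. if \<alpha> - {f j} = \<beta> - {q}
        then insert_sign (\<alpha> - {f j}) (f j) * insert_sign (\<beta> - {q}) q * R (f j) q else 0)"
    by (rule sum.inter_filter[OF \<beta>(1)])
  finally show ?thesis .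
qed

text \<open>The gradient differentiates one particle at a time, so two determinants only interact if they agree after removing one orbital
from each.  Summing over the particle \<open>j\<close> turns the orbital \<open>f j\<close> into each orbital of \<open>\<alpha>\<close> exactly
once, for every labelling \<open>f\<close>; this cancels the normalisation without counting labellings with
a prescribed value.\<close>

theorem slater_condon_gradient:
  assumes on: "\<And>p q. p \<in> L \<Longrightarrow> q \<in> L \<Longrightarrow> inner (\<phi> p) (\<phi> q) = (if p = q then 1 else 0)"
    and H: "\<And>p. p \<in> L \<Longrightarrow> \<phi> p \<in> H1"
    and \<alpha>: "\<alpha> \<subseteq> L" "finite \<alpha>" "card \<alpha> = CARD('n)" and \<beta>: "\<beta> \<subseteq> L" "finite \<beta>" "card \<beta> = CARD('n)"
  shows "(\<Sum>b\<in>Basis. inner (weak_deriv b (slater \<phi> \<alpha> :: ('n::{finite,linorder}) config l2)) (weak_deriv b (slater \<phi> \<beta>)))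
    = (\<Sum>p\<in>\<alpha>. \<Sum>q\<in>\<beta>. if \<alpha> - {p} = \<beta> - {q}
        then insert_sign (\<alpha> - {p}) p * insert_sign (\<beta> - {q}) q * inner (orbital_grad \<phi> p) (orbital_grad \<phi> q) else 0)"
proof -
  have c2: "(1 / sqrt (fact CARD('n)))\<^sup>2 = 1 / (fact CARD('n) :: real)"
    by (simp add: power_divide)
  let ?A = "labellings \<alpha> :: ('n \<Rightarrow> nat) set" and ?B = "labellings \<beta> :: ('n \<Rightarrow> nat) set"
  let ?D = "\<lambda>e f g j. inner (weak_deriv e (\<phi> (f j))) (weak_deriv e (\<phi> (g j)))"
  let ?G = "\<lambda>p q. inner (orbital_grad \<phi> p) (orbital_grad \<phi> q)"
  have \<phi>\<alpha>: "\<And>p. p \<in> \<alpha> \<Longrightarrow> \<phi> p \<in> H1" and \<phi>\<beta>: "\<And>p. p \<in> \<beta> \<Longrightarrow> \<phi> p \<in> H1"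
    using H \<alpha>(1) \<beta>(1) by auto
  have r: "range f \<subseteq> L" if "f \<in> ?A \<union> ?B" for f using that \<alpha>(1) \<beta>(1) labelling_range by blast
  have je: "inner (weak_deriv (axis j e) (slater \<phi> \<alpha> :: 'n config l2)) (weak_deriv (axis j e) (slater \<phi> \<beta>))
      = (1 / fact CARD('n)) * (\<Sum>f\<in>?A. \<Sum>g\<in>?B. if \<forall>i. i \<noteq> j \<longrightarrow> f i = g i
          then pair_sign UNIV f * pair_sign UNIV g * ?D e f g j else 0)" if e: "e \<in> Basis" for j e
  proof -
    have "inner (weak_deriv (axis j e) (slater \<phi> \<alpha> :: 'n config l2)) (weak_deriv (axis j e) (slater \<phi> \<beta>))
      = (1 / fact CARD('n)) * (\<Sum>f\<in>?A. \<Sum>g\<in>?B. pair_sign UNIV f * (pair_sign UNIV g *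
          inner (tensor ((\<phi> \<circ> f)(j := weak_deriv e (\<phi> (f j))))) (tensor ((\<phi> \<circ> g)(j := weak_deriv e (\<phi> (g j)))))))"
    proof -
      note a = slater_H1(2)[of \<alpha> \<phi> e j, OF \<phi>\<alpha> \<alpha>(2,3) e]
        and b = slater_H1(2)[of \<beta> \<phi> e j, OF \<phi>\<beta> \<beta>(2,3) e]
      show ?thesis by (simp only: a b) (simp only: inner_scaled_sums c2)
    qed
    also have "(\<Sum>f\<in>?A. \<Sum>g\<in>?B. pair_sign UNIV f * (pair_sign UNIV g *
          inner (tensor ((\<phi> \<circ> f)(j := weak_deriv e (\<phi> (f j))))) (tensor ((\<phi> \<circ> g)(j := weak_deriv e (\<phi> (g j)))))))
      = (\<Sum>f\<in>?A. \<Sum>g\<in>?B. if \<forall>i. i \<noteq> j \<longrightarrow> f i = g i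
          then pair_sign UNIV f * pair_sign UNIV g * ?D e f g j else 0)"
      using r by (intro sum.cong refl) (auto simp: inner_tensor_update[OF on, where L = L])
    finally show ?thesis .
  qed
  have if_sum: "(\<Sum>e\<in>S. if P then c * d e else 0) = (if P then c * (\<Sum>e\<in>S. d e) else (0::real))"
    for P c d and S :: "(real^3) set"
    by (simp add: sum_distrib_left)
  define R where "R p = (\<Sum>q\<in>\<beta>. if \<alpha> - {p} = \<beta> - {q}
        then insert_sign (\<alpha> - {p}) p * insert_sign (\<beta> - {q}) q * ?G p q else 0)" for p
  have j: "(\<Sum>e\<in>Basis. inner (weak_deriv (axis j e) (slater \<phi> \<alpha> :: 'n config l2)) (weak_deriv (axis j e) (slater \<phi> \<beta>)))
      = (1 / fact CARD('n)) * (\<Sum>f\<in>?A. R (f j))" for j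
  proof -
    have "(\<Sum>e\<in>Basis. inner (weak_deriv (axis j e) (slater \<phi> \<alpha> :: 'n config l2)) (weak_deriv (axis j e) (slater \<phi> \<beta>)))
      = (1 / fact CARD('n)) * (\<Sum>e\<in>Basis. \<Sum>f\<in>?A. \<Sum>g\<in>?B. if \<forall>i. i \<noteq> j \<longrightarrow> f i = g i
          then pair_sign UNIV f * pair_sign UNIV g * ?D e f g j else 0)"
      by (simp add: je sum_divide_distrib)
    also have "(\<Sum>e\<in>Basis. \<Sum>f\<in>?A. \<Sum>g\<in>?B. if \<forall>i. i \<noteq> j \<longrightarrow> f i = g i
          then pair_sign UNIV f * pair_sign UNIV g * ?D e f g j else 0)
      = (\<Sum>f\<in>?A. \<Sum>g\<in>?B. \<Sum>e\<in>Basis. if \<forall>i. i \<noteq> j \<longrightarrow> f i = g i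
          then pair_sign UNIV f * pair_sign UNIV g * ?D e f g j else 0)"
      by (subst sum.swap, rule sum.cong[OF refl], subst sum.swap, rule refl)
    also have "\<dots> = (\<Sum>f\<in>?A. \<Sum>g\<in>?B. if \<forall>i. i \<noteq> j \<longrightarrow> f i = g i
          then pair_sign UNIV f * pair_sign UNIV g * ?G (f j) (g j) else 0)"
      by (simp only: if_sum inner_orbital_grad)
    also have "\<dots> = (\<Sum>f\<in>?A. R (f j))"
      unfolding R_def by (intro sum.cong refl sum_labellings_agree_off \<beta>(2,3))
    finally show ?thesis .
  qed
  have "(\<Sum>b\<in>Basis. inner (weak_deriv b (slater \<phi> \<alpha> :: 'n config l2)) (weak_deriv b (slater \<phi> \<beta>)))
      = (\<Sum>j\<in>UNIV. (1 / fact CARD('n)) * (\<Sum>f\<in>?A. R (f j)))"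
    by (subst sum_Basis_vec, simp only: j)
  also have "\<dots> = (1 / fact CARD('n)) * (\<Sum>f\<in>?A. \<Sum>j\<in>UNIV. R (f j))"
    unfolding sum_distrib_left[symmetric] by (subst sum.swap) (rule refl)
  also have "(\<Sum>f\<in>?A. \<Sum>j\<in>UNIV. R (f j)) = (\<Sum>f\<in>?A. \<Sum>p\<in>\<alpha>. R p)"
    by (intro sum.cong refl sum.reindex_bij_betw) (simp add: labellings_def)
  finally show ?thesis
    by (simp add: card_labellings[OF \<alpha>(2,3)] R_def)
qed

section \<open>The convolution algebra of amplitudes\<close>

text \<open>The sign of sorting the particles of \<open>A\<close> followed by those of \<open>B\<close>; the occupied orbitals \<open>Oc\<close>
do not enter.\<close>

definition cross :: "nat set \<Rightarrow> nat set \<Rightarrow> nat set \<Rightarrow> real" where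
  "cross Oc A B = (\<Prod>a\<in>A - Oc. \<Prod>b\<in>B - Oc. ord_sign a b)"

lemma cross_square [simp]: "cross Oc A B * cross Oc A B = 1"
  unfolding cross_def prod.distrib[symmetric] by (simp add: prod.neutral)

lemma abs_cross [simp]: "\<bar>cross Oc A B\<bar> = 1"
  using cross_square[of Oc A B] by (metis abs_mult abs_one abs_mult_self_eq real_sqrt_abs2 real_sqrt_one)

lemma cross_empty [simp]: "cross Oc {} B = 1" "cross Oc A {} = 1"
  by (simp_all add: cross_def)

lemma cross_Un_left:
  assumes "finite A" "finite A'" "A \<inter> A' = {}"
  shows "cross Oc (A \<union> A') B = cross Oc A B * cross Oc A' B"
  unfolding cross_def Un_Diff using assms by (intro prod.union_disjoint) auto

lemma cross_Un_right:
  assumes "finite B" "finite B'" "B \<inter> B' = {}"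
  shows "cross Oc A (B \<union> B') = cross Oc A B * cross Oc A B'"
proof -
  have "(\<Prod>b\<in>(B \<union> B') - Oc. ord_sign a b) = (\<Prod>b\<in>B - Oc. ord_sign a b) * (\<Prod>b\<in>B' - Oc. ord_sign a b)" for a
    unfolding Un_Diff using assms by (intro prod.union_disjoint) auto
  then show ?thesis by (simp add: cross_def prod.distrib)
qed

lemma cross_insert_left:
  "finite A \<Longrightarrow> p \<notin> A \<Longrightarrow> cross Oc (insert p A) B = cross Oc {p} B * cross Oc A B"
  using cross_Un_left[of "{p}" A] by simp

lemma cross_insert_right:
  "finite B \<Longrightarrow> p \<notin> B \<Longrightarrow> cross Oc A (insert p B) = cross Oc A {p} * cross Oc A B"
  using cross_Un_right[of "{p}" B] by simp

lemma cross_swap_singleton: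
  assumes "finite A" "p \<notin> A" "p \<notin> Oc"
  shows "cross Oc {p} A = (- 1) ^ card (A - Oc) * cross Oc A {p}"
proof -
  have p: "{p} - Oc = {p}" using assms by auto
  have "(\<Prod>a\<in>A - Oc. ord_sign p a) = (\<Prod>a\<in>A - Oc. - 1 * ord_sign a p)"
    using assms by (intro prod.cong) (auto intro: ord_sign_swap[of _ p, THEN trans])
  also have "\<dots> = (\<Prod>a\<in>A - Oc. - 1) * (\<Prod>a\<in>A - Oc. ord_sign a p)"
    by (rule prod.distrib)
  finally show ?thesis by (simp add: cross_def p)
qed

text \<open>Subset convolution on coefficient functions that are indexed by codes (sets of holes and particles).  The second
argument may be vector valued, which is used for gradients.\<close>

definition conv :: "nat set \<Rightarrow> (nat set \<Rightarrow> real) \<Rightarrow> (nat set \<Rightarrow> 'v::real_vector) \<Rightarrow> nat set \<Rightarrow> 'v" where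
  "conv Oc t u z = (\<Sum>x\<in>Pow z. (cross Oc (z - x) x * t x) *\<^sub>R u (z - x))"

text \<open>Both sides sum over the decompositions of \<open>z\<close> into three disjoint parts; the signs agree because
\<open>cross\<close> is multiplicative in both arguments.\<close>

lemma conv_assoc:
  assumes z: "finite z"
  shows "conv Oc t (conv Oc s u) z = conv Oc (conv Oc t s) u z"
proof -
  have "conv Oc t (conv Oc s u) z = (\<Sum>x\<in>Pow z. \<Sum>y\<in>Pow (z - x).
      (cross Oc (z - x) x * t x * (cross Oc (z - x - y) y * s y)) *\<^sub>R u (z - x - y))"
    by (simp add: conv_def scaleR_sum_right)
  also have "\<dots> = (\<Sum>(x, y)\<in>Sigma (Pow z) (\<lambda>x. Pow (z - x)).
      (cross Oc (z - x) x * t x * (cross Oc (z - x - y) y * s y)) *\<^sub>R u (z - x - y))"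
    using z by (intro sum.Sigma) auto
  also have "\<dots> = (\<Sum>(w, x)\<in>Sigma (Pow z) Pow.
      (cross Oc (z - w) w * (cross Oc (w - x) x * t x * s (w - x))) *\<^sub>R u (z - w))"
  proof (rule sum.reindex_bij_witness[where i = "\<lambda>(w, x). (x, w - x)" and j = "\<lambda>(x, y). (x \<union> y, x)"])
    fix q assume "q \<in> Sigma (Pow z) (\<lambda>x. Pow (z - x))"
    then obtain x y where q: "q = (x, y)" "x \<subseteq> z" "y \<subseteq> z - x" by auto
    have fin: "finite x" "finite y" "finite (z - x - y)"
      using q z by (auto intro: finite_subset)
    have 1: "cross Oc (z - x) x = cross Oc y x * cross Oc (z - x - y) x"
    proof -
      have "z - x = y \<union> (z - x - y)" using q by auto
      then show ?thesis using cross_Un_left[of y "z - x - y" Oc x] fin by auto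
    qed
    have 2: "cross Oc (z - x - y) (x \<union> y) = cross Oc (z - x - y) x * cross Oc (z - x - y) y"
      using q fin by (intro cross_Un_right) auto
    have 3: "z - (x \<union> y) = z - x - y" "x \<union> y - x = y" using q by auto
    show "(case case q of (x, y) \<Rightarrow> (x \<union> y, x) of (w, x) \<Rightarrow>
        (cross Oc (z - w) w * (cross Oc (w - x) x * t x * s (w - x))) *\<^sub>R u (z - w)) =
        (case q of (x, y) \<Rightarrow> (cross Oc (z - x) x * t x * (cross Oc (z - x - y) y * s y)) *\<^sub>R u (z - x - y))"
      by (simp add: q(1) 1 2 3)
  qed auto
  also have "\<dots> = (\<Sum>w\<in>Pow z. \<Sum>x\<in>Pow w.
      (cross Oc (z - w) w * (cross Oc (w - x) x * t x * s (w - x))) *\<^sub>R u (z - w))"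
    using z by (intro sum.Sigma[symmetric]) (auto intro: finite_subset)
  also have "\<dots> = conv Oc (conv Oc t s) u z"
    by (simp add: conv_def scaleR_sum_left[symmetric] sum_distrib_left)
  finally show ?thesis .
qed

text \<open>Removal of the particle \<open>p\<close>: the annihilation operator.\<close>

definition contract :: "nat set \<Rightarrow> nat \<Rightarrow> (nat set \<Rightarrow> real) \<Rightarrow> nat set \<Rightarrow> real" where
  "contract Oc p u z = (if p \<in> z then 0 else cross Oc z {p} * u (insert p z))"

definition parity :: "nat set \<Rightarrow> (nat set \<Rightarrow> real) \<Rightarrow> nat set \<Rightarrow> real" where
  "parity Oc t x = (- 1) ^ card (x - Oc) * t x"

lemma sum_Pow_insert:
  fixes f :: "'a set \<Rightarrow> 'b::comm_monoid_add"
  assumes "finite z" "p \<notin> z"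
  shows "(\<Sum>x\<in>Pow (insert p z). f x) = (\<Sum>x\<in>Pow z. f x) + (\<Sum>x\<in>Pow z. f (insert p x))"
proof -
  have "(\<Sum>x\<in>Pow (insert p z). f x) = (\<Sum>x\<in>Pow z. f x) + (\<Sum>x\<in>insert p ` Pow z. f x)"
    unfolding Pow_insert using assms by (intro sum.union_disjoint) auto
  also have "(\<Sum>x\<in>insert p ` Pow z. f x) = (\<Sum>x\<in>Pow z. f (insert p x))"
    using assms(2) by (intro sum.reindex_cong[OF _ refl refl]) (auto simp: inj_on_def)
  finally show ?thesis .
qed

text \<open>The graded Leibniz rule.  A particle \<open>p\<close> of a union of two disjoint codes belongs to exactly one of them.  It
also has to hold at sets \<open>z\<close> that already contain \<open>p\<close>, where the left-hand side vanishes: there the two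
terms cancel in pairs, which is the exclusion principle.  Without this cancellation the terms with a
doubly occupied orbital could not be bounded, as the gradients of the orbitals are not uniformly bounded.\<close>

lemma contract_conv:
  assumes z: "finite z" and p: "p \<notin> Oc"
  shows "contract Oc p (conv Oc t u) z
    = conv Oc (parity Oc t) (contract Oc p u) z + conv Oc (contract Oc p t) u z"
proof (cases "p \<in> z")
  case False
  have sgn: "cross Oc z {p} * (cross Oc (insert p (z - x)) x * t x * u (insert p (z - x)))
        = cross Oc (z - x) x * parity Oc t x * contract Oc p u (z - x)"
      "cross Oc z {p} * (cross Oc (z - x) (insert p x) * t (insert p x) * u (z - x))
        = cross Oc (z - x) x * contract Oc p t x * u (z - x)" if x: "x \<subseteq> z" for x
  proof -
    have fin: "finite x" "finite (z - x)" using x z by (auto intro: finite_subset)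
    have px: "p \<notin> x" "p \<notin> z - x" using False x by auto
    have "z = x \<union> (z - x)" using x by auto
    then have 1: "cross Oc z {p} = cross Oc x {p} * cross Oc (z - x) {p}"
      using cross_Un_left[of x "z - x" Oc "{p}"] fin by auto
    have r1: "q * q = 1 \<Longrightarrow> q * r * ((n * q * c) * a * b) = c * (n * a) * (r * b)" for q r n c a b :: real
      by algebra
    have r2: "r * r = 1 \<Longrightarrow> q * r * ((r * c) * a * b) = c * (q * a) * b" for q r c a b :: real
      by algebra
    have 2: "cross Oc (insert p (z - x)) x = (- 1) ^ card (x - Oc) * cross Oc x {p} * cross Oc (z - x) x"
      using cross_insert_left[OF fin(2) px(2), of Oc x] cross_swap_singleton[OF fin(1) px(1) p] by simp
    show "cross Oc z {p} * (cross Oc (insert p (z - x)) x * t x * u (insert p (z - x)))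
        = cross Oc (z - x) x * parity Oc t x * contract Oc p u (z - x)"
      unfolding 1 2 parity_def contract_def if_not_P[OF px(2)] by (rule r1) simp
    show "cross Oc z {p} * (cross Oc (z - x) (insert p x) * t (insert p x) * u (z - x))
        = cross Oc (z - x) x * contract Oc p t x * u (z - x)"
      unfolding 1 cross_insert_right[OF fin(1) px(1)] contract_def if_not_P[OF px(1)] by (rule r2) simp
  qed
  have d: "insert p z - x = insert p (z - x)" "insert p z - insert p x = z - x" if "x \<subseteq> z" for x
    using False that by auto
  have "contract Oc p (conv Oc t u) z = (\<Sum>x\<in>Pow z. cross Oc z {p} * (cross Oc (insert p (z - x)) x * t x * u (insert p (z - x))))
      + (\<Sum>x\<in>Pow z. cross Oc z {p} * (cross Oc (z - x) (insert p x) * t (insert p x) * u (z - x)))"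
    using False by (simp add: contract_def conv_def sum_Pow_insert[OF z False] d sum_distrib_left distrib_left)
  then show ?thesis by (simp add: conv_def sgn)
next
  case True
  \<comment> \<open>The subsets of \<open>z\<close> with and without \<open>p\<close> are matched through their trace on \<open>z\<close> without \<open>p\<close>.\<close>
  define z' where "z' = z - {p}"
  have zz: "z = insert p z'" and z': "finite z'" "p \<notin> z'" using True z by (auto simp: z'_def)
  have sgn: "cross Oc (insert p (z' - x)) x * contract Oc p t x * u (insert p (z' - x))
      = - (cross Oc (z' - x) (insert p x) * parity Oc t (insert p x) * contract Oc p u (z' - x))"
    if x: "x \<subseteq> z'" for x
  proof -
    have fin: "finite x" "finite (z' - x)" using x z' by (auto intro: finite_subset)
    have px: "p \<notin> x" "p \<notin> z' - x" using x z' by auto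
    have c: "card (insert p x - Oc) = Suc (card (x - Oc))"
      using px fin p by (simp add: insert_Diff_if)
    have r: "q * q = 1 \<Longrightarrow> r * r = 1 \<Longrightarrow>
        n * q * d * (q * a) * b = - ((r * d) * (- 1 * n * a) * (r * b))" for q r n d a b :: real
      by algebra
    have 2: "cross Oc (insert p (z' - x)) x = (- 1) ^ card (x - Oc) * cross Oc x {p} * cross Oc (z' - x) x"
      using cross_insert_left[OF fin(2) px(2), of Oc x] cross_swap_singleton[OF fin(1) px(1) p] by simp
    show ?thesis
      unfolding 2 cross_insert_right[OF fin(1) px(1)] parity_def contract_def if_not_P[OF px(1)] if_not_P[OF px(2)]
        c power_Suc by (rule r) simp_all
  qed
  have d: "insert p z' - x = insert p (z' - x)" "insert p z' - insert p x = z' - x" if "x \<subseteq> z'" for x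
    using z' that by auto
  have "conv Oc (parity Oc t) (contract Oc p u) z
      = (\<Sum>x\<in>Pow z'. cross Oc (z' - x) (insert p x) * parity Oc t (insert p x) * contract Oc p u (z' - x))"
    unfolding zz conv_def sum_Pow_insert[OF z'] using Diff_insert0[OF z'(2)] z'(2) by (simp add: d) (simp add: contract_def)
  moreover have "conv Oc (contract Oc p t) u z
      = (\<Sum>x\<in>Pow z'. cross Oc (insert p (z' - x)) x * contract Oc p t x * u (insert p (z' - x)))"
    unfolding zz conv_def sum_Pow_insert[OF z'] by (simp add: d) (simp add: contract_def)
  moreover have "contract Oc p (conv Oc t u) z = 0" using True by (simp add: contract_def)
  ultimately show ?thesis by (simp add: sgn sum_negf)
qed

text \<open>The transpose of \<open>conv Oc t\<close>, for coefficients supported on subsets of the finite set \<open>P\<close>.\<close>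

definition adj_conv :: "nat set \<Rightarrow> nat set \<Rightarrow> (nat set \<Rightarrow> real) \<Rightarrow> (nat set \<Rightarrow> 'v::real_vector) \<Rightarrow> nat set \<Rightarrow> 'v" where
  "adj_conv Oc P t u z = (\<Sum>x\<in>{x \<in> Pow P. x \<inter> z = {}}. (cross Oc z x * t x) *\<^sub>R u (z \<union> x))"

text \<open>For the transpose no Leibniz term appears: the removed particle always belongs to the remaining factor.\<close>

lemma contract_adj_conv:
  assumes P: "finite P" and z: "finite z" and p: "p \<notin> Oc"
  shows "contract Oc p (adj_conv Oc P t u) z = adj_conv Oc P (parity Oc t) (contract Oc p u) z"
proof (cases "p \<in> z")
  case True
  then show ?thesis by (simp add: adj_conv_def contract_def)
next
  case False
  let ?X = "{x \<in> Pow P. x \<inter> z = {}}" and ?Y = "{x \<in> Pow P. x \<inter> insert p z = {}}"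
  have "adj_conv Oc P (parity Oc t) (contract Oc p u) z
      = (\<Sum>x\<in>?Y. cross Oc z x * parity Oc t x * contract Oc p u (z \<union> x))"
    unfolding adj_conv_def real_scaleR_def using P
    by (intro sum.mono_neutral_right) (auto simp: contract_def)
  also have "\<dots> = (\<Sum>x\<in>?Y. cross Oc z {p} * (cross Oc (insert p z) x * t x * u (insert p z \<union> x)))"
  proof (rule sum.cong[OF refl])
    fix x assume x: "x \<in> ?Y"
    then have fin: "finite x" and px: "p \<notin> x" and xz: "z \<inter> x = {}"
      using P by (auto intro: finite_subset)
    have 1: "cross Oc (z \<union> x) {p} = cross Oc z {p} * cross Oc x {p}"
      by (rule cross_Un_left) (use fin z xz in auto)
    have 2: "cross Oc (insert p z) x = (- 1) ^ card (x - Oc) * cross Oc x {p} * cross Oc z x"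
      using cross_insert_left[OF z False, of Oc x] cross_swap_singleton[OF fin px p] by simp
    have 3: "p \<notin> z \<union> x" using False px by simp
    have r: "c * (n * a) * (q * r * b) = q * ((n * r * c) * a * b)" for c n a q r b :: real
      by simp
    show "cross Oc z x * parity Oc t x * contract Oc p u (z \<union> x)
        = cross Oc z {p} * (cross Oc (insert p z) x * t x * u (insert p z \<union> x))"
      unfolding 1 2 parity_def contract_def if_not_P[OF 3] Un_insert_left by (rule r)
  qed
  also have "\<dots> = contract Oc p (adj_conv Oc P t u) z"
    using False by (simp add: contract_def adj_conv_def sum_distrib_left)
  finally show ?thesis ..
qed

lemma conv_adj_conv:
  fixes w u :: "nat set \<Rightarrow> real"
  assumes P: "finite P"
  shows "(\<Sum>z\<in>Pow P. conv Oc t w z * u z) = (\<Sum>y\<in>Pow P. w y * adj_conv Oc P t u y)"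
proof -
  have "(\<Sum>z\<in>Pow P. conv Oc t w z * u z) = (\<Sum>z\<in>Pow P. \<Sum>x\<in>Pow z. cross Oc (z - x) x * t x * w (z - x) * u z)"
    by (simp add: conv_def sum_distrib_right)
  also have "\<dots> = (\<Sum>(z, x)\<in>Sigma (Pow P) Pow. cross Oc (z - x) x * t x * w (z - x) * u z)"
    using P by (intro sum.Sigma) (auto intro: finite_subset)
  also have "\<dots> = (\<Sum>(y, x)\<in>Sigma (Pow P) (\<lambda>y. {x \<in> Pow P. x \<inter> y = {}}). cross Oc y x * t x * w y * u (y \<union> x))"
  proof (rule sum.reindex_bij_witness[where j = "\<lambda>(z, x). (z - x, x)" and i = "\<lambda>(y, x). (y \<union> x, x)"])
    fix q assume "q \<in> Sigma (Pow P) Pow"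
    then obtain z x where q: "q = (z, x)" "z \<subseteq> P" "x \<subseteq> z" by auto
    then have zx: "z - x \<union> x = z" by auto
    show "(case case q of (z, x) \<Rightarrow> (z - x, x) of (y, x) \<Rightarrow> (y \<union> x, x)) = q"
      by (simp only: q(1) prod.case zx)
    show "(case q of (z, x) \<Rightarrow> (z - x, x)) \<in> Sigma (Pow P) (\<lambda>y. {x \<in> Pow P. x \<inter> y = {}})"
      using q by auto
    show "(case case q of (z, x) \<Rightarrow> (z - x, x) of (y, x) \<Rightarrow> cross Oc y x * t x * w y * u (y \<union> x))
        = (case q of (z, x) \<Rightarrow> cross Oc (z - x) x * t x * w (z - x) * u z)"
      by (simp only: q(1) prod.case zx)
  next
    fix q assume "q \<in> Sigma (Pow P) (\<lambda>y. {x \<in> Pow P. x \<inter> y = {}})"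
    then obtain y x where q: "q = (y, x)" "y \<subseteq> P" "x \<subseteq> P" "x \<inter> y = {}" by auto
    then have yx: "y \<union> x - x = y" by auto
    show "(case case q of (y, x) \<Rightarrow> (y \<union> x, x) of (z, x) \<Rightarrow> (z - x, x)) = q"
      by (simp only: q(1) prod.case yx)
    show "(case q of (y, x) \<Rightarrow> (y \<union> x, x)) \<in> Sigma (Pow P) Pow"
      using q by auto
  qed
  also have "\<dots> = (\<Sum>y\<in>Pow P. \<Sum>x\<in>{x \<in> Pow P. x \<inter> y = {}}. cross Oc y x * t x * w y * u (y \<union> x))"
    using P by (intro sum.Sigma[symmetric]) auto
  also have "\<dots> = (\<Sum>y\<in>Pow P. w y * adj_conv Oc P t u y)"
    by (simp add: adj_conv_def sum_distrib_left mult_ac)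
  finally show ?thesis .
qed

text \<open>Only sets with at most \<open>2 M\<close> elements contribute, and such a set has at most \<open>4 ^ M\<close> decompositions, so
Cauchy--Schwarz costs a factor that does not depend on \<open>P\<close>.\<close>

lemma subset_convolution_bound:
  fixes a b :: "nat set \<Rightarrow> real"
  assumes P: "finite P"
    and a: "\<And>x. card x > M \<Longrightarrow> a x = 0" and b: "\<And>x. card x > M \<Longrightarrow> b x = 0"
  shows "(\<Sum>z\<in>Pow P. (\<Sum>x\<in>Pow z. a x * b (z - x))\<^sup>2)
    \<le> 2 ^ (2 * M) * ((\<Sum>x\<in>Pow P. (a x)\<^sup>2) * (\<Sum>x\<in>Pow P. (b x)\<^sup>2))"
proof -
  have z: "(\<Sum>x\<in>Pow z. a x * b (z - x))\<^sup>2 \<le> 2 ^ (2 * M) * (\<Sum>x\<in>Pow z. (a x * b (z - x))\<^sup>2)"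
    if zP: "z \<in> Pow P" for z
  proof (cases "card z \<le> 2 * M")
    case True
    have fin: "finite z" using P zP by (auto intro: finite_subset)
    have "(\<Sum>x\<in>Pow z. a x * b (z - x))\<^sup>2 \<le> (\<Sum>x\<in>Pow z. (a x * b (z - x))\<^sup>2) * card (Pow z)"
      by (rule sum_squared_le_sum_of_squares)
    also have "\<dots> \<le> (\<Sum>x\<in>Pow z. (a x * b (z - x))\<^sup>2) * 2 ^ (2 * M)"
    proof -
      have "card (Pow z) \<le> 2 ^ (2 * M)" using True fin by (simp add: card_Pow power_increasing)
      then have "real (card (Pow z)) \<le> 2 ^ (2 * M)" by (metis of_nat_le_iff of_nat_numeral of_nat_power)
      then show ?thesis by (intro mult_left_mono sum_nonneg) auto
    qed
    finally show ?thesis by (simp add: mult.commute)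
  next
    case False
    have "a x * b (z - x) = 0" if "x \<in> Pow z" for x
    proof -
      have "finite z" using P zP by (auto intro: finite_subset)
      then have "card z = card x + card (z - x)"
        using that by (metis PowD card_Diff_subset card_mono finite_subset le_add_diff_inverse)
      then have "card x > M \<or> card (z - x) > M" using False by linarith
      then show ?thesis using a b by auto
    qed
    then have "(\<Sum>x\<in>Pow z. a x * b (z - x)) = 0" by (rule sum.neutral[OF ballI])
    then show ?thesis by (simp add: sum_nonneg)
  qed
  have "(\<Sum>z\<in>Pow P. \<Sum>x\<in>Pow z. (a x * b (z - x))\<^sup>2)
      = (\<Sum>(z, x)\<in>Sigma (Pow P) Pow. (a x * b (z - x))\<^sup>2)"
    using P by (intro sum.Sigma) (auto intro: finite_subset)
  also have "\<dots> = (\<Sum>(x, y)\<in>(\<lambda>(z, x). (x, z - x)) ` Sigma (Pow P) Pow. (a x * b y)\<^sup>2)"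
    by (subst sum.reindex) (auto simp: inj_on_def case_prod_unfold)
  also have "\<dots> \<le> (\<Sum>(x, y)\<in>Pow P \<times> Pow P. (a x * b y)\<^sup>2)"
    using P by (intro sum_mono2) auto
  also have "\<dots> = (\<Sum>x\<in>Pow P. (a x)\<^sup>2) * (\<Sum>x\<in>Pow P. (b x)\<^sup>2)"
    by (simp add: sum_product sum.cartesian_product power_mult_distrib)
  finally have "2 ^ (2 * M) * (\<Sum>z\<in>Pow P. \<Sum>x\<in>Pow z. (a x * b (z - x))\<^sup>2)
      \<le> 2 ^ (2 * M) * ((\<Sum>x\<in>Pow P. (a x)\<^sup>2) * (\<Sum>x\<in>Pow P. (b x)\<^sup>2))"
    by (intro mult_left_mono) auto
  moreover have "(\<Sum>z\<in>Pow P. (\<Sum>x\<in>Pow z. a x * b (z - x))\<^sup>2)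
      \<le> 2 ^ (2 * M) * (\<Sum>z\<in>Pow P. \<Sum>x\<in>Pow z. (a x * b (z - x))\<^sup>2)"
    unfolding sum_distrib_left[of "2 ^ (2 * M)" "\<lambda>z. \<Sum>x\<in>Pow z. (a x * b (z - x))\<^sup>2"]
    by (intro sum_mono z)
  ultimately show ?thesis by linarith
qed

lemma disjoint_correlation_bound:
  fixes a b :: "nat set \<Rightarrow> real"
  assumes P: "finite P" and b: "\<And>x. card x > M \<Longrightarrow> b x = 0"
  shows "(\<Sum>z\<in>Pow P. (\<Sum>x\<in>{x \<in> Pow P. x \<inter> z = {}}. a x * b (z \<union> x))\<^sup>2)
    \<le> 2 ^ M * ((\<Sum>x\<in>Pow P. (a x)\<^sup>2) * (\<Sum>x\<in>Pow P. (b x)\<^sup>2))"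
proof -
  let ?X = "\<lambda>z. {x \<in> Pow P. x \<inter> z = {}}"
  have z: "(\<Sum>x\<in>?X z. a x * b (z \<union> x))\<^sup>2 \<le> (\<Sum>x\<in>Pow P. (a x)\<^sup>2) * (\<Sum>x\<in>?X z. (b (z \<union> x))\<^sup>2)" for z
  proof -
    have "(\<Sum>x\<in>?X z. a x * b (z \<union> x))\<^sup>2 \<le> (\<Sum>x\<in>?X z. (a x)\<^sup>2) * (\<Sum>x\<in>?X z. (b (z \<union> x))\<^sup>2)"
      by (rule Cauchy_Schwarz_ineq_sum)
    also have "\<dots> \<le> (\<Sum>x\<in>Pow P. (a x)\<^sup>2) * (\<Sum>x\<in>?X z. (b (z \<union> x))\<^sup>2)"
      using P by (intro mult_right_mono sum_mono2 sum_nonneg) auto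
    finally show ?thesis .
  qed
  have "(\<Sum>z\<in>Pow P. \<Sum>x\<in>?X z. (b (z \<union> x))\<^sup>2) = (\<Sum>(z, x)\<in>Sigma (Pow P) ?X. (b (z \<union> x))\<^sup>2)"
    using P by (intro sum.Sigma) auto
  also have "\<dots> = (\<Sum>(w, x)\<in>Sigma (Pow P) Pow. (b w)\<^sup>2)"
    by (rule sum.reindex_bij_witness[where i = "\<lambda>(w, x). (w - x, x)" and j = "\<lambda>(z, x). (z \<union> x, x)"]) auto
  also have "\<dots> = (\<Sum>w\<in>Pow P. \<Sum>x\<in>Pow w. (b w)\<^sup>2)"
    using P by (intro sum.Sigma[symmetric]) (auto intro: finite_subset)
  also have "\<dots> \<le> (\<Sum>w\<in>Pow P. 2 ^ M * (b w)\<^sup>2)"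
  proof (intro sum_mono)
    fix w assume "w \<in> Pow P"
    then have fin: "finite w" using P by (auto intro: finite_subset)
    show "(\<Sum>x\<in>Pow w. (b w)\<^sup>2) \<le> 2 ^ M * (b w)\<^sup>2"
    proof (cases "card w \<le> M")
      case True
      then show ?thesis using fin by (simp add: card_Pow mult_right_mono power_increasing)
    qed (simp add: b)
  qed
  finally have b2: "(\<Sum>z\<in>Pow P. \<Sum>x\<in>?X z. (b (z \<union> x))\<^sup>2) \<le> 2 ^ M * (\<Sum>w\<in>Pow P. (b w)\<^sup>2)"
    by (simp add: sum_distrib_left)
  have "(\<Sum>z\<in>Pow P. (\<Sum>x\<in>?X z. a x * b (z \<union> x))\<^sup>2)
      \<le> (\<Sum>x\<in>Pow P. (a x)\<^sup>2) * (\<Sum>z\<in>Pow P. \<Sum>x\<in>?X z. (b (z \<union> x))\<^sup>2)"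
    unfolding sum_distrib_left[of "\<Sum>x\<in>Pow P. (a x)\<^sup>2" "\<lambda>z. \<Sum>x\<in>?X z. (b (z \<union> x))\<^sup>2"] by (intro sum_mono z)
  also have "\<dots> \<le> (\<Sum>x\<in>Pow P. (a x)\<^sup>2) * (2 ^ M * (\<Sum>w\<in>Pow P. (b w)\<^sup>2))"
    by (intro mult_left_mono b2 sum_nonneg) auto
  finally show ?thesis by (simp add: mult_ac)
qed

text \<open>With \<open>g p = \<nabla>\<phi>\<^sub>p\<close> its sum of squares is the Slater--Condon expression for the kinetic energy with the gradients of the
occupied orbitals left out.\<close>

definition virt_grad :: "nat set \<Rightarrow> nat set \<Rightarrow> (nat \<Rightarrow> 'h::real_inner) \<Rightarrow> (nat set \<Rightarrow> real) \<Rightarrow> nat set \<Rightarrow> 'h" where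
  "virt_grad Oc P g u z = (\<Sum>p\<in>P - Oc. contract Oc p u z *\<^sub>R g p)"

lemma norm_sum_scaleR_le:
  fixes v :: "'i \<Rightarrow> 'v::real_normed_vector"
  shows "norm (\<Sum>i\<in>I. (c i * a i) *\<^sub>R v i) \<le> (\<Sum>i\<in>I. \<bar>c i\<bar> * (\<bar>a i\<bar> * norm (v i)))"
  by (rule order_trans[OF norm_sum]) (simp add: abs_mult mult.assoc)

lemma abs_parity [simp]: "\<bar>parity Oc t x\<bar> = \<bar>t x\<bar>"
  by (simp add: parity_def abs_mult power_abs)

lemma norm_conv_le:
  fixes u :: "nat set \<Rightarrow> 'v::real_normed_vector"
  shows "norm (conv Oc t u z) \<le> (\<Sum>x\<in>Pow z. \<bar>t x\<bar> * norm (u (z - x)))"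
  using norm_sum_scaleR_le[where I = "Pow z" and c = "\<lambda>x. cross Oc (z - x) x" and a = t and v = "\<lambda>x. u (z - x)"]
  by (simp add: conv_def)

lemma virt_grad_conv_le:
  assumes z: "finite z" and P: "finite P"
  shows "norm (virt_grad Oc P g (conv Oc t u) z)
    \<le> (\<Sum>x\<in>Pow z. \<bar>t x\<bar> * norm (virt_grad Oc P g u (z - x)))
      + (\<Sum>x\<in>Pow z. norm (virt_grad Oc P g t x) * \<bar>u (z - x)\<bar>)"
proof -
  have "virt_grad Oc P g (conv Oc t u) z
      = (\<Sum>p\<in>P - Oc. conv Oc (parity Oc t) (contract Oc p u) z *\<^sub>R g p) + (\<Sum>p\<in>P - Oc. conv Oc (contract Oc p t) u z *\<^sub>R g p)"
    unfolding virt_grad_def sum.distrib[symmetric]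
    by (intro sum.cong refl) (auto simp: contract_conv[OF z] scaleR_add_left)
  also have "(\<Sum>p\<in>P - Oc. conv Oc (parity Oc t) (contract Oc p u) z *\<^sub>R g p) = conv Oc (parity Oc t) (virt_grad Oc P g u) z"
    unfolding conv_def virt_grad_def scaleR_sum_left scaleR_sum_right
    by (subst sum.swap) simp
  also have "(\<Sum>p\<in>P - Oc. conv Oc (contract Oc p t) u z *\<^sub>R g p)
      = (\<Sum>x\<in>Pow z. (cross Oc (z - x) x * u (z - x)) *\<^sub>R virt_grad Oc P g t x)"
    unfolding conv_def virt_grad_def scaleR_sum_left scaleR_sum_right
    by (subst sum.swap) (simp add: mult_ac)
  finally have "norm (virt_grad Oc P g (conv Oc t u) z) \<le> norm (conv Oc (parity Oc t) (virt_grad Oc P g u) z)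
      + norm (\<Sum>x\<in>Pow z. (cross Oc (z - x) x * u (z - x)) *\<^sub>R virt_grad Oc P g t x)"
    by (simp add: norm_triangle_ineq)
  moreover have "norm (conv Oc (parity Oc t) (virt_grad Oc P g u) z) \<le> (\<Sum>x\<in>Pow z. \<bar>t x\<bar> * norm (virt_grad Oc P g u (z - x)))"
    using norm_conv_le[of Oc "parity Oc t" "virt_grad Oc P g u" z] by simp
  moreover have "norm (\<Sum>x\<in>Pow z. (cross Oc (z - x) x * u (z - x)) *\<^sub>R virt_grad Oc P g t x)
      \<le> (\<Sum>x\<in>Pow z. norm (virt_grad Oc P g t x) * \<bar>u (z - x)\<bar>)"
    using norm_sum_scaleR_le[where I = "Pow z" and c = "\<lambda>x. cross Oc (z - x) x" and a = "\<lambda>x. u (z - x)" and v = "virt_grad Oc P g t"]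
    by (simp add: mult.commute)
  ultimately show ?thesis by linarith
qed

lemma virt_grad_adj_conv:
  assumes z: "finite z" and P: "finite P"
  shows "virt_grad Oc P g (adj_conv Oc P t u) z = adj_conv Oc P (parity Oc t) (virt_grad Oc P g u) z"
proof -
  have "virt_grad Oc P g (adj_conv Oc P t u) z = (\<Sum>p\<in>P - Oc. adj_conv Oc P (parity Oc t) (contract Oc p u) z *\<^sub>R g p)"
    unfolding virt_grad_def by (intro sum.cong refl) (auto simp: contract_adj_conv[OF P z])
  also have "\<dots> = adj_conv Oc P (parity Oc t) (virt_grad Oc P g u) z"
    unfolding adj_conv_def virt_grad_def scaleR_sum_left scaleR_sum_right
    by (subst sum.swap) simp
  finally show ?thesis .
qed

lemma norm_adj_conv_le:
  fixes u :: "nat set \<Rightarrow> 'v::real_normed_vector"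
  shows "norm (adj_conv Oc P t u z) \<le> (\<Sum>x\<in>{x \<in> Pow P. x \<inter> z = {}}. \<bar>t x\<bar> * norm (u (z \<union> x)))"
  using norm_sum_scaleR_le[where I = "{x \<in> Pow P. x \<inter> z = {}}" and c = "cross Oc z" and a = t and v = "\<lambda>x. u (z \<union> x)"]
  by (simp add: adj_conv_def)

definition sumsq :: "nat set \<Rightarrow> (nat set \<Rightarrow> 'v::real_normed_vector) \<Rightarrow> real" where
  "sumsq P u = (\<Sum>z\<in>Pow P. (norm (u z))\<^sup>2)"

lemma sumsq_nonneg [simp]: "0 \<le> sumsq P u"
  by (simp add: sumsq_def sum_nonneg)

lemma virt_grad_card: "(\<And>x. card x > M \<Longrightarrow> u x = 0) \<Longrightarrow> finite P \<Longrightarrow> card z > M \<Longrightarrow> virt_grad Oc P g u z = 0"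
proof -
  assume u: "\<And>x. card x > M \<Longrightarrow> u x = 0" and z: "card z > M"
  have "finite z" using z by (metis card.infinite not_less_zero)
  then have "u (insert p z) = 0" if "p \<notin> z" for p using u[of "insert p z"] z that by simp
  then show ?thesis by (auto simp: virt_grad_def contract_def intro!: sum.neutral)
qed

lemma sumsq_conv_le:
  assumes P: "finite P"
    and t: "\<And>x. card x > M \<Longrightarrow> t x = 0" and u: "\<And>x. card x > M \<Longrightarrow> u x = (0::real)"
  shows "sumsq P (conv Oc t u) \<le> 2 ^ (2 * M) * (sumsq P t * sumsq P u)"
proof -
  have "sumsq P (conv Oc t u) \<le> (\<Sum>z\<in>Pow P. (\<Sum>x\<in>Pow z. \<bar>t x\<bar> * \<bar>u (z - x)\<bar>)\<^sup>2)"
    unfolding sumsq_def using norm_conv_le[of Oc t u] by (intro sum_mono power_mono) auto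
  also have "\<dots> \<le> 2 ^ (2 * M) * (sumsq P t * sumsq P u)"
    unfolding sumsq_def real_norm_def
    by (rule subset_convolution_bound[OF P]) (auto simp: t u)
  finally show ?thesis .
qed

lemma sumsq_virt_grad_conv_le:
  assumes P: "finite P"
    and t: "\<And>x. card x > M \<Longrightarrow> t x = 0" and u: "\<And>x. card x > M \<Longrightarrow> u x = 0"
  shows "sumsq P (virt_grad Oc P g (conv Oc t u))
    \<le> 2 * 2 ^ (2 * M) * (sumsq P t * sumsq P (virt_grad Oc P g u) + sumsq P (virt_grad Oc P g t) * sumsq P u)"
proof -
  let ?A = "\<lambda>z. \<Sum>x\<in>Pow z. \<bar>t x\<bar> * norm (virt_grad Oc P g u (z - x))"
  let ?B = "\<lambda>z. \<Sum>x\<in>Pow z. norm (virt_grad Oc P g t x) * \<bar>u (z - x)\<bar>"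
  have "sumsq P (virt_grad Oc P g (conv Oc t u)) \<le> (\<Sum>z\<in>Pow P. 2 * (?A z)\<^sup>2 + 2 * (?B z)\<^sup>2)"
    unfolding sumsq_def
  proof (intro sum_mono)
    fix z assume "z \<in> Pow P"
    then have "finite z" using P by (auto intro: finite_subset)
    then have "(norm (virt_grad Oc P g (conv Oc t u) z))\<^sup>2 \<le> (?A z + ?B z)\<^sup>2"
      by (intro power_mono virt_grad_conv_le P) auto
    also have "\<dots> \<le> 2 * (?A z)\<^sup>2 + 2 * (?B z)\<^sup>2"
      using sum_squares_bound[of "?A z" "?B z"] by (simp add: power2_sum)
    finally show "(norm (virt_grad Oc P g (conv Oc t u) z))\<^sup>2 \<le> 2 * (?A z)\<^sup>2 + 2 * (?B z)\<^sup>2" .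
  qed
  also have "\<dots> = 2 * (\<Sum>z\<in>Pow P. (?A z)\<^sup>2) + 2 * (\<Sum>z\<in>Pow P. (?B z)\<^sup>2)"
    by (simp add: sum.distrib sum_distrib_left)
  also have "\<dots> \<le> 2 * (2 ^ (2 * M) * (sumsq P t * sumsq P (virt_grad Oc P g u)))
      + 2 * (2 ^ (2 * M) * (sumsq P (virt_grad Oc P g t) * sumsq P u))"
    unfolding sumsq_def real_norm_def
    by (intro add_mono mult_left_mono subset_convolution_bound[OF P])
      (auto simp: t u virt_grad_card[OF t P] virt_grad_card[OF u P])
  finally show ?thesis by (simp add: algebra_simps)
qed

lemma sumsq_adj_conv_le:
  fixes u :: "nat set \<Rightarrow> 'v::real_normed_vector"
  assumes P: "finite P" and u: "\<And>x. card x > M \<Longrightarrow> u x = 0"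
  shows "sumsq P (adj_conv Oc P t u) \<le> 2 ^ M * (sumsq P t * sumsq P u)"
proof -
  have "sumsq P (adj_conv Oc P t u) \<le> (\<Sum>z\<in>Pow P. (\<Sum>x\<in>{x \<in> Pow P. x \<inter> z = {}}. \<bar>t x\<bar> * norm (u (z \<union> x)))\<^sup>2)"
    unfolding sumsq_def by (intro sum_mono power_mono norm_adj_conv_le) auto
  also have "\<dots> \<le> 2 ^ M * (sumsq P t * sumsq P u)"
    unfolding sumsq_def real_norm_def
    by (rule disjoint_correlation_bound[OF P]) (auto simp: u)
  finally show ?thesis .
qed

lemma sumsq_virt_grad_adj_conv_le:
  assumes P: "finite P" and u: "\<And>x. card x > M \<Longrightarrow> u x = 0"
  shows "sumsq P (virt_grad Oc P g (adj_conv Oc P t u)) \<le> 2 ^ M * (sumsq P t * sumsq P (virt_grad Oc P g u))"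
proof -
  have "sumsq P (virt_grad Oc P g (adj_conv Oc P t u)) = sumsq P (adj_conv Oc P (parity Oc t) (virt_grad Oc P g u))"
    unfolding sumsq_def using P
    by (intro sum.cong refl) (auto simp: virt_grad_adj_conv[OF finite_subset[OF _ P] P])
  also have "\<dots> \<le> 2 ^ M * (sumsq P (parity Oc t) * sumsq P (virt_grad Oc P g u))"
    using virt_grad_card[OF u P] by (rule sumsq_adj_conv_le[OF P])
  also have "sumsq P (parity Oc t) = sumsq P t" by (simp add: sumsq_def)
  finally show ?thesis .
qed

section \<open>Determinants coded by holes and particles\<close>

lemma sum_matching_inner:
  fixes v :: "'i \<Rightarrow> 'v::real_inner"
  assumes I: "finite I" and D: "finite D" and k: "\<And>i. i \<in> I \<Longrightarrow> key i \<in> D"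
  shows "(\<Sum>i\<in>I. \<Sum>j\<in>I. if key i = key j then inner (v i) (v j) else 0)
    = (\<Sum>\<delta>\<in>D. (norm (\<Sum>i\<in>{i \<in> I. key i = \<delta>}. v i))\<^sup>2)"
proof -
  have "(\<Sum>\<delta>\<in>D. (norm (\<Sum>i\<in>{i \<in> I. key i = \<delta>}. v i))\<^sup>2)
      = (\<Sum>\<delta>\<in>D. \<Sum>i\<in>{i \<in> I. key i = \<delta>}. inner (v i) (\<Sum>j\<in>{j \<in> I. key j = \<delta>}. v j))"
    by (simp only: power2_norm_eq_inner inner_sum_left)
  also have "\<dots> = (\<Sum>\<delta>\<in>D. \<Sum>i\<in>{i \<in> I. key i = \<delta>}. inner (v i) (\<Sum>j\<in>{j \<in> I. key j = key i}. v j))"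
    by (intro sum.cong refl) auto
  also have "\<dots> = (\<Sum>i\<in>I. inner (v i) (\<Sum>j\<in>{j \<in> I. key j = key i}. v j))"
    by (rule sum.group[OF I D]) (use k in auto)
  also have "\<dots> = (\<Sum>i\<in>I. \<Sum>j\<in>I. if key i = key j then inner (v i) (v j) else 0)"
    unfolding inner_sum_right using I by (simp add: sum.inter_filter eq_commute)
  finally show ?thesis ..
qed

lemma norm_add_square_le:
  fixes a b :: "'v::real_inner"
  shows "(norm (a + b))\<^sup>2 \<le> 2 * (norm a)\<^sup>2 + 2 * (norm b)\<^sup>2"
proof -
  have "(norm (a + b))\<^sup>2 \<le> (norm a + norm b)\<^sup>2"
    by (intro power_mono norm_triangle_ineq) auto
  also have "\<dots> \<le> 2 * (norm a)\<^sup>2 + 2 * (norm b)\<^sup>2"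
    using sum_squares_bound[of "norm a" "norm b"] by (simp add: power2_sum)
  finally show ?thesis .
qed

definition kinetic :: "'a::euclidean_space l2 \<Rightarrow> real" where
  "kinetic u = (\<Sum>b\<in>Basis. (norm (weak_deriv b u))\<^sup>2)"

lemma h1_norm_sq_kinetic: "(h1_norm u)\<^sup>2 = (norm u)\<^sup>2 + kinetic u"
  by (simp add: h1_norm_sq kinetic_def)

lemma subspace_antisym_H1: "subspace (antisym_H1 :: ('n::finite) config l2 set)"
  unfolding antisym_H1_def by (intro subspace_inter subspace_antisym_L2 subspace_H1)

text \<open>The parameter \<open>ty\<close> carries the type of the particle indices.  The reference state is a parameter so that notions which
only depend on it, such as codes, do not depend on that type.\<close>

locale slater_basis =
  fixes K :: enat and \<phi> :: "nat \<Rightarrow> (real^3) l2" and ty :: "'n::{finite,linorder} itself"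
    and occupied :: "nat set"
  assumes occupied_def: "occupied = ref_state CARD('n)"
    and NK: "enat CARD('n) \<le> K"
    and orbitals_H1: "\<And>p. p \<in> orbitals K \<Longrightarrow> \<phi> p \<in> H1"
    and orthonormal: "\<And>p q. p \<in> orbitals K \<Longrightarrow> q \<in> orbitals K \<Longrightarrow> inner (\<phi> p) (\<phi> q) = (if p = q then 1 else 0)"
begin

text \<open>Exchanges states and their codes: the symmetric difference with the reference state.  The holes of a code are
its occupied orbitals, the particles its virtual ones.\<close>

definition toggle :: "nat set \<Rightarrow> nat set" where
  "toggle \<alpha> = (\<alpha> - occupied) \<union> (occupied - \<alpha>)"

lemma finite_occupied [simp]: "finite occupied" and card_occupied: "card occupied = CARD('n)"
  by (simp_all add: occupied_def ref_state_def)

lemma occupied_orbitals: "occupied \<subseteq> orbitals K"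
  using NK by (auto simp: occupied_def ref_state_def orbitals_def) (meson enat_ord_simps(1) order_trans)

lemma toggle_toggle [simp]: "toggle (toggle \<alpha>) = \<alpha>"
  by (auto simp: toggle_def)

lemma toggle_diff: "toggle \<alpha> - occupied = \<alpha> - occupied" "toggle \<alpha> \<inter> occupied = occupied - \<alpha>"
  by (auto simp: toggle_def)

text \<open>As many holes as particles, that is, toggling yields a set of \<open>N\<close> orbitals.\<close>

definition codes :: "nat set set" where
  "codes = {x. finite x \<and> x \<subseteq> orbitals K \<and> card (x \<inter> occupied) = card (x - occupied)}"

lemma toggle_states: "toggle \<alpha> \<in> codes \<longleftrightarrow> \<alpha> \<in> states CARD('n) K"
proof -
  have f: "finite (toggle \<alpha>) \<longleftrightarrow> finite \<alpha>"
    by (metis finite_Diff finite_Un finite_occupied toggle_def toggle_toggle)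
  have s: "toggle \<alpha> \<subseteq> orbitals K \<longleftrightarrow> \<alpha> \<subseteq> orbitals K"
    using occupied_orbitals by (auto simp: toggle_def)
  have c: "card (occupied - \<alpha>) = card (\<alpha> - occupied) \<longleftrightarrow> card \<alpha> = CARD('n)" if "finite \<alpha>"
  proof -
    have "card (occupied - \<alpha>) + card (occupied \<inter> \<alpha>) = CARD('n)"
      using card_occupied by (metis add.commute card_Int_Diff finite_occupied)
    moreover have "card (\<alpha> - occupied) + card (occupied \<inter> \<alpha>) = card \<alpha>"
      using that by (metis Int_commute add.commute card_Int_Diff)
    ultimately show ?thesis by linarith
  qed
  show ?thesis using f s c by (auto simp: codes_def states_def toggle_diff)
qed

lemma toggle_codes: "x \<in> codes \<longleftrightarrow> toggle x \<in> states CARD('n) K"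
  using toggle_states[of "toggle x"] by simp

lemma code_card: "x \<in> codes \<Longrightarrow> card x \<le> 2 * CARD('n)"
proof -
  assume x: "x \<in> codes"
  have "card x = card (x \<inter> occupied) + card (x - occupied)"
    using x by (metis (mono_tags, lifting) card_Int_Diff codes_def mem_Collect_eq)
  moreover have "card (x \<inter> occupied) \<le> CARD('n)"
    using card_mono[of occupied "x \<inter> occupied"] card_occupied by simp
  moreover have "card (x \<inter> occupied) = card (x - occupied)" using x by (simp add: codes_def)
  ultimately show ?thesis by simp
qed

lemma empty_code: "{} \<in> codes"
  by (simp add: codes_def)

lemma code_finite: "x \<in> codes \<Longrightarrow> finite x"
  by (simp add: codes_def)

lemma Un_codes: "x \<in> codes \<Longrightarrow> y \<in> codes \<Longrightarrow> x \<inter> y = {} \<Longrightarrow> x \<union> y \<in> codes"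
proof -
  assume x: "x \<in> codes" and y: "y \<in> codes" and d: "x \<inter> y = {}"
  have "card ((x \<union> y) \<inter> occupied) = card (x \<inter> occupied) + card (y \<inter> occupied)"
    unfolding Int_Un_distrib2 using x y d by (intro card_Un_disjoint) (auto simp: codes_def)
  moreover have "card ((x \<union> y) - occupied) = card (x - occupied) + card (y - occupied)"
    unfolding Un_Diff using x y d by (intro card_Un_disjoint) (auto simp: codes_def)
  ultimately show ?thesis using x y by (auto simp: codes_def)
qed

lemma Un_codes_cancel: "x \<in> codes \<Longrightarrow> z \<union> x \<in> codes \<Longrightarrow> x \<inter> z = {} \<Longrightarrow> z \<in> codes"
proof -
  assume x: "x \<in> codes" and zx: "z \<union> x \<in> codes" and d: "x \<inter> z = {}"
  have f: "finite z" "finite x" using zx by (auto simp: codes_def)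
  have "card ((z \<union> x) \<inter> occupied) = card (z \<inter> occupied) + card (x \<inter> occupied)"
    unfolding Int_Un_distrib2 using f d by (intro card_Un_disjoint) auto
  moreover have "card ((z \<union> x) - occupied) = card (z - occupied) + card (x - occupied)"
    unfolding Un_Diff using f d by (intro card_Un_disjoint) auto
  ultimately show ?thesis using x zx by (auto simp: codes_def)
qed

definition e :: "nat set \<Rightarrow> 'n config l2" where
  "e x = slater \<phi> (toggle x)"

lemma inner_e: "x \<in> codes \<Longrightarrow> y \<in> codes \<Longrightarrow> inner (e x) (e y) = (if x = y then 1 else 0)"
proof -
  assume "x \<in> codes" "y \<in> codes"
  then have "toggle x \<in> states CARD('n) K" "toggle y \<in> states CARD('n) K"
    by (simp_all add: toggle_codes[symmetric])
  then have "inner (e x) (e y) = (if toggle x = toggle y then 1 else 0)"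
    unfolding e_def by (intro inner_slater[OF orthonormal]) (auto simp: states_def)
  moreover have "toggle x = toggle y \<longleftrightarrow> x = y" by (metis toggle_toggle)
  ultimately show ?thesis by simp
qed

lemma e_antisym_H1: "x \<in> codes \<Longrightarrow> e x \<in> antisym_H1"
proof -
  assume "x \<in> codes"
  then have s: "toggle x \<subseteq> orbitals K" "finite (toggle x)" "card (toggle x) = CARD('n)"
    using toggle_codes[of x] by (auto simp: states_def)
  then have "slater \<phi> (toggle x) \<in> (H1 :: 'n config l2 set)"
    by (intro slater_H1(1)) (auto intro: orbitals_H1)
  moreover have "slater \<phi> (toggle x) \<in> (antisym_L2 :: 'n config l2 set)"
    by (rule slater_antisym[OF s(2,3)])
  ultimately show ?thesis by (simp add: e_def antisym_H1_def)
qed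

lemma e_H1: "x \<in> codes \<Longrightarrow> e x \<in> H1"
  using e_antisym_H1 by (auto simp: antisym_H1_def)

abbreviation (input) dets :: "'n config l2 set" where "dets \<equiv> span (e ` codes)"

lemma dets_eq: "span (slater \<phi> ` states CARD('n) K) = dets"
proof -
  have "slater \<phi> ` states CARD('n) K = e ` codes"
  proof (intro set_eqI iffI)
    fix v :: "'n config l2" assume "v \<in> slater \<phi> ` states CARD('n) K"
    then obtain \<alpha> where "v = slater \<phi> \<alpha>" "\<alpha> \<in> states CARD('n) K" by auto
    then have "v = e (toggle \<alpha>)" "toggle \<alpha> \<in> codes" by (auto simp: e_def toggle_states)
    then show "v \<in> e ` codes" by blast
  qed (auto simp: e_def toggle_codes)
  then show ?thesis by simp
qed

lemma dets_antisym_H1: "w \<in> dets \<Longrightarrow> w \<in> antisym_H1"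
  using span_minimal[of "e ` codes" antisym_H1] e_antisym_H1 subspace_antisym_H1 by blast

lemma dets_H1: "w \<in> dets \<Longrightarrow> w \<in> H1"
  using dets_antisym_H1 by (auto simp: antisym_H1_def)

text \<open>Cut off outside \<open>codes\<close>, since \<open>slater\<close> has no meaningful value at sets of the wrong size.\<close>

definition coef :: "'n config l2 \<Rightarrow> nat set \<Rightarrow> real" where
  "coef u x = (if x \<in> codes then inner u (e x) else 0)"

lemma coef_outside: "x \<notin> codes \<Longrightarrow> coef u x = 0"
  by (simp add: coef_def)

lemma coef_linear: "coef (u + v) x = coef u x + coef v x" "coef (u - v) x = coef u x - coef v x"
  "coef (c *\<^sub>R u) x = c * coef u x" "coef 0 x = 0"
  by (auto simp: coef_def inner_add_left inner_diff_left)

lemma coef_sum: "coef (\<Sum>i\<in>I. f i) x = (\<Sum>i\<in>I. coef (f i) x)"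
  by (auto simp: coef_def inner_sum_left)

lemma coef_e: "x \<in> codes \<Longrightarrow> coef (e x) y = (if y = x then 1 else 0)"
  by (auto simp: coef_def inner_e)

lemma coef_tendsto: "X \<longlonglongrightarrow> v \<Longrightarrow> (\<lambda>n. coef (X n) x) \<longlonglongrightarrow> coef v x"
  unfolding coef_def by (auto intro: tendsto_intros)

definition on_codes :: "(nat set \<Rightarrow> real) \<Rightarrow> bool" where
  "on_codes c \<longleftrightarrow> (\<forall>x. c x \<noteq> 0 \<longrightarrow> x \<in> codes)"

lemma on_codes_coef: "on_codes (coef u)"
  by (auto simp: on_codes_def coef_def split: if_splits)

lemma on_codes_card: "on_codes c \<Longrightarrow> card x > 2 * CARD('n) \<Longrightarrow> c x = 0"
  unfolding on_codes_def using code_card by fastforce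

lemma on_codes_conv: "on_codes t \<Longrightarrow> on_codes u \<Longrightarrow> on_codes (conv occupied t u)"
proof -
  assume t: "on_codes t" and u: "on_codes u"
  show ?thesis
    unfolding on_codes_def
  proof (intro allI impI)
    fix z assume "conv occupied t u z \<noteq> 0"
    then obtain x where x: "x \<subseteq> z" "t x \<noteq> 0" "u (z - x) \<noteq> 0"
      unfolding conv_def by (auto elim!: sum.not_neutral_contains_not_neutral)
    then have "x \<union> (z - x) \<in> codes" using t u by (intro Un_codes) (auto simp: on_codes_def)
    then show "z \<in> codes" using x by (simp add: Un_absorb1)
  qed
qed

lemma on_codes_adj_conv: "on_codes t \<Longrightarrow> on_codes u \<Longrightarrow> on_codes (adj_conv occupied P t u)"
  unfolding on_codes_def[of "adj_conv occupied P t u"]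
proof (intro allI impI)
  fix z assume t: "on_codes t" and u: "on_codes u" and "adj_conv occupied P t u z \<noteq> 0"
  then obtain x where x: "x \<inter> z = {}" "t x \<noteq> 0" "u (z \<union> x) \<noteq> 0"
    unfolding adj_conv_def by (auto elim!: sum.not_neutral_contains_not_neutral)
  then show "z \<in> codes" using t u by (intro Un_codes_cancel[of x z]) (auto simp: on_codes_def)
qed

text \<open>A window is a finite set of orbitals to which finitely many finite combinations of determinants can be confined; on it
the finite convolution algebra applies.\<close>

definition window :: "nat set \<Rightarrow> bool" where
  "window P \<longleftrightarrow> finite P \<and> occupied \<subseteq> P \<and> P \<subseteq> orbitals K"

definition synth :: "nat set \<Rightarrow> (nat set \<Rightarrow> real) \<Rightarrow> 'n config l2" where
  "synth P c = (\<Sum>x\<in>Pow P \<inter> codes. c x *\<^sub>R e x)"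

definition fits :: "nat set \<Rightarrow> (nat set \<Rightarrow> real) \<Rightarrow> bool" where
  "fits P c \<longleftrightarrow> on_codes c \<and> (\<forall>x. c x \<noteq> 0 \<longrightarrow> x \<subseteq> P)"

lemma synth_dets: "synth P c \<in> dets"
  unfolding synth_def by (intro span_sum span_scale span_base) auto

lemma coef_synth:
  assumes P: "window P" and c: "fits P c"
  shows "coef (synth P c) = c"
proof
  fix x
  have f: "finite (Pow P \<inter> codes)" using P by (simp add: window_def)
  have "coef (synth P c) x = (\<Sum>y\<in>Pow P \<inter> codes. if x = y then c y else 0)"
    unfolding synth_def coef_sum by (intro sum.cong refl) (auto simp: coef_linear coef_e)
  also have "\<dots> = c x"
    using f c by (auto simp: sum.delta' fits_def on_codes_def)
  finally show "coef (synth P c) x = c x" .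
qed

lemma synth_mono:
  assumes "window P'" "P \<subseteq> P'" "fits P c"
  shows "synth P' c = synth P c"
  unfolding synth_def using assms
  by (intro sum.mono_neutral_right) (auto simp: window_def fits_def)

lemma dets_window:
  assumes "w \<in> dets"
  shows "\<exists>P. window P \<and> fits P (coef w) \<and> w = synth P (coef w)"
  using assms
proof (induction rule: span_induct_alt)
  case base
  have "window occupied" using occupied_orbitals by (simp add: window_def)
  then show ?case by (intro exI[of _ occupied]) (simp add: fits_def on_codes_def coef_linear synth_def)
next
  case (step c v w)
  then obtain x where x: "v = e x" "x \<in> codes" by blast
  obtain P where P: "window P" "fits P (coef w)" "w = synth P (coef w)" using step by blast
  let ?P = "P \<union> x"
  have P': "window ?P" using P x by (auto simp: window_def codes_def)
  have w: "fits ?P (coef (c *\<^sub>R v + w))"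
    using P x by (auto simp: fits_def on_codes_coef coef_linear coef_e split: if_splits)
  have "synth ?P (coef (c *\<^sub>R v + w)) = synth ?P (\<lambda>y. c * coef v y) + synth ?P (coef w)"
    by (simp add: synth_def coef_linear scaleR_add_left sum.distrib)
  also have "synth ?P (coef w) = w" using synth_mono[OF P' _ P(2)] P(3) by simp
  also have "synth ?P (\<lambda>y. c * coef v y) = (\<Sum>y\<in>Pow ?P \<inter> codes. if x = y then c *\<^sub>R e y else 0)"
    unfolding synth_def x(1) using x(2) by (intro sum.cong refl) (auto simp: coef_e)
  also have "\<dots> = c *\<^sub>R v"
    using P' x by (simp add: window_def sum.delta')
  finally show ?case using P' w by (intro exI[of _ ?P]) simp
qed

lemma dets_window2:
  assumes "t \<in> dets" "u \<in> dets"
  shows "\<exists>P. window P \<and> fits P (coef t) \<and> fits P (coef u) \<and> t = synth P (coef t) \<and> u = synth P (coef u)"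
proof -
  obtain P where P: "window P" "fits P (coef t)" "t = synth P (coef t)" using dets_window[OF assms(1)] by blast
  obtain P' where P': "window P'" "fits P' (coef u)" "u = synth P' (coef u)" using dets_window[OF assms(2)] by blast
  have W: "window (P \<union> P')" using P P' by (auto simp: window_def)
  moreover have "fits (P \<union> P') (coef t)" "fits (P \<union> P') (coef u)"
    using P P' by (auto simp: fits_def)
  moreover have "t = synth (P \<union> P') (coef t)" using synth_mono[OF W _ P(2)] P(3) by simp
  moreover have "u = synth (P \<union> P') (coef u)" using synth_mono[OF W _ P'(2)] P'(3) by simp
  ultimately show ?thesis by blast
qed

lemma inner_synth:
  assumes P: "window P" and c: "fits P c" and d: "fits P d"
  shows "inner (synth P c) (synth P d) = (\<Sum>x\<in>Pow P. c x * d x)"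
proof -
  have f: "finite P" using P by (simp add: window_def)
  have "inner (synth P c) (synth P d) = (\<Sum>x\<in>Pow P \<inter> codes. c x * inner (e x) (synth P d))"
    by (simp add: synth_def[of P c] inner_sum_left)
  also have "\<dots> = (\<Sum>x\<in>Pow P \<inter> codes. c x * d x)"
  proof (intro sum.cong refl)
    fix x assume "x \<in> Pow P \<inter> codes"
    then have "inner (e x) (synth P d) = coef (synth P d) x"
      by (simp add: coef_def inner_commute)
    then show "c x * inner (e x) (synth P d) = c x * d x" by (simp add: coef_synth[OF P d])
  qed
  also have "\<dots> = (\<Sum>x\<in>Pow P. c x * d x)"
    using f c by (intro sum.mono_neutral_left) (auto simp: fits_def on_codes_def)
  finally show ?thesis .
qed

lemma norm_synth: "window P \<Longrightarrow> fits P c \<Longrightarrow> (norm (synth P c))\<^sup>2 = sumsq P c"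
  using inner_synth[of P c c] by (simp only: power2_norm_eq_inner sumsq_def real_norm_def power2_abs) (simp only: power2_eq_square)

abbreviation grad :: "nat \<Rightarrow> (real^3) l2 ^ 3" where "grad \<equiv> orbital_grad \<phi>"

text \<open>The factor \<open>2\<close> comes from \<open>\<parallel>a + b\<parallel>\<^sup>2 \<le> 2 \<parallel>a\<parallel>\<^sup>2 + 2 \<parallel>b\<parallel>\<^sup>2\<close>.  One factor \<open>N\<close> is the number of occupied orbitals whose removal
can lead to the same set of \<open>N - 1\<close> orbitals, the other the number of occupied orbitals that can be removed from one state.\<close>

definition occ_const :: real where
  "occ_const = 2 * real (card occupied) * (real (card occupied) * (\<Sum>p\<in>occupied. (norm (grad p))\<^sup>2))"

lemma occ_const_nonneg: "0 \<le> occ_const"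
  by (simp add: occ_const_def sum_nonneg)

lemma virtual_insert_sign:
  assumes "p \<in> orbitals K" "p \<notin> occupied"
  shows "insert_sign \<delta> p = cross occupied (toggle \<delta>) {p}"
proof -
  have "cross occupied (toggle \<delta>) {p} = (\<Prod>a\<in>\<delta> - occupied. ord_sign a p)"
  proof -
    have "{p} - occupied = {p}" using assms by auto
    then show ?thesis by (simp add: cross_def toggle_diff)
  qed
  also have "\<dots> = insert_sign \<delta> p"
  proof (cases "finite \<delta>")
    case True
    have "ord_sign a p = 1" if "a \<in> occupied" for a
      using that assms by (auto simp: ord_sign_def occupied_def ref_state_def orbitals_def)
    then show ?thesis unfolding insert_sign_def using True
      by (intro prod.mono_neutral_left) auto
  next
    case False
    then show ?thesis by (simp add: insert_sign_def)
  qed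
  finally show ?thesis ..
qed

text \<open>By the Slater--Condon rule the kinetic energy is a sum over the sets \<open>\<delta>\<close> of \<open>N - 1\<close> orbitals of the squared norm of a vector
\<open>A \<delta> + B \<delta>\<close>, where \<open>A\<close> collects the virtual and \<open>B\<close> the occupied orbitals.  The first is a virtual gradient.  The second
has at most \<open>N\<close> terms for each \<open>\<delta>\<close>, so its sum of squares is bounded by the L2 norm.\<close>

lemma kinetic_synth:
  assumes P: "window P" and c: "fits P c"
  shows "kinetic (synth P c) \<le> 2 * sumsq P (virt_grad occupied P grad c) + occ_const * sumsq P c"
    and "sumsq P (virt_grad occupied P grad c) \<le> 2 * kinetic (synth P c) + occ_const * sumsq P c"
proof -
  have fP: "finite P" and oP: "occupied \<subseteq> P" and PK: "P \<subseteq> orbitals K" using P by (auto simp: window_def)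
  let ?C = "Pow P \<inter> codes"
  have fC: "finite ?C" using fP by simp
  \<comment> \<open>A pair consists of a code and an orbital of its state; its key is what is left of the state when the orbital is removed.\<close>
  define I where "I = Sigma ?C toggle"
  define key where "key = (\<lambda>(x, p). toggle x - {p :: nat})"
  define v where "v = (\<lambda>(x, p). (c x * insert_sign (toggle x - {p}) p) *\<^sub>R grad p)"
  have tf: "finite (toggle x)" if "x \<in> ?C" for x
    using that toggle_codes[of x] by (auto simp: states_def)
  have tP: "toggle x \<subseteq> P" if "x \<subseteq> P" for x using that oP by (auto simp: toggle_def)
  have fI: "finite I" unfolding I_def using fC tf by (rule finite_SigmaI)
  have keyP: "key i \<in> Pow P" if "i \<in> I" for i
  proof -
    obtain x p where xp: "i = (x, p)" by (cases i)
    then show ?thesis using that tP[of x] by (auto simp: I_def key_def)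
  qed
  have kin: "kinetic (synth P c) = (\<Sum>\<delta>\<in>Pow P. (norm (\<Sum>i\<in>{i \<in> I. key i = \<delta>}. v i))\<^sup>2)"
  proof -
    have eH: "c x *\<^sub>R e x \<in> H1" if "x \<in> ?C" for x
      using that e_H1 by (intro subspace_scale[OF subspace_H1]) auto
    have wd: "weak_deriv b (synth P c) = (\<Sum>x\<in>?C. c x *\<^sub>R weak_deriv b (e x))" if b: "b \<in> Basis" for b
      unfolding synth_def using b eH e_H1
      by (subst weak_deriv_sum) (auto intro!: sum.cong weak_deriv_scaleR)
    have "kinetic (synth P c) = (\<Sum>b\<in>Basis. \<Sum>x\<in>?C. \<Sum>y\<in>?C. c x * c y * inner (weak_deriv b (e x)) (weak_deriv b (e y)))"
      unfolding kinetic_def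
    proof (intro sum.cong refl)
      fix b :: "'n config" assume b: "b \<in> Basis"
      show "(norm (weak_deriv b (synth P c)))\<^sup>2 = (\<Sum>x\<in>?C. \<Sum>y\<in>?C. c x * c y * inner (weak_deriv b (e x)) (weak_deriv b (e y)))"
        unfolding wd[OF b] power2_norm_eq_inner inner_sum_left
        by (simp add: inner_sum_right sum_distrib_left mult_ac)
    qed
    also have "\<dots> = (\<Sum>x\<in>?C. \<Sum>y\<in>?C. \<Sum>b\<in>Basis. c x * c y * inner (weak_deriv b (e x)) (weak_deriv b (e y)))"
      by (subst sum.swap, rule sum.cong[OF refl], subst sum.swap, rule refl)
    also have "\<dots> = (\<Sum>x\<in>?C. \<Sum>y\<in>?C. c x * c y * (\<Sum>b\<in>Basis. inner (weak_deriv b (e x)) (weak_deriv b (e y))))"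
      by (simp add: sum_distrib_left)
    also have "\<dots> = (\<Sum>x\<in>?C. \<Sum>y\<in>?C. \<Sum>p\<in>toggle x. \<Sum>q\<in>toggle y.
        if key (x, p) = key (y, q) then inner (v (x, p)) (v (y, q)) else 0)"
    proof (intro sum.cong refl)
      fix x y assume x: "x \<in> ?C" and y: "y \<in> ?C"
      have s: "toggle x \<in> states CARD('n) K" "toggle y \<in> states CARD('n) K" using x y toggle_codes by auto
      have "(\<Sum>b\<in>Basis. inner (weak_deriv b (e x)) (weak_deriv b (e y)))
        = (\<Sum>p\<in>toggle x. \<Sum>q\<in>toggle y. if toggle x - {p} = toggle y - {q}
            then insert_sign (toggle x - {p}) p * insert_sign (toggle y - {q}) q * inner (grad p) (grad q) else 0)"
        unfolding e_def by (rule slater_condon_gradient[OF orthonormal orbitals_H1]) (use s in \<open>auto simp: states_def\<close>)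
      then show "c x * c y * (\<Sum>b\<in>Basis. inner (weak_deriv b (e x)) (weak_deriv b (e y)))
        = (\<Sum>p\<in>toggle x. \<Sum>q\<in>toggle y. if key (x, p) = key (y, q) then inner (v (x, p)) (v (y, q)) else 0)"
        by (simp only: sum_distrib_left) (intro sum.cong refl, simp add: key_def v_def)
    qed
    also have "\<dots> = (\<Sum>x\<in>?C. \<Sum>p\<in>toggle x. \<Sum>y\<in>?C. \<Sum>q\<in>toggle y.
        if key (x, p) = key (y, q) then inner (v (x, p)) (v (y, q)) else 0)"
      by (rule sum.cong[OF refl], rule sum.swap)
    also have "\<dots> = (\<Sum>i\<in>I. \<Sum>j\<in>I. if key i = key j then inner (v i) (v j) else 0)"
      unfolding I_def using fC tf by (simp add: sum.Sigma case_prod_unfold) (simp only: prod.collapse)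
    also have "\<dots> = (\<Sum>\<delta>\<in>Pow P. (norm (\<Sum>i\<in>{i \<in> I. key i = \<delta>}. v i))\<^sup>2)"
      by (rule sum_matching_inner[OF fI _ keyP]) (simp_all add: fP)
    finally show ?thesis .
  qed
  define A where "A \<delta> = (\<Sum>i\<in>{i \<in> I. key i = \<delta> \<and> snd i \<notin> occupied}. v i)" for \<delta>
  define B where "B \<delta> = (\<Sum>i\<in>{i \<in> I. key i = \<delta> \<and> snd i \<in> occupied}. v i)" for \<delta>
  have AB: "(\<Sum>i\<in>{i \<in> I. key i = \<delta>}. v i) = A \<delta> + B \<delta>" for \<delta>
  proof -
    have "{i \<in> I. key i = \<delta>} = {i \<in> I. key i = \<delta> \<and> snd i \<notin> occupied} \<union> {i \<in> I. key i = \<delta> \<and> snd i \<in> occupied}"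
      by auto
    then show ?thesis unfolding A_def B_def using fI by (subst sum.union_disjoint[symmetric]) auto
  qed
  have A_eq: "A \<delta> = virt_grad occupied P grad c (toggle \<delta>)" if \<delta>: "\<delta> \<subseteq> P" for \<delta>
  proof -
    let ?T = "{p \<in> P - occupied. p \<notin> \<delta> \<and> insert p (toggle \<delta>) \<in> codes}"
    have pt: "p \<in> toggle \<delta> \<longleftrightarrow> p \<in> \<delta>" if "p \<notin> occupied" for p using that by (auto simp: toggle_def)
    have it: "toggle (insert p (toggle \<delta>)) = insert p \<delta>" if "p \<notin> occupied" for p
      using that by (auto simp: toggle_def)
    have "virt_grad occupied P grad c (toggle \<delta>) = (\<Sum>p\<in>?T. contract occupied p c (toggle \<delta>) *\<^sub>R grad p)"
      unfolding virt_grad_def using fP c pt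
      by (intro sum.mono_neutral_right) (auto simp: contract_def fits_def on_codes_def)
    also have "\<dots> = A \<delta>"
      unfolding A_def
    proof (rule sum.reindex_bij_witness[where i = snd and j = "\<lambda>p. (insert p (toggle \<delta>), p)"])
      fix p assume p: "p \<in> ?T"
      then have pO: "p \<notin> occupied" by auto
      show "snd (insert p (toggle \<delta>), p) = p" by simp
      have "insert p (toggle \<delta>) \<subseteq> P" using p tP[OF \<delta>] by auto
      then show "(insert p (toggle \<delta>), p) \<in> {i \<in> I. key i = \<delta> \<and> snd i \<notin> occupied}"
        using p it[OF pO] by (auto simp: I_def key_def)
      have "insert p \<delta> - {p} = \<delta>" using p by auto
      then show "v (insert p (toggle \<delta>), p) = contract occupied p c (toggle \<delta>) *\<^sub>R grad p"
        using p pt[OF pO] virtual_insert_sign[of p \<delta>] PK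
        by (auto simp: v_def it[OF pO] contract_def mult.commute)
    next
      fix i assume i: "i \<in> {i \<in> I. key i = \<delta> \<and> snd i \<notin> occupied}"
      obtain x p where xp: "i = (x, p)" by (cases i)
      have x: "x \<in> ?C" "p \<in> toggle x" "toggle x - {p} = \<delta>" "p \<notin> occupied"
        using i by (auto simp: xp I_def key_def)
      have "toggle x = insert p \<delta>" using x by auto
      then have "x = toggle (insert p \<delta>)" by (metis toggle_toggle)
      then have xe: "insert p (toggle \<delta>) = x" using x(4) by (auto simp: toggle_def)
      then show "(insert (snd i) (toggle \<delta>), snd i) = i" by (simp add: xp)
      show "snd i \<in> ?T" using x xe tP[of x] by (auto simp: xp)
    qed
    finally show ?thesis ..
  qed
  have SA: "(\<Sum>\<delta>\<in>Pow P. (norm (A \<delta>))\<^sup>2) = sumsq P (virt_grad occupied P grad c)"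
    unfolding sumsq_def
    by (rule sum.reindex_bij_witness[where i = toggle and j = toggle]) (auto simp: A_eq dest: tP)
  have SB: "(\<Sum>\<delta>\<in>Pow P. (norm (B \<delta>))\<^sup>2) \<le> occ_const / 2 * sumsq P c"
  proof -
    define G where "G = (\<Sum>p\<in>occupied. (norm (grad p))\<^sup>2)"
    have oc: "occ_const = 2 * real CARD('n) * (real CARD('n) * G)"
      by (simp add: occ_const_def G_def card_occupied)
    define J where "J = {i \<in> I. snd i \<in> occupied}"
    have fJ: "finite J" using fI by (simp add: J_def)
    have J\<delta>: "{i \<in> I. key i = \<delta> \<and> snd i \<in> occupied} = {i \<in> J. key i = \<delta>}" for \<delta> by (auto simp: J_def)
    have vG: "(norm (v i))\<^sup>2 \<le> G * (c (fst i))\<^sup>2" if "i \<in> J" for i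
    proof -
      obtain x p where xp: "i = (x, p)" by (cases i)
      have p: "p \<in> occupied" using that by (simp add: J_def xp)
      have "(insert_sign (toggle x - {p}) p)\<^sup>2 = 1"
        by (simp add: insert_sign_def power2_eq_square prod.distrib[symmetric])
      then have "(norm (v i))\<^sup>2 = (norm (grad p))\<^sup>2 * (c x)\<^sup>2"
        by (simp add: v_def xp power_mult_distrib)
      moreover have "(norm (grad p))\<^sup>2 \<le> G"
        unfolding G_def using p by (intro member_le_sum) auto
      ultimately show ?thesis by (simp add: xp mult_right_mono)
    qed
    have "(norm (B \<delta>))\<^sup>2 \<le> real CARD('n) * (\<Sum>i\<in>{i \<in> J. key i = \<delta>}. (norm (v i))\<^sup>2)" for \<delta>
    proof -
      have "inj_on snd {i \<in> J. key i = \<delta>}"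
      proof (rule inj_onI)
        fix i k assume i: "i \<in> {i \<in> J. key i = \<delta>}" and k: "k \<in> {i \<in> J. key i = \<delta>}" and s: "snd i = snd k"
        have "toggle (fst i) = insert (snd i) \<delta>" "toggle (fst k) = insert (snd k) \<delta>"
          using i k by (auto simp: J_def I_def key_def)
        then show "i = k" using s by (metis toggle_toggle prod.collapse)
      qed
      then have "card {i \<in> J. key i = \<delta>} \<le> card occupied"
        by (rule card_inj_on_le) (auto simp: J_def)
      then have cd: "real (card {i \<in> J. key i = \<delta>}) \<le> real CARD('n)" using card_occupied by simp
      have "(norm (B \<delta>))\<^sup>2 \<le> (\<Sum>i\<in>{i \<in> J. key i = \<delta>}. norm (v i))\<^sup>2"
        unfolding B_def J\<delta> by (intro power_mono norm_sum) auto
      also have "\<dots> \<le> (\<Sum>i\<in>{i \<in> J. key i = \<delta>}. (norm (v i))\<^sup>2) * card {i \<in> J. key i = \<delta>}"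
        by (rule sum_squared_le_sum_of_squares)
      also have "\<dots> \<le> (\<Sum>i\<in>{i \<in> J. key i = \<delta>}. (norm (v i))\<^sup>2) * CARD('n)"
        by (intro mult_left_mono cd sum_nonneg) auto
      finally show ?thesis by (simp add: mult.commute)
    qed
    then have "(\<Sum>\<delta>\<in>Pow P. (norm (B \<delta>))\<^sup>2) \<le> (\<Sum>\<delta>\<in>Pow P. real CARD('n) * (\<Sum>i\<in>{i \<in> J. key i = \<delta>}. (norm (v i))\<^sup>2))"
      by (intro sum_mono)
    also have "\<dots> = real CARD('n) * (\<Sum>i\<in>J. (norm (v i))\<^sup>2)"
      unfolding sum_distrib_left[symmetric]
      by (subst sum.group) (use fP fJ keyP in \<open>auto simp: J_def\<close>)
    also have "\<dots> \<le> real CARD('n) * (\<Sum>i\<in>J. G * (c (fst i))\<^sup>2)"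
      by (intro mult_left_mono sum_mono vG) auto
    also have "\<dots> \<le> real CARD('n) * (\<Sum>i\<in>Pow P \<times> occupied. G * (c (fst i))\<^sup>2)"
      using fP by (intro mult_left_mono sum_mono2) (auto simp: J_def I_def G_def sum_nonneg)
    also have "(\<Sum>i\<in>Pow P \<times> occupied. G * (c (fst i))\<^sup>2) = (\<Sum>x\<in>Pow P. \<Sum>p\<in>occupied. G * (c x)\<^sup>2)"
      unfolding sum.cartesian_product case_prod_unfold ..
    also have "real CARD('n) * \<dots> = occ_const / 2 * sumsq P c"
      by (simp add: oc sumsq_def card_occupied sum_distrib_left mult_ac)
    finally show ?thesis .
  qed
  have "kinetic (synth P c) \<le> (\<Sum>\<delta>\<in>Pow P. 2 * (norm (A \<delta>))\<^sup>2 + 2 * (norm (B \<delta>))\<^sup>2)"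
    unfolding kin AB by (intro sum_mono norm_add_square_le)
  also have "\<dots> = 2 * sumsq P (virt_grad occupied P grad c) + 2 * (\<Sum>\<delta>\<in>Pow P. (norm (B \<delta>))\<^sup>2)"
    by (simp add: sum.distrib sum_distrib_left[symmetric] SA)
  finally show "kinetic (synth P c) \<le> 2 * sumsq P (virt_grad occupied P grad c) + occ_const * sumsq P c"
    using SB by simp
  have "(norm (A \<delta>))\<^sup>2 \<le> 2 * (norm (A \<delta> + B \<delta>))\<^sup>2 + 2 * (norm (B \<delta>))\<^sup>2" for \<delta>
    using norm_add_square_le[of "A \<delta> + B \<delta>" "- B \<delta>"] by simp
  then have "(\<Sum>\<delta>\<in>Pow P. (norm (A \<delta>))\<^sup>2) \<le> (\<Sum>\<delta>\<in>Pow P. 2 * (norm (A \<delta> + B \<delta>))\<^sup>2 + 2 * (norm (B \<delta>))\<^sup>2)"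
    by (intro sum_mono)
  also have "\<dots> = 2 * kinetic (synth P c) + 2 * (\<Sum>\<delta>\<in>Pow P. (norm (B \<delta>))\<^sup>2)"
    by (simp add: sum.distrib sum_distrib_left[symmetric] kin AB)
  finally show "sumsq P (virt_grad occupied P grad c) \<le> 2 * kinetic (synth P c) + occ_const * sumsq P c"
    using SB SA by simp
qed

end

section \<open>The space spanned by the determinants\<close>

lemma null_by_bound:
  fixes f g :: "nat \<Rightarrow> real"
  assumes "\<And>n. \<bar>f n\<bar> \<le> g n" "g \<longlonglongrightarrow> 0"
  shows "f \<longlonglongrightarrow> 0"
  by (rule Lim_null_comparison[OF _ assms(2)]) (simp add: assms(1))

lemmas H1_diff = subspace_diff[OF subspace_H1]

context slater_basis
begin

definition V :: "'n config l2 set" where "V = H1K K \<phi>"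

lemma h1_tendsto_l2:
  assumes "(\<lambda>n. h1_norm (X n - v)) \<longlonglongrightarrow> 0"
  shows "X \<longlonglongrightarrow> v"
proof -
  have "(\<lambda>n. X n - v) \<longlonglongrightarrow> 0"
    by (rule Lim_null_comparison[OF _ assms]) (simp add: norm_le_h1_norm)
  then show ?thesis by (simp add: LIM_zero_iff)
qed

text \<open>For finite \<open>K\<close> the span is its own closure: an H1 limit of combinations of the finitely many determinants is recovered
from the limits of its coefficients.  So both cases share one description.\<close>

lemma V_iff: "u \<in> V \<longleftrightarrow> u \<in> antisym_H1 \<and> (\<forall>\<epsilon>>0. \<exists>w\<in>dets. h1_norm (u - w) < \<epsilon>)"
proof (cases "K = \<infinity>")
  case True
  show ?thesis unfolding V_def H1K_def dets_eq Let_def if_P[OF True] by simp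
next
  case False
  have V: "V = dets" unfolding V_def H1K_def dets_eq Let_def if_not_P[OF False] ..
  have fin: "finite (orbitals K)"
  proof -
    obtain k where "K = enat k" using False by auto
    then have "orbitals K \<subseteq> {..k}" by (auto simp: orbitals_def)
    then show ?thesis by (rule finite_subset) simp
  qed
  then have W: "window (orbitals K)" using occupied_orbitals by (simp add: window_def)
  show ?thesis
  proof
    assume "u \<in> V"
    then show "u \<in> antisym_H1 \<and> (\<forall>\<epsilon>>0. \<exists>w\<in>dets. h1_norm (u - w) < \<epsilon>)"
      using dets_antisym_H1 V by (auto intro!: bexI[of _ u])
  next
    assume u: "u \<in> antisym_H1 \<and> (\<forall>\<epsilon>>0. \<exists>w\<in>dets. h1_norm (u - w) < \<epsilon>)"
    then have uH: "u \<in> H1" by (simp add: antisym_H1_def)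
    have "\<forall>n. \<exists>w\<in>dets. h1_norm (u - w) < inverse (real (Suc n))" using u by simp
    then obtain w where w: "\<And>n. w n \<in> dets" "\<And>n. h1_norm (u - w n) < inverse (real (Suc n))" by metis
    have "\<bar>h1_norm (w n - u)\<bar> \<le> inverse (real (Suc n))" for n
      using w(2)[of n] h1_norm_minus_commute[OF dets_H1[OF w(1)] uH, of n] h1_norm_nonneg[of "w n - u"]
      by linarith
    then have "(\<lambda>n. h1_norm (w n - u)) \<longlonglongrightarrow> 0"
      by (rule null_by_bound[OF _ LIMSEQ_inverse_real_of_nat])
    then have lim: "w \<longlonglongrightarrow> u" by (rule h1_tendsto_l2)
    have "synth (orbitals K) (coef (w n)) = w n" for n
    proof -
      obtain P where P: "window P" "fits P (coef (w n))" "w n = synth P (coef (w n))"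
        using dets_window[OF w(1)] by blast
      have "synth (orbitals K) (coef (w n)) = synth P (coef (w n))"
        by (rule synth_mono[OF W _ P(2)]) (use P(1) in \<open>simp add: window_def\<close>)
      then show ?thesis by (rule trans[OF _ P(3)[symmetric]])
    qed
    then have weq: "(\<lambda>n. synth (orbitals K) (coef (w n))) = w" by (rule ext)
    have "(\<lambda>n. synth (orbitals K) (coef (w n))) \<longlonglongrightarrow> synth (orbitals K) (coef u)"
      unfolding synth_def by (intro tendsto_intros coef_tendsto lim)
    then have "synth (orbitals K) (coef u) = u"
      unfolding weq by (rule LIMSEQ_unique[OF _ lim])
    then show "u \<in> V" unfolding V using synth_dets[of "orbitals K" "coef u"] by (simp only:)
  qed
qed

lemma V_H1: "u \<in> V \<Longrightarrow> u \<in> H1"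
  by (simp add: V_iff antisym_H1_def)

lemma dets_V: "w \<in> dets \<Longrightarrow> w \<in> V"
  unfolding V_iff using dets_antisym_H1 by (auto intro!: bexI[of _ w])

lemma e_V: "x \<in> codes \<Longrightarrow> e x \<in> V"
  by (intro dets_V span_base) auto

lemma V_approx:
  assumes "u \<in> V"
  shows "\<exists>w. (\<forall>n. w n \<in> dets) \<and> (\<lambda>n. h1_norm (w n - u)) \<longlonglongrightarrow> 0"
proof -
  have "\<forall>n. \<exists>w\<in>dets. h1_norm (u - w) < inverse (real (Suc n))" using assms by (simp add: V_iff)
  then obtain w where w: "\<And>n. w n \<in> dets" "\<And>n. h1_norm (u - w n) < inverse (real (Suc n))" by metis
  have "\<bar>h1_norm (w n - u)\<bar> \<le> inverse (real (Suc n))" for n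
    using w(2)[of n] h1_norm_minus_commute[OF dets_H1[OF w(1)] V_H1[OF assms], of n] h1_norm_nonneg[of "w n - u"]
    by linarith
  then have "(\<lambda>n. h1_norm (w n - u)) \<longlonglongrightarrow> 0"
    by (rule null_by_bound[OF _ LIMSEQ_inverse_real_of_nat])
  then show ?thesis using w by blast
qed

text \<open>The only condition that is not immediate is antisymmetry of the limit, which uses almost-everywhere convergence.\<close>

lemma V_closed:
  assumes X: "\<And>n. X n \<in> dets" and v: "v \<in> H1" and lim: "(\<lambda>n. h1_norm (X n - v)) \<longlonglongrightarrow> 0"
  shows "v \<in> V"
  unfolding V_iff
proof (intro conjI allI impI)
  have "v \<in> antisym_L2"
    by (rule antisym_L2_closed[OF h1_tendsto_l2[OF lim]]) (use dets_antisym_H1[OF X] in \<open>auto simp: antisym_H1_def\<close>)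
  then show "v \<in> antisym_H1" using v by (simp add: antisym_H1_def)
  fix \<epsilon> :: real assume "\<epsilon> > 0"
  then have "\<forall>\<^sub>F n in sequentially. h1_norm (X n - v) < \<epsilon>"
    using order_tendstoD(2)[OF lim] by simp
  then obtain n where "h1_norm (X n - v) < \<epsilon>"
    unfolding eventually_sequentially by blast
  then show "\<exists>w\<in>dets. h1_norm (v - w) < \<epsilon>"
    using X h1_norm_minus_commute[OF v dets_H1[OF X, of n]] by (intro bexI[of _ "X n"]) auto
qed

lemma subspace_V: "subspace V"
proof (rule subspaceI)
  show "0 \<in> V" by (intro dets_V span_zero)
  show "u + v \<in> V" if u: "u \<in> V" and v: "v \<in> V" for u v
  proof -
    obtain w where w: "\<And>n. w n \<in> dets" "(\<lambda>n. h1_norm (w n - u)) \<longlonglongrightarrow> 0" using V_approx[OF u] by blast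
    obtain x where x: "\<And>n. x n \<in> dets" "(\<lambda>n. h1_norm (x n - v)) \<longlonglongrightarrow> 0" using V_approx[OF v] by blast
    show ?thesis
    proof (rule V_closed[of "\<lambda>n. w n + x n"])
      show "w n + x n \<in> dets" for n by (intro span_add w x)
      show "u + v \<in> H1" by (intro subspace_add[OF subspace_H1] V_H1 u v)
      have "h1_norm (w n + x n - (u + v)) \<le> h1_norm (w n - u) + h1_norm (x n - v)" for n
      proof -
        have "w n + x n - (u + v) = (w n - u) + (x n - v)" by simp
        then show ?thesis
          using h1_norm_triangle[OF H1_diff[OF dets_H1[OF w(1)] V_H1[OF u]] H1_diff[OF dets_H1[OF x(1)] V_H1[OF v]]]
          by (simp only:)
      qed
      then have "\<bar>h1_norm (w n + x n - (u + v))\<bar> \<le> h1_norm (w n - u) + h1_norm (x n - v)" for n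
        by (simp only: abs_of_nonneg[OF h1_norm_nonneg])
      moreover have "(\<lambda>n. h1_norm (w n - u) + h1_norm (x n - v)) \<longlonglongrightarrow> 0"
        using tendsto_add[OF w(2) x(2)] by simp
      ultimately show "(\<lambda>n. h1_norm (w n + x n - (u + v))) \<longlonglongrightarrow> 0"
        by (rule null_by_bound)
    qed
  qed
  show "c *\<^sub>R u \<in> V" if u: "u \<in> V" for c u
  proof -
    obtain w where w: "\<And>n. w n \<in> dets" "(\<lambda>n. h1_norm (w n - u)) \<longlonglongrightarrow> 0" using V_approx[OF u] by blast
    show ?thesis
    proof (rule V_closed[of "\<lambda>n. c *\<^sub>R w n"])
      show "c *\<^sub>R w n \<in> dets" for n by (intro span_scale w)
      show "c *\<^sub>R u \<in> H1" by (intro subspace_scale[OF subspace_H1] V_H1 u)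
      have "h1_norm (c *\<^sub>R w n - c *\<^sub>R u) = \<bar>c\<bar> * h1_norm (w n - u)" for n
        unfolding scaleR_diff_right[symmetric]
        by (rule h1_norm_scaleR[OF H1_diff[OF dets_H1[OF w(1)] V_H1[OF u]]])
      then show "(\<lambda>n. h1_norm (c *\<^sub>R w n - c *\<^sub>R u)) \<longlonglongrightarrow> 0"
        using tendsto_mult_left[OF w(2), of "\<bar>c\<bar>"] by simp
    qed
  qed
qed

lemmas V_add = subspace_add[OF subspace_V] and V_diff = subspace_diff[OF subspace_V]
  and V_scale = subspace_scale[OF subspace_V] and V_sum = subspace_sum[OF subspace_V]
  and V_0 = subspace_0[OF subspace_V]

lemma V_zeroI:
  assumes v: "v \<in> V" and z: "\<And>x. coef v x = 0"
  shows "v = 0"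
proof -
  obtain w where w: "\<And>n. w n \<in> dets" "(\<lambda>n. h1_norm (w n - v)) \<longlonglongrightarrow> 0" using V_approx[OF v] by blast
  have "inner v (w n) = 0" for n
  proof -
    have "inner v (e x) = 0" if "x \<in> codes" for x using z[of x] that by (simp add: coef_def)
    then have "e ` codes \<subseteq> {x. inner v x = 0}" by auto
    moreover have "subspace {x. inner v x = 0}" by (auto simp: subspace_def inner_add_right)
    ultimately show ?thesis using span_minimal w(1)[of n] by blast
  qed
  moreover have "(\<lambda>n. inner v (w n)) \<longlonglongrightarrow> inner v v"
    by (intro tendsto_intros h1_tendsto_l2 w)
  ultimately have "inner v v = 0" by (simp add: LIMSEQ_const_iff)
  then show ?thesis by simp
qed

lemma V_eqI: "u \<in> V \<Longrightarrow> v \<in> V \<Longrightarrow> (\<And>x. coef u x = coef v x) \<Longrightarrow> u = v"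
  using V_zeroI[OF V_diff, of u v] by (simp add: coef_linear)

lemma V_ortho_zero: "v \<in> V \<Longrightarrow> (\<And>w. w \<in> V \<Longrightarrow> inner w v = 0) \<Longrightarrow> v = 0"
  by (metis inner_eq_zero_iff)

text \<open>Comparable to the squared H1 norm (\<open>h1_norm_synth\<close>), but free of the gradients of the occupied orbitals, for which
\<open>contract\<close> has no Leibniz rule.\<close>

definition energy :: "nat set \<Rightarrow> (nat set \<Rightarrow> real) \<Rightarrow> real" where
  "energy P c = sumsq P c + sumsq P (virt_grad occupied P grad c)"

lemma h1_norm_synth:
  assumes P: "window P" and c: "fits P c"
  shows "(h1_norm (synth P c))\<^sup>2 \<le> (2 + occ_const) * energy P c"
    and "energy P c \<le> (2 + occ_const) * (h1_norm (synth P c))\<^sup>2"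
proof -
  have s: "0 \<le> occ_const" "0 \<le> sumsq P c" "0 \<le> sumsq P (virt_grad occupied P grad c)"
    "0 \<le> kinetic (synth P c)"
    by (auto simp: occ_const_nonneg kinetic_def sum_nonneg)
  then have m: "0 \<le> occ_const * sumsq P (virt_grad occupied P grad c)" "0 \<le> occ_const * kinetic (synth P c)"
    by simp_all
  have d: "(2 + occ_const) * (a + b) = 2 * a + 2 * b + occ_const * a + occ_const * b" for a b
    by (simp add: algebra_simps)
  show "(h1_norm (synth P c))\<^sup>2 \<le> (2 + occ_const) * energy P c"
    using kinetic_synth(1)[OF P c] s m unfolding h1_norm_sq_kinetic norm_synth[OF P c] energy_def d by linarith
  show "energy P c \<le> (2 + occ_const) * (h1_norm (synth P c))\<^sup>2"
    using kinetic_synth(2)[OF P c] s m unfolding h1_norm_sq_kinetic norm_synth[OF P c] energy_def d by linarith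
qed

definition l2_const :: real where "l2_const = 2 ^ (2 * card occupied)"

text \<open>The power of \<open>2\<close> is the constant of the convolution bound, as codes have at most \<open>2 N\<close> elements; a factor
\<open>2 + occ_const\<close> is lost in each of the three passages between \<open>energy\<close> and the H1 norm.\<close>

definition h1_const :: real where
  "h1_const = sqrt (2 * 2 ^ (2 * (2 * card occupied)) * (2 + occ_const) ^ 3)"

lemma l2_const_nonneg: "0 \<le> l2_const" and h1_const_nonneg: "0 \<le> h1_const"
  by (simp_all add: l2_const_def h1_const_def occ_const_nonneg)

text \<open>The common last step of the bounds for the product and for its adjoint.\<close>

lemma synth_bounds:
  assumes P: "window P" and t: "fits P t" and u: "fits P u" and c: "fits P c"
    and s: "sumsq P c \<le> 2 ^ (2 * (2 * card occupied)) * (sumsq P t * sumsq P u)"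
    and k: "sumsq P (virt_grad occupied P grad c) \<le> 2 * 2 ^ (2 * (2 * card occupied)) *
      (sumsq P t * sumsq P (virt_grad occupied P grad u) + sumsq P (virt_grad occupied P grad t) * sumsq P u)"
  shows "norm (synth P c) \<le> l2_const * norm (synth P t) * norm (synth P u)"
    and "h1_norm (synth P c) \<le> h1_const * h1_norm (synth P t) * h1_norm (synth P u)"
proof -
  let ?B = "2 ^ (2 * (2 * card occupied)) :: real" and ?D = "2 + occ_const"
  let ?K = "\<lambda>c. sumsq P (virt_grad occupied P grad c)"
  have "l2_const\<^sup>2 = ?B" by (simp add: l2_const_def power_mult[symmetric] mult.commute)
  then have "(norm (synth P c))\<^sup>2 \<le> (l2_const * norm (synth P t) * norm (synth P u))\<^sup>2"
    using s unfolding power_mult_distrib by (simp only: norm_synth[OF P c] norm_synth[OF P t] norm_synth[OF P u] mult.assoc)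
  then show "norm (synth P c) \<le> l2_const * norm (synth P t) * norm (synth P u)"
    by (rule power2_le_imp_le) (simp add: l2_const_nonneg)
  have D: "0 \<le> ?D" using occ_const_nonneg by simp
  have E0: "0 \<le> energy P c" for c by (simp add: energy_def)
  have "energy P c \<le> ?B * (sumsq P t * sumsq P u) + 2 * ?B * (sumsq P t * ?K u + ?K t * sumsq P u)"
    using s k by (simp add: energy_def)
  also have "\<dots> \<le> 2 * ?B * (energy P t * energy P u)"
  proof -
    have "0 \<le> ?B * (sumsq P t * sumsq P u)" "0 \<le> ?B * (?K t * ?K u)" by simp_all
    then show ?thesis by (simp add: energy_def algebra_simps)
  qed
  also have "\<dots> \<le> 2 * ?B * ((?D * (h1_norm (synth P t))\<^sup>2) * (?D * (h1_norm (synth P u))\<^sup>2))"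
    by (intro mult_left_mono mult_mono h1_norm_synth(2)[OF P t] h1_norm_synth(2)[OF P u] E0 mult_nonneg_nonneg D) auto
  finally have "?D * energy P c \<le> ?D * (2 * ?B * ((?D * (h1_norm (synth P t))\<^sup>2) * (?D * (h1_norm (synth P u))\<^sup>2)))"
    using D by (rule mult_left_mono)
  then have "(h1_norm (synth P c))\<^sup>2 \<le> ?D * (2 * ?B * ((?D * (h1_norm (synth P t))\<^sup>2) * (?D * (h1_norm (synth P u))\<^sup>2)))"
    using h1_norm_synth(1)[OF P c] by linarith
  also have "\<dots> = (h1_const * h1_norm (synth P t) * h1_norm (synth P u))\<^sup>2"
    using D by (simp add: h1_const_def power_mult_distrib power3_eq_cube mult_ac)
  finally show "h1_norm (synth P c) \<le> h1_const * h1_norm (synth P t) * h1_norm (synth P u)"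
    by (rule power2_le_imp_le) (simp add: h1_const_nonneg h1_norm_nonneg)
qed

lemma fits_conv:
  assumes t: "fits P t" and u: "fits P u"
  shows "fits P (conv occupied t u)"
  unfolding fits_def
proof (intro conjI allI impI)
  show "on_codes (conv occupied t u)" using assms by (intro on_codes_conv) (auto simp: fits_def)
  fix z assume "conv occupied t u z \<noteq> 0"
  then obtain x where x: "x \<subseteq> z" "t x \<noteq> 0" "u (z - x) \<noteq> 0"
    unfolding conv_def by (auto elim!: sum.not_neutral_contains_not_neutral)
  then have "x \<subseteq> P" "z - x \<subseteq> P" using t u by (simp_all add: fits_def)
  then show "z \<subseteq> P" by blast
qed

lemma fits_adj_conv:
  assumes t: "fits P t" and u: "fits P u"
  shows "fits P (adj_conv occupied P t u)"
  unfolding fits_def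
proof (intro conjI allI impI)
  show "on_codes (adj_conv occupied P t u)" using assms by (intro on_codes_adj_conv) (auto simp: fits_def)
  fix z assume "adj_conv occupied P t u z \<noteq> 0"
  then obtain x where "u (z \<union> x) \<noteq> 0"
    unfolding adj_conv_def by (auto elim!: sum.not_neutral_contains_not_neutral)
  then show "z \<subseteq> P" using u by (auto simp: fits_def)
qed

lemma adj_conv_mono:
  assumes "finite P'" "P \<subseteq> P'" "fits P t"
  shows "adj_conv occupied P' t u z = adj_conv occupied P t u z"
  unfolding adj_conv_def using assms by (intro sum.mono_neutral_right) (auto simp: fits_def)

lemma fits_card: "fits P t \<Longrightarrow> card x > 2 * card occupied \<Longrightarrow> t x = 0"
  using on_codes_card card_occupied by (auto simp: fits_def)

lemma dets_conv:
  assumes t: "t \<in> dets" and u: "u \<in> dets"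
  shows "\<exists>w\<in>dets. coef w = conv occupied (coef t) (coef u) \<and>
    norm w \<le> l2_const * norm t * norm u \<and> h1_norm w \<le> h1_const * h1_norm t * h1_norm u"
proof -
  obtain P where P: "window P" and ft: "fits P (coef t)" and fu: "fits P (coef u)"
    and te: "t = synth P (coef t)" and ue: "u = synth P (coef u)"
    using dets_window2[OF t u] by blast
  have fP: "finite P" using P by (simp add: window_def)
  let ?c = "conv occupied (coef t) (coef u)"
  have fc: "fits P ?c" by (rule fits_conv[OF ft fu])
  note b = synth_bounds[OF P ft fu fc
      sumsq_conv_le[OF fP fits_card[OF ft] fits_card[OF fu]]
      sumsq_virt_grad_conv_le[OF fP fits_card[OF ft] fits_card[OF fu]]]
  show ?thesis
    using b coef_synth[OF P fc] synth_dets[of P ?c] te[symmetric] ue[symmetric]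
    by (intro bexI[of _ "synth P ?c"]) auto
qed

lemma dets_adj_conv:
  assumes t: "t \<in> dets" and u: "u \<in> dets"
  shows "\<exists>w\<in>dets. (\<forall>v\<in>dets. \<forall>y\<in>dets. coef y = conv occupied (coef t) (coef v) \<longrightarrow> inner y u = inner v w) \<and>
    h1_norm w \<le> h1_const * h1_norm t * h1_norm u"
proof -
  obtain P where P: "window P" and ft: "fits P (coef t)" and fu: "fits P (coef u)"
    and te: "t = synth P (coef t)" and ue: "u = synth P (coef u)"
    using dets_window2[OF t u] by blast
  have fP: "finite P" using P by (simp add: window_def)
  let ?M = "2 * card occupied"
  let ?c = "adj_conv occupied P (coef t) (coef u)"
  have fc: "fits P ?c" by (rule fits_adj_conv[OF ft fu])
  have B: "(2 :: real) ^ ?M \<le> 2 ^ (2 * ?M)" by (intro power_increasing) auto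
  have s: "sumsq P ?c \<le> 2 ^ (2 * ?M) * (sumsq P (coef t) * sumsq P (coef u))"
    using sumsq_adj_conv_le[OF fP fits_card[OF fu]] mult_right_mono[OF B, of "sumsq P (coef t) * sumsq P (coef u)"]
    by (meson order_trans mult_nonneg_nonneg sumsq_nonneg)
  let ?K = "\<lambda>c. sumsq P (virt_grad occupied P grad c)"
  have "?K ?c \<le> 2 ^ ?M * (sumsq P (coef t) * ?K (coef u))"
    by (rule sumsq_virt_grad_adj_conv_le[OF fP fits_card[OF fu]])
  also have "\<dots> \<le> (2 * 2 ^ (2 * ?M)) * (sumsq P (coef t) * ?K (coef u) + ?K (coef t) * sumsq P (coef u))"
  proof (rule mult_mono)
    have "(0 :: real) \<le> 2 ^ (2 * ?M)" by simp
    then show "(2 :: real) ^ ?M \<le> 2 * 2 ^ (2 * ?M)" using B by linarith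
  qed auto
  finally have k: "?K ?c \<le> 2 * 2 ^ (2 * ?M) * (sumsq P (coef t) * ?K (coef u) + ?K (coef t) * sumsq P (coef u))" .
  have adj: "inner y u = inner v (synth P ?c)"
    if v: "v \<in> dets" and y: "y \<in> dets" and cy: "coef y = conv occupied (coef t) (coef v)" for v y
  proof -
    obtain Q where Q: "window Q" "fits Q (coef v)" "v = synth Q (coef v)" using dets_window[OF v] by blast
    let ?R = "P \<union> Q"
    have R: "window ?R" and fR: "finite ?R" using P Q by (auto simp: window_def)
    have ftR: "fits ?R (coef t)" and fuR: "fits ?R (coef u)" and fvR: "fits ?R (coef v)" and fcR: "fits ?R ?c"
      using ft fu Q fc by (auto simp: fits_def)
    have uR: "u = synth ?R (coef u)" using synth_mono[OF R _ fu] ue by simp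
    have vR: "v = synth ?R (coef v)" using synth_mono[OF R _ Q(2)] Q(3) by simp
    have cR: "synth P ?c = synth ?R ?c" using synth_mono[OF R _ fc] by simp
    have yR: "y = synth ?R (coef y)"
    proof (rule V_eqI)
      have "fits ?R (coef y)" unfolding cy by (rule fits_conv[OF ftR fvR])
      then show "coef y x = coef (synth ?R (coef y)) x" for x by (simp add: coef_synth[OF R])
    qed (auto intro: dets_V y synth_dets)
    have "inner y u = (\<Sum>z\<in>Pow ?R. conv occupied (coef t) (coef v) z * coef u z)"
      using inner_synth[OF R fits_conv[OF ftR fvR] fuR] yR uR cy by simp
    also have "\<dots> = (\<Sum>z\<in>Pow ?R. coef v z * adj_conv occupied ?R (coef t) (coef u) z)"
      by (rule conv_adj_conv[OF fR])
    also have "\<dots> = (\<Sum>z\<in>Pow ?R. coef v z * ?c z)"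
      by (simp add: adj_conv_mono[OF fR _ ft])
    also have "\<dots> = inner v (synth P ?c)"
      using inner_synth[OF R fvR fcR] vR cR by simp
    finally show ?thesis .
  qed
  show ?thesis
    using synth_bounds(2)[OF P ft fu fc s k] adj te[symmetric] ue[symmetric] synth_dets
    by (intro bexI[of _ "synth P ?c"]) auto
qed

lemma h1_norm_diff_le: "u \<in> H1 \<Longrightarrow> v \<in> H1 \<Longrightarrow> h1_norm u \<le> h1_norm v + h1_norm (u - v)"
  using h1_norm_triangle[of v "u - v"] by (simp add: subspace_diff[OF subspace_H1])

lemma h1_norm_tendsto:
  assumes X: "\<And>n. X n \<in> H1" and v: "v \<in> H1" and lim: "(\<lambda>n. h1_norm (X n - v)) \<longlonglongrightarrow> 0"
  shows "(\<lambda>n. h1_norm (X n)) \<longlonglongrightarrow> h1_norm v"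
proof -
  have "\<bar>h1_norm (X n) - h1_norm v\<bar> \<le> h1_norm (X n - v)" for n
    using h1_norm_diff_le[OF X v, of n] h1_norm_diff_le[OF v X, of n] h1_norm_minus_commute[OF X v, of n]
    by linarith
  then have "(\<lambda>n. h1_norm (X n) - h1_norm v) \<longlonglongrightarrow> 0"
    by (intro Lim_null_comparison[OF _ lim]) auto
  then show ?thesis by (simp add: LIM_zero_iff)
qed

text \<open>The extension to \<open>V\<close> is stated along prescribed approximating sequences, so that an identity which holds
for the approximants can be passed to the limit.\<close>

lemma bilinear_extension:
  assumes B: "\<And>t u. t \<in> dets \<Longrightarrow> u \<in> dets \<Longrightarrow> B t u \<in> dets"
    and left: "\<And>t t' u. t \<in> dets \<Longrightarrow> t' \<in> dets \<Longrightarrow> u \<in> dets \<Longrightarrow> B (t - t') u = B t u - B t' u"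
    and right: "\<And>t u u'. t \<in> dets \<Longrightarrow> u \<in> dets \<Longrightarrow> u' \<in> dets \<Longrightarrow> B t (u - u') = B t u - B t u'"
    and bd: "\<And>t u. t \<in> dets \<Longrightarrow> u \<in> dets \<Longrightarrow> h1_norm (B t u) \<le> C * h1_norm t * h1_norm u"
    and C: "0 \<le> C"
    and T: "\<And>n. T n \<in> dets" "(\<lambda>n. h1_norm (T n - t)) \<longlonglongrightarrow> 0" "t \<in> V"
    and U: "\<And>n. U n \<in> dets" "(\<lambda>n. h1_norm (U n - u)) \<longlonglongrightarrow> 0" "u \<in> V"
  shows "\<exists>v\<in>V. h1_norm v \<le> C * h1_norm t * h1_norm u \<and> (\<lambda>n. h1_norm (B (T n) (U n) - v)) \<longlonglongrightarrow> 0"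
proof -
  note H = dets_H1 V_H1 subspace_diff[OF subspace_H1]
  have tT: "(\<lambda>n. h1_norm (T n)) \<longlonglongrightarrow> h1_norm t" and tU: "(\<lambda>n. h1_norm (U n)) \<longlonglongrightarrow> h1_norm u"
    by (intro h1_norm_tendsto H T U)+
  have "Bseq (\<lambda>n. h1_norm (T n))" "Bseq (\<lambda>n. h1_norm (U n))"
    using tT tU by (auto intro: convergent_imp_Bseq convergentI)
  then obtain r1 r2 where r12: "\<And>n. \<bar>h1_norm (T n)\<bar> \<le> r1" "\<And>n. \<bar>h1_norm (U n)\<bar> \<le> r2"
    unfolding Bseq_def by auto
  define r where "r = max r1 r2"
  have r: "h1_norm (T n) \<le> r" "h1_norm (U n) \<le> r" for n
    using r12(1)[of n] r12(2)[of n] by (auto simp: r_def)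
  have r0: "0 \<le> r" using r(1)[of 0] h1_norm_nonneg order_trans by blast
  define a where "a n = h1_norm (T n - t) + h1_norm (U n - u)" for n
  have a: "a \<longlonglongrightarrow> 0" unfolding a_def using tendsto_add[OF T(2) U(2)] by simp
  \<comment> \<open>The images form a Cauchy sequence: change one argument at a time.\<close>
  have key: "h1_norm (B (T m) (U m) - B (T n) (U n)) \<le> C * r * (a m + a n)" for m n
  proof -
    have dT: "T m - T n \<in> dets" and dU: "U m - U n \<in> dets" by (intro span_diff T U)+
    have "B (T m) (U m) - B (T n) (U n) = B (T m) (U m - U n) + B (T m - T n) (U n)"
      by (simp add: left right T U)
    also have "h1_norm \<dots> \<le> h1_norm (B (T m) (U m - U n)) + h1_norm (B (T m - T n) (U n))"
      by (intro h1_norm_triangle dets_H1 B T U dT dU)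
    also have "\<dots> \<le> C * h1_norm (T m) * h1_norm (U m - U n) + C * h1_norm (T m - T n) * h1_norm (U n)"
      by (intro add_mono bd T U dT dU)
    also have "\<dots> \<le> C * r * h1_norm (U m - U n) + C * h1_norm (T m - T n) * r"
      by (intro add_mono mult_mono mult_left_mono mult_nonneg_nonneg r C h1_norm_nonneg r0) auto
    also have "\<dots> = C * r * (h1_norm (U m - U n) + h1_norm (T m - T n))" by (simp add: algebra_simps)
    also have "\<dots> \<le> C * r * (a m + a n)"
    proof (intro mult_left_mono mult_nonneg_nonneg C r0)
      have "h1_norm (T m - T n) \<le> h1_norm (T m - t) + h1_norm (T n - t)"
        using h1_norm_diff_triangle[of "T m" t "T n"] h1_norm_minus_commute[of t "T n"] by (simp add: H T)
      moreover have "h1_norm (U m - U n) \<le> h1_norm (U m - u) + h1_norm (U n - u)"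
        using h1_norm_diff_triangle[of "U m" u "U n"] h1_norm_minus_commute[of u "U n"] by (simp add: H U)
      ultimately show "h1_norm (U m - U n) + h1_norm (T m - T n) \<le> a m + a n" by (simp add: a_def)
    qed
    finally show ?thesis .
  qed
  have "\<exists>M. \<forall>m\<ge>M. \<forall>n\<ge>M. h1_norm (B (T m) (U m) - B (T n) (U n)) < \<epsilon>" if \<epsilon>: "\<epsilon> > 0" for \<epsilon>
  proof -
    have "(\<lambda>n. C * r * a n) \<longlonglongrightarrow> C * r * 0" by (intro tendsto_intros a)
    then obtain M where M: "\<And>n. n \<ge> M \<Longrightarrow> \<bar>C * r * a n\<bar> < \<epsilon> / 2"
      using LIMSEQ_D[of _ 0 "\<epsilon> / 2"] \<epsilon> by fastforce
    show ?thesis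
    proof (intro exI[of _ M] allI impI)
      fix m n assume "M \<le> m" "M \<le> n"
      then have "C * r * a m < \<epsilon> / 2" "C * r * a n < \<epsilon> / 2"
        using M[of m] M[of n] abs_ge_self[of "C * r * a m"] abs_ge_self[of "C * r * a n"] by linarith+
      then have "C * r * (a m + a n) < \<epsilon>" by (simp add: distrib_left)
      then show "h1_norm (B (T m) (U m) - B (T n) (U n)) < \<epsilon>" using key[of m n] by linarith
    qed
  qed
  then obtain v where v: "v \<in> H1" and lim: "(\<lambda>n. h1_norm (B (T n) (U n) - v)) \<longlonglongrightarrow> 0"
    using H1_complete[of "\<lambda>n. B (T n) (U n)"] dets_H1[OF B[OF T(1) U(1)]] by blast
  have vV: "v \<in> V" by (rule V_closed[OF _ v lim]) (intro B T U)
  have "h1_norm v \<le> C * h1_norm t * h1_norm u"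
  proof (rule LIMSEQ_le)
    show "(\<lambda>n. h1_norm (B (T n) (U n))) \<longlonglongrightarrow> h1_norm v"
      by (intro h1_norm_tendsto dets_H1 B T U v lim)
    show "(\<lambda>n. C * h1_norm (T n) * h1_norm (U n)) \<longlonglongrightarrow> C * h1_norm t * h1_norm u"
      by (intro tendsto_intros tT tU)
    show "\<exists>N. \<forall>n\<ge>N. h1_norm (B (T n) (U n)) \<le> C * h1_norm (T n) * h1_norm (U n)"
      using bd T U by blast
  qed
  then show ?thesis using vV lim by blast
qed

end

section \<open>Multiplication on the space of determinants and its adjoint\<close>

lemma conv_linear_left:
  fixes u :: "nat set \<Rightarrow> real"
  shows "conv Oc (\<lambda>x. a x + b x) u z = conv Oc a u z + conv Oc b u z"
    "conv Oc (\<lambda>x. a x - b x) u z = conv Oc a u z - conv Oc b u z"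
    "conv Oc (\<lambda>x. c * a x) u z = c * conv Oc a u z"
  by (simp_all add: conv_def algebra_simps sum.distrib sum_subtractf sum_distrib_left)

lemma conv_linear_right:
  fixes u v :: "nat set \<Rightarrow> real"
  shows "conv Oc t (\<lambda>x. u x + v x) z = conv Oc t u z + conv Oc t v z"
    "conv Oc t (\<lambda>x. u x - v x) z = conv Oc t u z - conv Oc t v z"
    "conv Oc t (\<lambda>x. c * u x) z = c * conv Oc t u z"
  by (simp_all add: conv_def algebra_simps sum.distrib sum_subtractf sum_distrib_left)

lemma conv_infinite: "infinite z \<Longrightarrow> conv Oc t u z = 0"
  by (simp add: conv_def)

context slater_basis
begin

text \<open>The product of the algebra on \<open>V\<close>.  Its existence for all \<open>t\<close> and \<open>u\<close> in \<open>V\<close>, that is, membership of the product in H1,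
is the analytic core (\<open>mul_V\<close>).\<close>

definition mul :: "'n config l2 \<Rightarrow> 'n config l2 \<Rightarrow> 'n config l2" where
  "mul t u = (THE v. v \<in> V \<and> coef v = conv occupied (coef t) (coef u))"

lemma mul_unique: "v \<in> V \<Longrightarrow> coef v = conv occupied (coef t) (coef u) \<Longrightarrow> mul t u = v"
  unfolding mul_def by (rule the_equality) (auto intro: V_eqI)

lemma dets_mul:
  assumes "t \<in> dets" "u \<in> dets"
  shows "mul t u \<in> dets" "coef (mul t u) = conv occupied (coef t) (coef u)"
    "norm (mul t u) \<le> l2_const * norm t * norm u"
    "h1_norm (mul t u) \<le> h1_const * h1_norm t * h1_norm u"
proof -
  obtain w where w: "w \<in> dets" "coef w = conv occupied (coef t) (coef u)"
    "norm w \<le> l2_const * norm t * norm u" "h1_norm w \<le> h1_const * h1_norm t * h1_norm u"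
    using dets_conv[OF assms] by blast
  have "mul t u = w" by (rule mul_unique[OF dets_V[OF w(1)] w(2)])
  then show "mul t u \<in> dets" "coef (mul t u) = conv occupied (coef t) (coef u)"
    "norm (mul t u) \<le> l2_const * norm t * norm u"
    "h1_norm (mul t u) \<le> h1_const * h1_norm t * h1_norm u"
    using w by simp_all
qed

lemma coef_fun: "coef (u + v) = (\<lambda>x. coef u x + coef v x)" "coef (u - v) = (\<lambda>x. coef u x - coef v x)"
  "coef (c *\<^sub>R u) = (\<lambda>x. c * coef u x)"
  by (auto simp: coef_linear)

lemma dets_mul_diff_left:
  assumes "t \<in> dets" "t' \<in> dets" "u \<in> dets"
  shows "mul (t - t') u = mul t u - mul t' u"
  by (rule mul_unique)
    (use assms in \<open>auto simp: coef_fun dets_mul(2) conv_linear_left fun_eq_iff intro!: V_diff dets_V[OF dets_mul(1)]\<close>)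

lemma dets_mul_diff_right:
  assumes "t \<in> dets" "u \<in> dets" "u' \<in> dets"
  shows "mul t (u - u') = mul t u - mul t u'"
  by (rule mul_unique)
    (use assms in \<open>auto simp: coef_fun dets_mul(2) conv_linear_right fun_eq_iff intro!: V_diff dets_V[OF dets_mul(1)]\<close>)

lemma mul_approx:
  assumes T: "\<And>n. T n \<in> dets" "(\<lambda>n. h1_norm (T n - t)) \<longlonglongrightarrow> 0" "t \<in> V"
    and U: "\<And>n. U n \<in> dets" "(\<lambda>n. h1_norm (U n - u)) \<longlonglongrightarrow> 0" "u \<in> V"
  shows "mul t u \<in> V" "coef (mul t u) = conv occupied (coef t) (coef u)"
    "h1_norm (mul t u) \<le> h1_const * h1_norm t * h1_norm u"
    "(\<lambda>n. h1_norm (mul (T n) (U n) - mul t u)) \<longlonglongrightarrow> 0"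
proof -
  obtain v where v: "v \<in> V" "h1_norm v \<le> h1_const * h1_norm t * h1_norm u"
    and lim: "(\<lambda>n. h1_norm (mul (T n) (U n) - v)) \<longlonglongrightarrow> 0"
    using bilinear_extension[OF dets_mul(1) dets_mul_diff_left dets_mul_diff_right dets_mul(4) h1_const_nonneg T U]
    by blast
  have "coef v = conv occupied (coef t) (coef u)"
  proof
    fix z
    have "(\<lambda>n. coef (mul (T n) (U n)) z) \<longlonglongrightarrow> coef v z"
      by (intro coef_tendsto h1_tendsto_l2 lim)
    then have "(\<lambda>n. conv occupied (coef (T n)) (coef (U n)) z) \<longlonglongrightarrow> coef v z"
      by (simp add: dets_mul(2) T U)
    moreover have "(\<lambda>n. conv occupied (coef (T n)) (coef (U n)) z) \<longlonglongrightarrow> conv occupied (coef t) (coef u) z"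
      unfolding conv_def by (intro tendsto_intros coef_tendsto h1_tendsto_l2 T U)
    ultimately show "coef v z = conv occupied (coef t) (coef u) z" by (rule LIMSEQ_unique)
  qed
  moreover from this have "mul t u = v" by (rule mul_unique[OF v(1)])
  ultimately show "mul t u \<in> V" "coef (mul t u) = conv occupied (coef t) (coef u)"
    "h1_norm (mul t u) \<le> h1_const * h1_norm t * h1_norm u"
    "(\<lambda>n. h1_norm (mul (T n) (U n) - mul t u)) \<longlonglongrightarrow> 0"
    using v lim by simp_all
qed

lemma mul_props:
  assumes t: "t \<in> V" and u: "u \<in> V"
  shows mul_V: "mul t u \<in> V" and coef_mul: "coef (mul t u) = conv occupied (coef t) (coef u)"
    and h1_norm_mul: "h1_norm (mul t u) \<le> h1_const * h1_norm t * h1_norm u"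
    and norm_mul: "norm (mul t u) \<le> l2_const * norm t * norm u"
proof -
  obtain T where T: "\<And>n. T n \<in> dets" "(\<lambda>n. h1_norm (T n - t)) \<longlonglongrightarrow> 0" using V_approx[OF t] by blast
  obtain U where U: "\<And>n. U n \<in> dets" "(\<lambda>n. h1_norm (U n - u)) \<longlonglongrightarrow> 0" using V_approx[OF u] by blast
  note m = mul_approx[OF T t U u]
  show "mul t u \<in> V" "coef (mul t u) = conv occupied (coef t) (coef u)"
    "h1_norm (mul t u) \<le> h1_const * h1_norm t * h1_norm u" by (fact m)+
  show "norm (mul t u) \<le> l2_const * norm t * norm u"
  proof (rule LIMSEQ_le)
    show "(\<lambda>n. norm (mul (T n) (U n))) \<longlonglongrightarrow> norm (mul t u)"
      by (intro tendsto_norm h1_tendsto_l2 m)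
    show "(\<lambda>n. l2_const * norm (T n) * norm (U n)) \<longlonglongrightarrow> l2_const * norm t * norm u"
      by (intro tendsto_intros h1_tendsto_l2 T U)
    show "\<exists>N. \<forall>n\<ge>N. norm (mul (T n) (U n)) \<le> l2_const * norm (T n) * norm (U n)"
      using dets_mul(3)[OF T(1) U(1)] by blast
  qed
qed

lemma mul_linear:
  assumes "t \<in> V" "t' \<in> V" "u \<in> V" "u' \<in> V"
  shows "mul (t + t') u = mul t u + mul t' u" "mul (t - t') u = mul t u - mul t' u"
    "mul (c *\<^sub>R t) u = c *\<^sub>R mul t u"
    "mul t (u + u') = mul t u + mul t u'" "mul t (u - u') = mul t u - mul t u'"
    "mul t (c *\<^sub>R u) = c *\<^sub>R mul t u"
  by (rule mul_unique; use assms in \<open>auto simp: coef_fun coef_mul conv_linear_left conv_linear_right fun_eq_iff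
    intro!: V_diff V_add V_scale mul_V\<close>)+

lemma mul_zero: "u \<in> V \<Longrightarrow> mul 0 u = 0" "u \<in> V \<Longrightarrow> mul u 0 = 0"
  using mul_linear(3)[OF V_0 V_0 _ V_0, of u 0] mul_linear(6)[OF _ V_0 V_0 V_0, of u 0] by simp_all

lemma mul_assoc:
  assumes "t \<in> V" "s \<in> V" "u \<in> V"
  shows "mul t (mul s u) = mul (mul t s) u"
proof (rule mul_unique)
  show "mul (mul t s) u \<in> V" by (intro mul_V assms)
  show "coef (mul (mul t s) u) = conv occupied (coef t) (coef (mul s u))"
  proof
    fix z
    show "coef (mul (mul t s) u) z = conv occupied (coef t) (coef (mul s u)) z"
      using assms
      by (cases "finite z") (auto simp: coef_mul mul_V conv_assoc conv_infinite)
  qed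
qed

lemma mul_unit:
  assumes "u \<in> V" shows "mul (e {}) u = u" "mul u (e {}) = u"
proof -
  have c: "coef (e {}) = (\<lambda>x. if x = {} then 1 else 0)"
    using empty_code by (auto simp: coef_e)
  have i: "coef u z = 0" if "infinite z" for z
    using that code_finite coef_outside by blast
  show "mul (e {}) u = u"
  proof (rule mul_unique[OF assms], rule ext)
    fix z
    show "coef u z = conv occupied (coef (e {})) (coef u) z"
    proof (cases "finite z")
      case True
      have "conv occupied (coef (e {})) (coef u) z = (\<Sum>x\<in>Pow z. if {} = x then coef u z else 0)"
        unfolding conv_def c by (intro sum.cong) auto
      then show ?thesis using True by simp
    qed (simp add: i conv_infinite)
  qed
  show "mul u (e {}) = u"
  proof (rule mul_unique[OF assms], rule ext)
    fix z
    show "coef u z = conv occupied (coef u) (coef (e {})) z"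
    proof (cases "finite z")
      case True
      have "conv occupied (coef u) (coef (e {})) z = (\<Sum>x\<in>Pow z. if z = x then coef u z else 0)"
        unfolding conv_def c by (intro sum.cong) auto
      then show ?thesis using True by simp
    qed (simp add: i conv_infinite)
  qed
qed

text \<open>The adjoint for the L2 inner product, but within \<open>V\<close>: that it maps into H1 is a statement of its own (\<open>adj_V\<close>), which holds because
the transposed convolution is bounded for the H1 norm as well.\<close>

definition adj :: "'n config l2 \<Rightarrow> 'n config l2 \<Rightarrow> 'n config l2" where
  "adj t u = (THE v. v \<in> V \<and> (\<forall>w\<in>V. inner (mul t w) u = inner w v))"

lemma adj_unique:
  assumes "v \<in> V" "\<And>w. w \<in> V \<Longrightarrow> inner (mul t w) u = inner w v"
  shows "adj t u = v"
  unfolding adj_def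
proof (rule the_equality)
  fix v' assume v': "v' \<in> V \<and> (\<forall>w\<in>V. inner (mul t w) u = inner w v')"
  have "v' - v = 0"
    by (rule V_ortho_zero) (use v' assms in \<open>auto intro: V_diff simp: inner_diff_right\<close>)
  then show "v' = v" by simp
qed (use assms in auto)

lemma inner_mul_extend:
  assumes t: "t \<in> V" and u: "u \<in> V" and v: "v \<in> V"
    and d: "\<And>w. w \<in> dets \<Longrightarrow> inner (mul t w) u = inner w v" and w: "w \<in> V"
  shows "inner (mul t w) u = inner w v"
proof -
  obtain X where X: "\<And>n. X n \<in> dets" "(\<lambda>n. h1_norm (X n - w)) \<longlonglongrightarrow> 0" using V_approx[OF w] by blast
  have Xw: "X \<longlonglongrightarrow> w" by (rule h1_tendsto_l2[OF X(2)])
  have "(\<lambda>n. mul t (X n)) \<longlonglongrightarrow> mul t w"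
  proof (rule LIM_zero_cancel, rule tendsto_norm_zero_cancel, rule null_by_bound)
    show "\<bar>norm (mul t (X n) - mul t w)\<bar> \<le> l2_const * norm t * norm (X n - w)" for n
      using norm_mul[OF t V_diff[OF dets_V[OF X(1)] w], of n]
      by (simp add: mul_linear(5)[OF t t dets_V[OF X(1)] w])
    have "(\<lambda>n. norm (X n - w)) \<longlonglongrightarrow> 0" using Xw by (simp add: LIM_zero tendsto_norm_zero)
    then show "(\<lambda>n. l2_const * norm t * norm (X n - w)) \<longlonglongrightarrow> 0"
      by (rule tendsto_mult_right_zero)
  qed
  then have "(\<lambda>n. inner (mul t (X n)) u) \<longlonglongrightarrow> inner (mul t w) u" by (intro tendsto_intros)
  moreover have "(\<lambda>n. inner (X n) v) \<longlonglongrightarrow> inner w v" by (intro tendsto_intros Xw)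
  ultimately show ?thesis using d[OF X(1)] by (simp add: LIMSEQ_unique)
qed

lemma dets_adj:
  assumes t: "t \<in> dets" and u: "u \<in> dets"
  shows "adj t u \<in> dets" "h1_norm (adj t u) \<le> h1_const * h1_norm t * h1_norm u"
    "\<And>w. w \<in> V \<Longrightarrow> inner (mul t w) u = inner w (adj t u)"
proof -
  obtain v where v: "v \<in> dets" "h1_norm v \<le> h1_const * h1_norm t * h1_norm u"
    and a: "\<And>w y. w \<in> dets \<Longrightarrow> y \<in> dets \<Longrightarrow> coef y = conv occupied (coef t) (coef w) \<Longrightarrow> inner y u = inner w v"
    using dets_adj_conv[OF t u] by blast
  have d: "inner (mul t w) u = inner w v" if "w \<in> dets" for w
    by (rule a[OF that]) (use dets_mul[OF t that] in auto)
  have i: "inner (mul t w) u = inner w v" if "w \<in> V" for w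
    by (rule inner_mul_extend[OF dets_V[OF t] dets_V[OF u] dets_V[OF v(1)] d that])
  have "adj t u = v" by (rule adj_unique[OF dets_V[OF v(1)] i])
  then show "adj t u \<in> dets" "h1_norm (adj t u) \<le> h1_const * h1_norm t * h1_norm u"
    "\<And>w. w \<in> V \<Longrightarrow> inner (mul t w) u = inner w (adj t u)"
    using v i by simp_all
qed

lemma dets_adj_diff_left:
  assumes t: "t \<in> dets" "t' \<in> dets" and u: "u \<in> dets"
  shows "adj (t - t') u = adj t u - adj t' u"
proof (rule adj_unique)
  show "adj t u - adj t' u \<in> V" by (intro V_diff dets_V dets_adj(1) t u)
  show "inner (mul (t - t') w) u = inner w (adj t u - adj t' u)" if "w \<in> V" for w
    using dets_adj(3)[OF t(1) u that] dets_adj(3)[OF t(2) u that]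
    by (simp add: mul_linear(2)[OF dets_V[OF t(1)] dets_V[OF t(2)] that that] inner_diff_left inner_diff_right)
qed

lemma dets_adj_diff_right:
  assumes t: "t \<in> dets" and u: "u \<in> dets" "u' \<in> dets"
  shows "adj t (u - u') = adj t u - adj t u'"
proof (rule adj_unique)
  show "adj t u - adj t u' \<in> V" by (intro V_diff dets_V dets_adj(1) t u)
  show "inner (mul t w) (u - u') = inner w (adj t u - adj t u')" if "w \<in> V" for w
    using dets_adj(3)[OF t u(1) that] dets_adj(3)[OF t u(2) that]
    by (simp add: inner_diff_right)
qed

lemma adj_props:
  assumes t: "t \<in> V" and u: "u \<in> V"
  shows adj_V: "adj t u \<in> V" and inner_adj: "\<And>w. w \<in> V \<Longrightarrow> inner (mul t w) u = inner w (adj t u)"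
proof -
  obtain T where T: "\<And>n. T n \<in> dets" "(\<lambda>n. h1_norm (T n - t)) \<longlonglongrightarrow> 0" using V_approx[OF t] by blast
  obtain U where U: "\<And>n. U n \<in> dets" "(\<lambda>n. h1_norm (U n - u)) \<longlonglongrightarrow> 0" using V_approx[OF u] by blast
  obtain v where v: "v \<in> V" and lim: "(\<lambda>n. h1_norm (adj (T n) (U n) - v)) \<longlonglongrightarrow> 0"
    using bilinear_extension[OF dets_adj(1) dets_adj_diff_left dets_adj_diff_right dets_adj(2) h1_const_nonneg T t U u]
    by blast
  have d: "inner (mul t w) u = inner w v" if w: "w \<in> dets" for w
  proof -
    have "(\<lambda>n. mul (T n) w) \<longlonglongrightarrow> mul t w"
    proof (rule h1_tendsto_l2)
      show "(\<lambda>n. h1_norm (mul (T n) w - mul t w)) \<longlonglongrightarrow> 0"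
        by (rule mul_approx(4)[OF T t w _ dets_V[OF w]]) simp
    qed
    then have "(\<lambda>n. inner (mul (T n) w) (U n)) \<longlonglongrightarrow> inner (mul t w) u"
      by (rule tendsto_inner[OF _ h1_tendsto_l2[OF U(2)]])
    moreover have "(\<lambda>n. inner w (adj (T n) (U n))) \<longlonglongrightarrow> inner w v"
      by (intro tendsto_intros h1_tendsto_l2 lim)
    ultimately show ?thesis
      using dets_adj(3)[OF T(1) U(1) dets_V[OF w]] by (simp add: LIMSEQ_unique)
  qed
  have i: "inner (mul t w) u = inner w v" if "w \<in> V" for w
    by (rule inner_mul_extend[OF t u v d that])
  have "adj t u = v" by (rule adj_unique[OF v i])
  then show "adj t u \<in> V" "\<And>w. w \<in> V \<Longrightarrow> inner (mul t w) u = inner w (adj t u)"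
    using v i by simp_all
qed

lemma adj_linear_right:
  assumes "t \<in> V" "u \<in> V" "u' \<in> V"
  shows "adj t (u + u') = adj t u + adj t u'" "adj t (c *\<^sub>R u) = c *\<^sub>R adj t u"
proof -
  show "adj t (u + u') = adj t u + adj t u'"
    by (rule adj_unique) (use assms in \<open>auto simp: inner_add_right inner_adj intro!: V_add adj_V\<close>)
  show "adj t (c *\<^sub>R u) = c *\<^sub>R adj t u"
    by (rule adj_unique) (use assms in \<open>auto simp: inner_adj intro!: V_scale adj_V\<close>)
qed

end

section \<open>Excitation operators and cluster operators\<close>

lemma summable_on_orthonormal:
  fixes b :: "'i \<Rightarrow> 'v::{real_inner, banach}"
  assumes on: "\<And>x y. x \<in> A \<Longrightarrow> y \<in> A \<Longrightarrow> inner (b x) (b y) = (if x = y then 1 else 0)"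
    and t: "(\<lambda>x. (t x)\<^sup>2) summable_on A"
  shows "(\<lambda>x. t x *\<^sub>R b x) summable_on A"
proof -
  let ?f = "\<lambda>x. t x *\<^sub>R b x" and ?g = "\<lambda>x. (t x)\<^sup>2 :: real"
  have nrm: "(norm (sum ?f F))\<^sup>2 = sum ?g F" if F: "finite F" "F \<subseteq> A" for F
  proof -
    have "(norm (sum ?f F))\<^sup>2 = (\<Sum>x\<in>F. \<Sum>y\<in>F. t x * (t y * inner (b x) (b y)))"
      unfolding power2_norm_eq_inner by (simp only: inner_sum_left) (simp add: inner_sum_right sum_distrib_left mult_ac)
    also have "\<dots> = (\<Sum>x\<in>F. \<Sum>y\<in>F. if x = y then (t x)\<^sup>2 else 0)"
    proof (intro sum.cong refl)
      fix x y assume "x \<in> F" "y \<in> F"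
      then have "inner (b x) (b y) = (if x = y then 1 else 0)" using F by (intro on) auto
      then show "t x * (t y * inner (b x) (b y)) = (if x = y then (t x)\<^sup>2 else 0)"
        by (simp add: power2_eq_square)
    qed
    also have "\<dots> = sum ?g F" using F by simp
    finally show ?thesis .
  qed
  obtain S where S: "(?g has_sum S) A" using t summable_on_def by blast
  have "\<exists>P. eventually P (finite_subsets_at_top A) \<and> (\<forall>F F'. P F \<and> P F' \<longrightarrow> dist (sum ?f F) (sum ?f F') < \<epsilon>)"
    if \<epsilon>: "\<epsilon> > 0" for \<epsilon>
  proof -
    define d where "d = (\<epsilon> / 4)\<^sup>2"
    have d: "d > 0" using \<epsilon> by (simp add: d_def)
    have "\<forall>\<^sub>F F in finite_subsets_at_top A. dist (sum ?g F) S < d"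
      using S d unfolding has_sum_def by (rule tendstoD)
    then obtain F0 where "finite F0 \<and> F0 \<subseteq> A \<and>
        (\<forall>F. finite F \<and> F0 \<subseteq> F \<and> F \<subseteq> A \<longrightarrow> dist (sum ?g F) S < d)"
      unfolding eventually_finite_subsets_at_top by (elim exE)
    then have F0: "finite F0" "F0 \<subseteq> A"
      and near: "\<And>F. finite F \<Longrightarrow> F0 \<subseteq> F \<Longrightarrow> F \<subseteq> A \<Longrightarrow> dist (sum ?g F) S < d"
      by simp_all
    define P where "P F \<longleftrightarrow> finite F \<and> F0 \<subseteq> F \<and> F \<subseteq> A" for F
    have "eventually P (finite_subsets_at_top A)"
      unfolding eventually_finite_subsets_at_top P_def using F0 by blast
    moreover have close: "norm (sum ?f F - sum ?f F0) < \<epsilon> / 2" if "P F" for F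
    proof -
      have F: "finite F" "F0 \<subseteq> F" "F \<subseteq> A" using that by (auto simp: P_def)
      have "(norm (sum ?f F - sum ?f F0))\<^sup>2 = sum ?g (F - F0)"
        using nrm[of "F - F0"] F by (simp add: sum_diff F0) (auto simp: sum_diff)
      also have "\<dots> = sum ?g F - sum ?g F0" using F by (simp add: sum_diff)
      also have "\<dots> < 2 * d"
        using near[OF F] near[OF F0(1) subset_refl F0(2)] unfolding dist_real_def by linarith
      also have "\<dots> \<le> (\<epsilon> / 2)\<^sup>2" by (simp add: d_def power2_eq_square)
      finally show ?thesis using \<epsilon> by (intro power2_less_imp_less[of _ "\<epsilon> / 2"]) auto
    qed
    moreover have "dist (sum ?f F) (sum ?f F') < \<epsilon>" if "P F" "P F'" for F F'
    proof -
      have "dist (sum ?f F) (sum ?f F') \<le> norm (sum ?f F - sum ?f F0) + norm (sum ?f F' - sum ?f F0)"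
        using dist_triangle2[of "sum ?f F" "sum ?f F'" "sum ?f F0"] by (simp add: dist_norm)
      then show ?thesis using close[OF that(1)] close[OF that(2)] by linarith
    qed
    ultimately show ?thesis by blast
  qed
  then have "cauchy_filter (filtermap (sum ?f) (finite_subsets_at_top A))"
    by (simp add: cauchy_filter_metric_filtermap)
  moreover have "complete (UNIV :: 'v set)"
    by (meson Cauchy_convergent UNIV_I complete_def convergent_def)
  ultimately obtain L where "(sum ?f \<longlongrightarrow> L) (finite_subsets_at_top A)"
    using complete_uniform[where S = UNIV] by (force simp: filterlim_def)
  then show ?thesis using summable_on_def has_sum_def by blast
qed

context slater_basis
begin

lemma mul_e_e:
  assumes a: "a \<in> codes" and b: "b \<in> codes"
  shows "mul (e a) (e b) = (if a \<inter> b = {} then cross occupied b a *\<^sub>R e (a \<union> b) else 0)"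
proof (rule mul_unique)
  show "(if a \<inter> b = {} then cross occupied b a *\<^sub>R e (a \<union> b) else 0) \<in> V"
    using Un_codes[OF a b] by (auto intro: V_scale e_V V_0)
  show "coef (if a \<inter> b = {} then cross occupied b a *\<^sub>R e (a \<union> b) else 0)
      = conv occupied (coef (e a)) (coef (e b))"
  proof
    fix z
    have s: "conv occupied (coef (e a)) (coef (e b)) z
        = (\<Sum>x\<in>Pow z. if x = a then (if z - a = b then cross occupied b a else 0) else 0)"
      unfolding conv_def by (intro sum.cong refl) (auto simp: coef_e a b)
    show "coef (if a \<inter> b = {} then cross occupied b a *\<^sub>R e (a \<union> b) else 0) z
        = conv occupied (coef (e a)) (coef (e b)) z"
    proof (cases "a \<inter> b = {} \<and> z = a \<union> b")
      case True
      then have "z - a = b" "a \<subseteq> z" "finite z" using a b by (auto simp: code_finite)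
      then show ?thesis using True Un_codes[OF a b] unfolding s by (simp add: coef_linear coef_e)
    next
      case False
      have "\<not> (a \<subseteq> z \<and> z - a = b)" using False by blast
      then have "conv occupied (coef (e a)) (coef (e b)) z = 0"
        unfolding s by (intro sum.neutral) auto
      then show ?thesis using False Un_codes[OF a b] by (auto simp: coef_linear coef_e)
    qed
  qed
qed

lemma toggle_inject: "toggle \<alpha> = toggle \<beta> \<longleftrightarrow> \<alpha> = \<beta>"
  by (metis toggle_toggle)

lemma toggle_compatible:
  "toggle \<alpha> \<inter> toggle \<beta> = {} \<longleftrightarrow> occ CARD('n) \<alpha> \<union> occ CARD('n) \<beta> = ref_state CARD('n) \<and>
    virt CARD('n) \<alpha> \<inter> virt CARD('n) \<beta> = {}"
  unfolding toggle_def occ_def virt_def occupied_def[symmetric] by blast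

lemma toggle_join:
  "toggle \<alpha> \<inter> toggle \<beta> = {} \<Longrightarrow> toggle \<alpha> \<union> toggle \<beta> = toggle (state_join CARD('n) \<alpha> \<beta>)"
  unfolding toggle_def state_join_def occ_def virt_def occupied_def[symmetric] by blast

lemma cross_excitation_sign:
  assumes "\<alpha> \<in> states CARD('n) K" "\<beta> \<in> states CARD('n) K" "toggle \<alpha> \<inter> toggle \<beta> = {}"
  shows "cross occupied (toggle \<beta>) (toggle \<alpha>) = of_int (excitation_sign CARD('n) \<alpha> \<beta>)"
proof -
  have "virt CARD('n) \<beta> \<inter> virt CARD('n) \<alpha> = {}" using assms(3) toggle_compatible[of \<alpha> \<beta>] by blast
  then have "of_int (excitation_sign CARD('n) \<alpha> \<beta>) = (\<Prod>a\<in>virt CARD('n) \<beta>. \<Prod>b\<in>virt CARD('n) \<alpha>. ord_sign a b)"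
    unfolding excitation_sign_def using assms by (intro sort_sign_append) (auto simp: virt_def states_def)
  then show ?thesis by (simp add: cross_def toggle_diff virt_def occupied_def[symmetric])
qed

lemma slater_e: "slater \<phi> \<alpha> = e (toggle \<alpha>)"
  by (simp add: e_def)

text \<open>Boundedness is what makes the characterisation of excitation operators by their values at determinants unique when
there are infinitely many determinants.\<close>

lemma linear_on_dets_unique:
  assumes X: "bounded_operator_on V X" and Y: "bounded_operator_on V Y"
    and eq: "\<And>x. x \<in> codes \<Longrightarrow> X (e x) = Y (e x)" and u: "u \<in> V"
  shows "X u = Y u"
proof -
  have lin: "X (a *\<^sub>R v + b *\<^sub>R w) = a *\<^sub>R X v + b *\<^sub>R X w" "Y (a *\<^sub>R v + b *\<^sub>R w) = a *\<^sub>R Y v + b *\<^sub>R Y w"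
    if "v \<in> V" "w \<in> V" for a b v w
    using X Y that by (auto simp: bounded_operator_on_def linear_on_subspace_def)
  have VV: "X v \<in> V" "Y v \<in> V" if "v \<in> V" for v
    using X Y that by (auto simp: bounded_operator_on_def)
  have dets: "X w = Y w" if "w \<in> dets" for w
  proof -
    have "w \<in> V \<and> X w = Y w" using that
    proof (induction rule: span_induct_alt)
      case base
      show ?case using lin[OF V_0 V_0, of 0 0] V_0 by simp
    next
      case (step c v w)
      then obtain x where x: "v = e x" "x \<in> codes" by blast
      have v: "v \<in> V" using x e_V by simp
      have "c *\<^sub>R v + w = c *\<^sub>R v + 1 *\<^sub>R w" by simp
      then show ?case using lin[of v w c 1] step v x eq by (auto intro: V_add V_scale)
    qed
    then show ?thesis by simp
  qed
  obtain C1 C2 where C: "\<And>v. v \<in> V \<Longrightarrow> h1_norm (X v) \<le> C1 * h1_norm v" "\<And>v. v \<in> V \<Longrightarrow> h1_norm (Y v) \<le> C2 * h1_norm v"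
    using X Y unfolding bounded_operator_on_def by blast
  obtain w where w: "\<And>n. w n \<in> dets" "(\<lambda>n. h1_norm (w n - u)) \<longlonglongrightarrow> 0" using V_approx[OF u] by blast
  have bd: "norm (X u - Y u) \<le> (C1 + C2) * h1_norm (w n - u)" for n
  proof -
    have wV: "w n \<in> V" using dets_V[OF w(1)] .
    have "X (w n - u) = X (w n) - X u" "Y (w n - u) = Y (w n) - Y u"
      using lin[OF wV u, of 1 "-1"] by simp_all
    then have "X u - Y u = Y (w n - u) - X (w n - u)" using dets[OF w(1)[of n]] by simp
    then have "norm (X u - Y u) \<le> norm (Y (w n - u)) + norm (X (w n - u))"
      by (simp add: norm_triangle_ineq4)
    also have "\<dots> \<le> h1_norm (Y (w n - u)) + h1_norm (X (w n - u))"
      by (intro add_mono norm_le_h1_norm)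
    also have "\<dots> \<le> C2 * h1_norm (w n - u) + C1 * h1_norm (w n - u)"
      by (intro add_mono C V_diff wV u)
    finally show ?thesis by (simp add: algebra_simps)
  qed
  have "(\<lambda>n. (C1 + C2) * h1_norm (w n - u)) \<longlonglongrightarrow> 0"
    by (rule tendsto_mult_right_zero[OF w(2)])
  from null_by_bound[of "\<lambda>_. norm (X u - Y u)", OF _ this] bd
  have "(\<lambda>n::nat. norm (X u - Y u)) \<longlonglongrightarrow> 0" by (simp only: abs_norm_cancel)
  then show ?thesis by (simp add: LIMSEQ_const_iff)
qed

lemma bounded_mul: "t \<in> V \<Longrightarrow> bounded_operator_on V (\<lambda>u. if u \<in> V then mul t u else 0)"
  unfolding bounded_operator_on_def linear_on_subspace_def
proof (intro conjI ballI allI)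
  assume t: "t \<in> V"
  show "(\<lambda>u. if u \<in> V then mul t u else 0) \<in> V \<rightarrow> V" using mul_V[OF t] by auto
  show "(if a *\<^sub>R u + b *\<^sub>R v \<in> V then mul t (a *\<^sub>R u + b *\<^sub>R v) else 0) =
      a *\<^sub>R (if u \<in> V then mul t u else 0) + b *\<^sub>R (if v \<in> V then mul t v else 0)"
    if u: "u \<in> V" and v: "v \<in> V" for u v a b
  proof -
    note s = V_scale[OF u, of a] V_scale[OF v, of b]
    have "mul t (a *\<^sub>R u + b *\<^sub>R v) = a *\<^sub>R mul t u + b *\<^sub>R mul t v"
      using mul_linear(4)[OF t t s] mul_linear(6)[OF t t u u, of a] mul_linear(6)[OF t t v v, of b] by simp
    then show ?thesis using u v V_add[OF s] by simp
  qed
  show "\<exists>C. \<forall>u\<in>V. h1_norm (if u \<in> V then mul t u else 0) \<le> C * h1_norm u"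
    using h1_norm_mul[OF t] by auto
qed

text \<open>Compatibility of two states in the definition of \<open>excitation\<close> says that their codes are disjoint, and the sign
is the one of the convolution.\<close>

theorem excitation_eq_mul:
  assumes \<alpha>: "\<alpha> \<in> states CARD('n) K"
  shows "excitation K \<phi> \<alpha> = (\<lambda>u. if u \<in> V then mul (slater \<phi> \<alpha>) u else 0)"
proof -
  have a: "toggle \<alpha> \<in> codes" using \<alpha> by (simp add: toggle_states)
  let ?M = "\<lambda>u. if u \<in> V then mul (slater \<phi> \<alpha>) u else 0"
  let ?r = "\<lambda>\<beta>. if occ CARD('n) \<alpha> \<union> occ CARD('n) \<beta> = ref_state CARD('n) \<and>
           virt CARD('n) \<alpha> \<inter> virt CARD('n) \<beta> = {}
        then of_int (excitation_sign CARD('n) \<alpha> \<beta>) *\<^sub>R slater \<phi> (state_join CARD('n) \<alpha> \<beta>)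
        else (0 :: 'n config l2)"
  have B: "bounded_operator_on V ?M" unfolding slater_e by (intro bounded_mul e_V a)
  have on_slater: "?M (slater \<phi> \<beta>) = ?r \<beta>" if \<beta>: "\<beta> \<in> states CARD('n) K" for \<beta>
  proof -
    have b: "toggle \<beta> \<in> codes" using \<beta> by (simp add: toggle_states)
    have "?M (slater \<phi> \<beta>) = mul (e (toggle \<alpha>)) (e (toggle \<beta>))"
      unfolding slater_e using e_V[OF b] by simp
    also have "\<dots> = ?r \<beta>"
      unfolding mul_e_e[OF a b] toggle_compatible[symmetric] slater_e
      using cross_excitation_sign[OF \<alpha> \<beta>] toggle_join[of \<alpha> \<beta>] by simp
    finally show ?thesis .
  qed
  show ?thesis
    unfolding excitation_def V_def[symmetric]
  proof (rule the_equality)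
    show "bounded_operator_on V ?M \<and> (\<forall>u. u \<notin> V \<longrightarrow> ?M u = 0) \<and>
        (\<forall>\<beta>\<in>states CARD('n) K. ?M (slater \<phi> \<beta>) = ?r \<beta>)"
      using B on_slater by (intro conjI ballI allI impI) (simp_all only: if_False)
    fix X assume X: "bounded_operator_on V X \<and> (\<forall>u. u \<notin> V \<longrightarrow> X u = 0) \<and>
        (\<forall>\<beta>\<in>states CARD('n) K. X (slater \<phi> \<beta>) = ?r \<beta>)"
    show "X = ?M"
    proof
      fix u
      show "X u = ?M u"
      proof (cases "u \<in> V")
        case True
        show ?thesis
        proof (rule linear_on_dets_unique[OF _ B _ True])
          show "bounded_operator_on V X" using X by blast
          fix x assume "x \<in> codes"
          then have s: "toggle x \<in> states CARD('n) K" using toggle_codes by blast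
          have "X (slater \<phi> (toggle x)) = ?M (slater \<phi> (toggle x))"
            using X s on_slater[OF s] by metis
          then show "X (e x) = ?M (e x)" by (simp add: e_def)
        qed
      next
        case False
        then show ?thesis using X by simp
      qed
    qed
  qed
qed

lemma excited_state: "\<alpha> \<in> excited_states CARD('n) K \<longleftrightarrow> toggle \<alpha> \<in> codes \<and> toggle \<alpha> \<noteq> {}"
proof -
  have "toggle \<alpha> = {} \<longleftrightarrow> \<alpha> = occupied" by (auto simp: toggle_def)
  then show ?thesis by (simp add: excited_states_def toggle_states occupied_def[symmetric])
qed

lemma reference_e: "slater \<phi> (ref_state CARD('n)) = e {}"
proof -
  have "toggle occupied = {}" by (auto simp: toggle_def)
  then show ?thesis by (simp add: slater_e occupied_def[symmetric])
qed

text \<open>The vectors of \<open>V\<close> orthogonal to the reference determinant, whose code is \<open>{}\<close>.\<close>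

definition excited_space :: "'n config l2 set" where
  "excited_space = {v \<in> V. coef v {} = 0}"

text \<open>The vector \<open>T \<Phi>\<^sub>0\<close> of the amplitude \<open>t\<close>.\<close>

definition state_of :: "(nat set \<Rightarrow> real) \<Rightarrow> 'n config l2" where
  "state_of t = (\<Sum>\<^sub>\<infinity>\<alpha>\<in>excited_states CARD('n) K. t \<alpha> *\<^sub>R slater \<phi> \<alpha>)"

lemma square_summable_has_sum:
  assumes "(\<lambda>\<alpha>. (t \<alpha>)\<^sup>2) summable_on excited_states CARD('n) K"
  shows "((\<lambda>\<alpha>. t \<alpha> *\<^sub>R slater \<phi> \<alpha>) has_sum state_of t) (excited_states CARD('n) K)"
  unfolding state_of_def
proof (rule has_sum_infsum, rule summable_on_orthonormal[OF _ assms])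
  fix \<alpha> \<beta> assume "\<alpha> \<in> excited_states CARD('n) K" "\<beta> \<in> excited_states CARD('n) K"
  then have "inner (e (toggle \<alpha>)) (e (toggle \<beta>)) = (if toggle \<alpha> = toggle \<beta> then 1 else 0)"
    by (intro inner_e) (auto simp: excited_state)
  then show "inner (slater \<phi> \<alpha>) (slater \<phi> \<beta> :: 'n config l2) = (if \<alpha> = \<beta> then 1 else 0)"
    by (simp add: slater_e toggle_inject)
qed

lemma inner_has_sum:
  fixes f :: "'i \<Rightarrow> 'v::real_inner"
  assumes "(f has_sum s) A"
  shows "((\<lambda>i. inner (f i) v) has_sum inner s v) A"
  using has_sum_bounded_linear[OF bounded_linear_inner_left assms, of v] by (simp add: comp_def)

lemma coef_state_of:
  assumes "(\<lambda>\<alpha>. (t \<alpha>)\<^sup>2) summable_on excited_states CARD('n) K"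
  shows "coef (state_of t) x = (if x \<in> codes \<and> x \<noteq> {} then t (toggle x) else 0)"
proof (cases "x \<in> codes")
  case True
  have "((\<lambda>\<alpha>. inner (t \<alpha> *\<^sub>R slater \<phi> \<alpha>) (e x)) has_sum inner (state_of t) (e x)) (excited_states CARD('n) K)"
    by (rule inner_has_sum[OF square_summable_has_sum[OF assms]])
  moreover have "((\<lambda>\<alpha>. inner (t \<alpha> *\<^sub>R slater \<phi> \<alpha>) (e x)) has_sum (if x \<noteq> {} then t (toggle x) else 0)) (excited_states CARD('n) K)"
  proof -
    have i: "inner (t \<alpha> *\<^sub>R slater \<phi> \<alpha>) (e x) = (if \<alpha> = toggle x then t \<alpha> else 0)" if "\<alpha> \<in> excited_states CARD('n) K" for \<alpha>
      using that True by (auto simp: excited_state slater_e inner_e)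
    show ?thesis
    proof (cases "x = {}")
      case True
      then have "\<alpha> \<noteq> toggle x" if "\<alpha> \<in> excited_states CARD('n) K" for \<alpha> using that by (auto simp: excited_state)
      then show ?thesis using True i by (simp add: has_sum_0)
    next
      case False
      then have "toggle x \<in> excited_states CARD('n) K" using \<open>x \<in> codes\<close> by (simp add: excited_state)
      then have "((\<lambda>\<alpha>. inner (t \<alpha> *\<^sub>R slater \<phi> \<alpha>) (e x)) has_sum (\<Sum>\<alpha>\<in>{toggle x}. inner (t \<alpha> *\<^sub>R slater \<phi> \<alpha>) (e x))) {toggle x}"
        by (intro has_sum_finite) auto
      then have hs: "((\<lambda>\<alpha>. inner (t \<alpha> *\<^sub>R slater \<phi> \<alpha>) (e x)) has_sum (\<Sum>\<alpha>\<in>{toggle x}. inner (t \<alpha> *\<^sub>R slater \<phi> \<alpha>) (e x))) (excited_states CARD('n) K)"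
        by (rule has_sum_cong_neutral[THEN iffD1, rotated 3]) (use \<open>toggle x \<in> _\<close> i in auto)
      have "(\<Sum>\<alpha>\<in>{toggle x}. inner (t \<alpha> *\<^sub>R slater \<phi> \<alpha>) (e x)) = (if x \<noteq> {} then t (toggle x) else 0)"
        using i[OF \<open>toggle x \<in> _\<close>] False by simp
      then show ?thesis using hs by (simp only:)
    qed
  qed
  ultimately have "inner (state_of t) (e x) = (if x \<noteq> {} then t (toggle x) else 0)"
    by (rule has_sum_unique)
  then show ?thesis using True by (simp add: coef_def)
qed (simp add: coef_outside)

lemma amplitudes_iff:
  "t \<in> amplitudes TYPE('n) K \<phi> \<longleftrightarrow>
    (\<lambda>\<alpha>. (t \<alpha>)\<^sup>2) summable_on excited_states CARD('n) K \<and> state_of t \<in> V"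
  by (simp add: amplitudes_def state_of_def V_def)

lemma state_of_excited:
  assumes "t \<in> amplitudes TYPE('n) K \<phi>"
  shows "state_of t \<in> excited_space"
  using assms coef_state_of[of t "{}"] by (simp add: amplitudes_iff excited_space_def)

lemma excited_V: "v \<in> excited_space \<Longrightarrow> v \<in> V"
  by (simp add: excited_space_def)

text \<open>Bessel's inequality gives square summability.  The L2 sum \<open>s\<close> of the resulting series is not known to lie in \<open>V\<close>
beforehand; but \<open>s - v\<close> is orthogonal to all determinants while \<open>s\<close> and \<open>v\<close> are L2 limits of combinations of determinants, so
\<open>s = v\<close>.\<close>

theorem excited_space_amplitudes:
  assumes v: "v \<in> excited_space"
  shows "\<exists>t\<in>amplitudes TYPE('n) K \<phi>. state_of t = v"
proof -
  have vV: "v \<in> V" and v0: "coef v {} = 0" using v by (auto simp: excited_space_def)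
  define t where "t \<alpha> = coef v (toggle \<alpha>)" for \<alpha>
  have bessel: "(\<Sum>\<alpha>\<in>F. (t \<alpha>)\<^sup>2) \<le> (norm v)\<^sup>2" if F: "finite F" "F \<subseteq> excited_states CARD('n) K" for F
  proof -
    define w where "w = (\<Sum>\<alpha>\<in>F. t \<alpha> *\<^sub>R e (toggle \<alpha>))"
    have c: "toggle \<alpha> \<in> codes" if "\<alpha> \<in> F" for \<alpha> using that F(2) excited_state by blast
    have vw: "inner v w = (\<Sum>\<alpha>\<in>F. (t \<alpha>)\<^sup>2)"
      unfolding w_def inner_sum_right using c
      by (intro sum.cong) (auto simp: t_def coef_def power2_eq_square)
    have "inner w w = (\<Sum>\<alpha>\<in>F. t \<alpha> * inner (e (toggle \<alpha>)) w)" by (subst (1) w_def) (simp add: inner_sum_left)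
    also have "\<dots> = (\<Sum>\<alpha>\<in>F. (t \<alpha>)\<^sup>2)"
    proof (intro sum.cong refl)
      fix \<alpha> assume a: "\<alpha> \<in> F"
      have "inner (e (toggle \<alpha>)) w = (\<Sum>\<beta>\<in>F. if \<alpha> = \<beta> then t \<beta> else 0)"
        unfolding w_def inner_sum_right
        using c a by (intro sum.cong refl) (auto simp: inner_e toggle_inject)
      then show "t \<alpha> * inner (e (toggle \<alpha>)) w = (t \<alpha>)\<^sup>2" using F a by (simp add: power2_eq_square)
    qed
    finally have ww: "inner w w = (\<Sum>\<alpha>\<in>F. (t \<alpha>)\<^sup>2)" .
    have "0 \<le> inner (v - w) (v - w)" by simp
    then show ?thesis using vw ww
      by (simp add: inner_diff_left inner_diff_right inner_commute power2_norm_eq_inner)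
  qed
  have t: "(\<lambda>\<alpha>. (t \<alpha>)\<^sup>2) summable_on excited_states CARD('n) K"
    by (rule nonneg_bdd_above_summable_on) (use bessel in \<open>auto intro!: bdd_aboveI[of _ "(norm v)\<^sup>2"]\<close>)
  define s where "s = state_of t"
  have c: "coef s x = coef v x" for x
    unfolding s_def coef_state_of[OF t] by (auto simp: t_def v0 coef_outside)
  have orth: "inner (s - v) w = 0" if "w \<in> dets" for w
  proof -
    have "inner (s - v) (e x) = 0" if "x \<in> codes" for x using c[of x] that by (simp add: coef_def inner_diff_left)
    then have "e ` codes \<subseteq> {w. inner (s - v) w = 0}" by auto
    moreover have "subspace {w. inner (s - v) w = 0}" by (auto simp: subspace_def inner_add_right)
    ultimately show ?thesis using span_minimal that by blast
  qed
  have sv: "inner (s - v) v = 0"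
  proof -
    obtain w where w: "\<And>n. w n \<in> dets" "(\<lambda>n. h1_norm (w n - v)) \<longlonglongrightarrow> 0" using V_approx[OF vV] by blast
    have "(\<lambda>n. inner (s - v) (w n)) \<longlonglongrightarrow> inner (s - v) v" by (intro tendsto_intros h1_tendsto_l2 w)
    then show ?thesis using orth[OF w(1)] by (simp add: LIMSEQ_const_iff)
  qed
  have ss: "inner (s - v) s = 0"
  proof -
    have "((\<lambda>\<alpha>. inner (t \<alpha> *\<^sub>R slater \<phi> \<alpha>) (s - v)) has_sum inner s (s - v)) (excited_states CARD('n) K)"
      unfolding s_def by (rule inner_has_sum[OF square_summable_has_sum[OF t]])
    moreover have "inner (t \<alpha> *\<^sub>R slater \<phi> \<alpha>) (s - v) = 0" if "\<alpha> \<in> excited_states CARD('n) K" for \<alpha>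
      using orth[OF span_base, of "e (toggle \<alpha>)"] that by (simp add: excited_state slater_e inner_commute)
    ultimately have "inner s (s - v) = 0" using has_sum_0 has_sum_unique by (metis (no_types, lifting))
    then show ?thesis by (simp add: inner_commute)
  qed
  have "inner (s - v) (s - v) = 0" using sv ss by (simp add: inner_diff_right)
  then have "s = v" by simp
  then show ?thesis using t vV by (intro bexI[of _ t]) (auto simp: amplitudes_iff s_def)
qed

text \<open>The product is continuous for the L2 norm in its left factor, so it commutes with the L2-convergent sum.\<close>

theorem cluster_eq_mul:
  assumes t: "t \<in> amplitudes TYPE('n) K \<phi>" and u: "u \<in> V"
  shows "cluster K \<phi> t u = mul (state_of t) u"
proof -
  let ?A = "excited_states CARD('n) K"
  have tau: "state_of t \<in> V" and hs: "((\<lambda>\<alpha>. t \<alpha> *\<^sub>R slater \<phi> \<alpha>) has_sum state_of t) ?A"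
    using t square_summable_has_sum by (auto simp: amplitudes_iff)
  have st: "\<alpha> \<in> states CARD('n) K" if "\<alpha> \<in> ?A" for \<alpha> using that by (simp add: excited_states_def)
  have sV: "slater \<phi> \<alpha> \<in> V" if "\<alpha> \<in> ?A" for \<alpha> using that e_V by (simp add: slater_e excited_state)
  have part: "(\<Sum>\<alpha>\<in>F. t \<alpha> *\<^sub>R excitation K \<phi> \<alpha> u) = mul (\<Sum>\<alpha>\<in>F. t \<alpha> *\<^sub>R slater \<phi> \<alpha>) u"
    if "finite F" "F \<subseteq> ?A" for F
    using that
  proof (induction rule: finite_induct)
    case empty
    then show ?case using mul_zero(1)[OF u] by simp
  next
    case (insert \<alpha> F)
    have "t \<alpha> *\<^sub>R slater \<phi> \<alpha> \<in> V" "(\<Sum>\<alpha>\<in>F. t \<alpha> *\<^sub>R slater \<phi> \<alpha>) \<in> V"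
      using insert sV by (auto intro!: V_scale V_sum)
    then show ?case
      using insert u sV st mul_linear(1)[OF _ _ u u] mul_linear(3)[OF sV sV u u, of \<alpha> \<alpha> "t \<alpha>"]
      by (simp add: excitation_eq_mul)
  qed
  have "((\<lambda>\<alpha>. t \<alpha> *\<^sub>R excitation K \<phi> \<alpha> u) has_sum mul (state_of t) u) ?A"
    unfolding has_sum_def
  proof (rule tendstoI)
    fix \<epsilon> :: real assume \<epsilon>: "\<epsilon> > 0"
    define c where "c = l2_const * norm u + 1"
    have c: "c > 0" using l2_const_nonneg by (simp add: c_def add_nonneg_pos)
    have "\<forall>\<^sub>F F in finite_subsets_at_top ?A. dist (\<Sum>\<alpha>\<in>F. t \<alpha> *\<^sub>R slater \<phi> \<alpha>) (state_of t) < \<epsilon> / c"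
      using hs unfolding has_sum_def by (rule tendstoD) (use \<epsilon> c in simp)
    moreover have "\<forall>\<^sub>F F in finite_subsets_at_top ?A. finite F \<and> F \<subseteq> ?A"
      by (rule eventually_finite_subsets_at_top_weakI) auto
    ultimately show "\<forall>\<^sub>F F in finite_subsets_at_top ?A.
        dist (\<Sum>\<alpha>\<in>F. t \<alpha> *\<^sub>R excitation K \<phi> \<alpha> u) (mul (state_of t) u) < \<epsilon>"
    proof eventually_elim
      fix F assume d: "dist (\<Sum>\<alpha>\<in>F. t \<alpha> *\<^sub>R slater \<phi> \<alpha>) (state_of t) < \<epsilon> / c" and F: "finite F \<and> F \<subseteq> ?A"
      let ?s = "\<Sum>\<alpha>\<in>F. t \<alpha> *\<^sub>R slater \<phi> \<alpha> :: 'n config l2"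
      have s: "?s \<in> V" using F sV by (auto intro!: V_scale V_sum)
      have "dist (\<Sum>\<alpha>\<in>F. t \<alpha> *\<^sub>R excitation K \<phi> \<alpha> u) (mul (state_of t) u) = norm (mul (?s - state_of t) u)"
        using part F mul_linear(2)[OF s tau u u] by (simp add: dist_norm)
      also have "\<dots> \<le> l2_const * norm (?s - state_of t) * norm u"
        by (intro norm_mul V_diff s tau u)
      also have "\<dots> \<le> norm (?s - state_of t) * c"
        by (simp add: c_def algebra_simps)
      also have "\<dots> < \<epsilon>" using d c by (simp add: dist_norm pos_less_divide_eq)
      finally show "dist (\<Sum>\<alpha>\<in>F. t \<alpha> *\<^sub>R excitation K \<phi> \<alpha> u) (mul (state_of t) u) < \<epsilon>" .
    qed
  qed
  then show ?thesis unfolding cluster_def by (rule infsumI)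
qed

theorem adjoint_cluster:
  assumes t: "t \<in> amplitudes TYPE('n) K \<phi>"
  shows "l2_adjoint_on V (cluster K \<phi> t) = (\<lambda>v. if v \<in> V then adj (state_of t) v else 0)"
proof -
  have tau: "state_of t \<in> V" using t by (simp add: amplitudes_iff)
  show ?thesis
    unfolding l2_adjoint_on_def
  proof (rule the_equality)
    show "(\<lambda>v. if v \<in> V then adj (state_of t) v else 0) \<in> V \<rightarrow> V \<and>
      (\<forall>v. v \<notin> V \<longrightarrow> (if v \<in> V then adj (state_of t) v else 0) = 0) \<and>
      (\<forall>u\<in>V. \<forall>v\<in>V. inner (cluster K \<phi> t u) v = inner u (if v \<in> V then adj (state_of t) v else 0))"
      using adj_V[OF tau] inner_adj[OF tau] cluster_eq_mul[OF t] by auto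
    fix B assume B: "B \<in> V \<rightarrow> V \<and> (\<forall>v. v \<notin> V \<longrightarrow> B v = 0) \<and>
      (\<forall>u\<in>V. \<forall>v\<in>V. inner (cluster K \<phi> t u) v = inner u (B v))"
    show "B = (\<lambda>v. if v \<in> V then adj (state_of t) v else 0)"
    proof
      fix v
      have "adj (state_of t) v = B v" if "v \<in> V"
        by (rule adj_unique) (use B that cluster_eq_mul[OF t] in auto)
      then show "B v = (if v \<in> V then adj (state_of t) v else 0)" using B by auto
    qed
  qed
qed

end

section \<open>Exponential and logarithm of nilpotent operators\<close>

text \<open>The power series \<open>F\<close> at the nilpotent operator \<open>A\<close>.  For fixed \<open>A\<close> this is multiplicative in \<open>F\<close>, so
identities between exponential and logarithm follow from those of formal power series.\<close>

definition nil_eval :: "nat \<Rightarrow> ('v::real_vector \<Rightarrow> 'v) \<Rightarrow> real fps \<Rightarrow> 'v \<Rightarrow> 'v" where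
  "nil_eval N A F u = (\<Sum>j\<le>N. fps_nth F j *\<^sub>R (A ^^ j) u)"

lemma exp_nilpotent_eq: "exp_nilpotent N A u = nil_eval N A (fps_exp 1) u"
  by (simp add: exp_nilpotent_def nil_eval_def inverse_eq_divide)

locale nilpotent_operator =
  fixes S :: "'v::real_vector set" and A :: "'v \<Rightarrow> 'v" and N :: nat
  assumes S: "subspace S" and A_S: "\<And>u. u \<in> S \<Longrightarrow> A u \<in> S"
    and A_add: "\<And>u v. u \<in> S \<Longrightarrow> v \<in> S \<Longrightarrow> A (u + v) = A u + A v"
    and A_scale: "\<And>c u. u \<in> S \<Longrightarrow> A (c *\<^sub>R u) = c *\<^sub>R A u"
    and nilpotent: "\<And>u. u \<in> S \<Longrightarrow> (A ^^ Suc N) u = 0"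
begin

lemma pow_S: "u \<in> S \<Longrightarrow> (A ^^ j) u \<in> S"
  by (induction j) (auto simp: A_S)

lemma pow_scale: "u \<in> S \<Longrightarrow> (A ^^ j) (c *\<^sub>R u) = c *\<^sub>R (A ^^ j) u"
  by (induction j) (auto simp: A_scale pow_S)

lemma pow_add: "u \<in> S \<Longrightarrow> v \<in> S \<Longrightarrow> (A ^^ j) (u + v) = (A ^^ j) u + (A ^^ j) v"
  by (induction j) (auto simp: A_add pow_S)

lemma pow_0: "(A ^^ j) 0 = 0"
  using pow_scale[OF subspace_0[OF S], of j 0] by simp

lemma pow_sum: "(\<And>i. i \<in> I \<Longrightarrow> v i \<in> S) \<Longrightarrow> (A ^^ j) (\<Sum>i\<in>I. c i *\<^sub>R v i) = (\<Sum>i\<in>I. c i *\<^sub>R (A ^^ j) (v i))"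
proof (induction I rule: infinite_finite_induct)
  case (insert i I)
  then have "(\<Sum>i\<in>I. c i *\<^sub>R v i) \<in> S" "c i *\<^sub>R v i \<in> S"
    by (auto intro!: subspace_sum[OF S] subspace_scale[OF S])
  then show ?case using insert by (simp add: pow_add pow_scale)
qed (simp_all add: pow_0)

lemma pow_vanish: "u \<in> S \<Longrightarrow> N < m \<Longrightarrow> (A ^^ m) u = 0"
proof -
  assume u: "u \<in> S" and "N < m"
  then obtain k where m: "m = k + Suc N" using less_iff_Suc_add[of N m] by (auto simp: add.commute)
  have "(A ^^ m) u = (A ^^ k) ((A ^^ Suc N) u)" unfolding m funpow_add by simp
  then show ?thesis unfolding nilpotent[OF u] by (simp add: pow_0)
qed

lemma nil_eval_S: "u \<in> S \<Longrightarrow> nil_eval N A F u \<in> S"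
  unfolding nil_eval_def by (intro subspace_sum[OF S] subspace_scale[OF S] pow_S)

lemma nil_eval_linear:
  "u \<in> S \<Longrightarrow> v \<in> S \<Longrightarrow> nil_eval N A F (u + v) = nil_eval N A F u + nil_eval N A F v"
  "u \<in> S \<Longrightarrow> nil_eval N A F (c *\<^sub>R u) = c *\<^sub>R nil_eval N A F u"
  by (simp_all add: nil_eval_def pow_add pow_scale scaleR_add_right sum.distrib scaleR_sum_right mult.commute)

lemma nil_eval_mult:
  assumes u: "u \<in> S"
  shows "nil_eval N A F (nil_eval N A G u) = nil_eval N A (F * G) u"
proof -
  let ?g = "\<lambda>i j. (fps_nth F i * fps_nth G j) *\<^sub>R (A ^^ (i + j)) u"
  have "nil_eval N A F (nil_eval N A G u) = (\<Sum>i\<le>N. \<Sum>j\<le>N. ?g i j)"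
    unfolding nil_eval_def by (simp add: pow_sum pow_S u scaleR_sum_right funpow_add)
  also have "\<dots> = (\<Sum>(i, j)\<in>{..N} \<times> {..N}. ?g i j)" by (simp add: sum.cartesian_product)
  also have "\<dots> = (\<Sum>(i, j)\<in>{(i, j). i + j \<le> N}. ?g i j)"
  proof (rule sum.mono_neutral_right)
    show "\<forall>q\<in>{..N} \<times> {..N} - {(i, j). i + j \<le> N}. (case q of (i, j) \<Rightarrow> ?g i j) = 0"
    proof
      fix q assume q: "q \<in> {..N} \<times> {..N} - {(i, j). i + j \<le> N}"
      then have "N < fst q + snd q" by auto
      then show "(case q of (i, j) \<Rightarrow> ?g i j) = 0" using pow_vanish[OF u] by (simp add: case_prod_unfold)
    qed
  qed auto
  also have "\<dots> = (\<Sum>m\<le>N. \<Sum>i\<le>m. ?g i (m - i))" by (rule sum.triangle_reindex_eq)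
  also have "\<dots> = nil_eval N A (F * G) u"
    unfolding nil_eval_def
    by (intro sum.cong refl) (simp add: fps_mult_nth scaleR_sum_left atLeast0AtMost)
  finally show ?thesis .
qed

lemma nil_eval_1: "nil_eval N A 1 u = u"
proof -
  have "nil_eval N A 1 u = (\<Sum>j\<le>N. if j = 0 then u else 0)"
    unfolding nil_eval_def by (intro sum.cong) auto
  then show ?thesis by simp
qed

lemma nil_eval_exp_inverse:
  assumes "u \<in> S"
  shows "nil_eval N A (fps_exp (- 1)) (nil_eval N A (fps_exp 1) u) = u"
  unfolding nil_eval_mult[OF assms] fps_exp_add_mult[symmetric] by (simp add: nil_eval_1)

lemma exp_nilpotent_minus:
  assumes u: "u \<in> S"
  shows "exp_nilpotent N (\<lambda>v. - A v) u = nil_eval N A (fps_exp (- 1)) u"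
proof -
  have "((\<lambda>v. - A v) ^^ j) u = (- 1) ^ j *\<^sub>R (A ^^ j) u" for j
  proof (induction j)
    case (Suc j)
    then show ?case using A_scale[OF pow_S[OF u], of "(- 1) ^ j" j] by simp
  qed simp
  then show ?thesis
    unfolding exp_nilpotent_def nil_eval_def
    by (intro sum.cong refl) (simp add: divide_inverse mult.commute)
qed

end

lemma funpow_cong_on:
  assumes "\<And>u. u \<in> S \<Longrightarrow> A u = B u" "\<And>u. u \<in> S \<Longrightarrow> B u \<in> S" "u \<in> S"
  shows "(A ^^ j) u = (B ^^ j) u"
proof -
  have "(A ^^ j) u = (B ^^ j) u \<and> (B ^^ j) u \<in> S"
    by (induction j) (use assms in auto)
  then show ?thesis by simp
qed

lemma nil_eval_cong_on:
  assumes "\<And>u. u \<in> S \<Longrightarrow> A u = B u" "\<And>u. u \<in> S \<Longrightarrow> B u \<in> S" "u \<in> S"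
  shows "nil_eval N A F u = nil_eval N B F u"
  unfolding nil_eval_def using funpow_cong_on[of S A B u, OF assms] by simp

text \<open>The series of \<open>log (1 + X)\<close>, as the compositional inverse of \<open>exp X - 1\<close>.\<close>

definition fps_log1 :: "real fps" where
  "fps_log1 = fps_inv (fps_exp 1 - 1)"

lemma fps_log1_0: "fps_nth fps_log1 0 = 0"
  by (simp add: fps_log1_def fps_inv_def)

lemma fps_exp_compose_log1: "fps_exp 1 oo fps_log1 = 1 + fps_X"
proof -
  have "(fps_exp 1 - 1) oo fps_log1 = fps_X"
    unfolding fps_log1_def by (rule fps_inv_right) simp_all
  then show ?thesis by (simp add: fps_compose_sub_distrib algebra_simps)
qed

context slater_basis
begin

abbreviation (input) N :: nat where "N \<equiv> card occupied"

text \<open>Each factor without constant term adds at least one particle, and a state has at most \<open>N\<close> of them.\<close>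

lemma mul_pow_order:
  assumes c: "c \<in> excited_space" and u: "u \<in> V"
  shows "(mul c ^^ j) u \<in> V \<and> (\<forall>z. coef ((mul c ^^ j) u) z \<noteq> 0 \<longrightarrow> j \<le> card (z - occupied))"
proof (induction j)
  case 0
  then show ?case using u by simp
next
  case (Suc j)
  let ?w = "(mul c ^^ j) u"
  have cV: "c \<in> V" and c0: "coef c {} = 0" using c by (auto simp: excited_space_def)
  have w: "?w \<in> V" using Suc by simp
  have "Suc j \<le> card (z - occupied)" if "coef (mul c ?w) z \<noteq> 0" for z
  proof -
    have "conv occupied (coef c) (coef ?w) z \<noteq> 0" using that coef_mul[OF cV w] by simp
    then obtain x where x: "x \<subseteq> z" "coef c x \<noteq> 0" "coef ?w (z - x) \<noteq> 0"
      unfolding conv_def by (auto elim!: sum.not_neutral_contains_not_neutral)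
    have xc: "x \<in> codes" "z - x \<in> codes" using x coef_outside by blast+
    have "x \<noteq> {}" using x c0 by auto
    then have "card x > 0" using xc code_finite by (simp add: card_gt_0_iff)
    moreover have "card x = card (x \<inter> occupied) + card (x - occupied)"
      using code_finite[OF xc(1)] by (rule card_Int_Diff)
    moreover have "card (x \<inter> occupied) = card (x - occupied)" using xc by (simp add: codes_def)
    ultimately have 1: "1 \<le> card (x - occupied)" by linarith
    have 2: "j \<le> card ((z - x) - occupied)" using Suc x by blast
    have "z - occupied = (x - occupied) \<union> ((z - x) - occupied)" using x by auto
    then have "card (z - occupied) = card (x - occupied) + card ((z - x) - occupied)"
      using xc code_finite by (metis (no_types, lifting) Diff_disjoint Diff_Int2 card_Un_disjoint finite_Diff Diff_Int_distrib2 Int_Diff inf_commute)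
    then show ?thesis using 1 2 by linarith
  qed
  then show ?case using mul_V[OF cV w] by simp
qed

lemma nilpotent_mul:
  assumes c: "c \<in> excited_space"
  shows "nilpotent_operator V (mul c) N"
proof
  have cV: "c \<in> V" using c by (rule excited_V)
  show "subspace V" by (rule subspace_V)
  show "mul c u \<in> V" if "u \<in> V" for u by (rule mul_V[OF cV that])
  show "mul c (u + v) = mul c u + mul c v" if "u \<in> V" "v \<in> V" for u v
    by (rule mul_linear(4)[OF cV cV that])
  show "mul c (a *\<^sub>R u) = a *\<^sub>R mul c u" if "u \<in> V" for a u
    by (rule mul_linear(6)[OF cV cV that that])
  show "(mul c ^^ Suc N) u = 0" if u: "u \<in> V" for u
  proof (rule V_zeroI)
    note o = mul_pow_order[OF c u, of "Suc N"]
    show "(mul c ^^ Suc N) u \<in> V" using o by (rule conjunct1)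
    fix z
    show "coef ((mul c ^^ Suc N) u) z = 0"
    proof (rule ccontr)
      assume n: "coef ((mul c ^^ Suc N) u) z \<noteq> 0"
      then have "Suc N \<le> card (z - occupied)" using o by blast
      moreover have "z \<in> codes" using n coef_outside by blast
      then have "card (z - occupied) = card (z \<inter> occupied)" by (simp add: codes_def)
      moreover have "card (z \<inter> occupied) \<le> N" by (intro card_mono) auto
      ultimately show False by linarith
    qed
  qed
qed

lemma inner_mul_pow:
  assumes c: "c \<in> V" and w: "w \<in> V" and v: "v \<in> V"
  shows "inner ((mul c ^^ j) w) v = inner w ((adj c ^^ j) v) \<and> (adj c ^^ j) v \<in> V"
  using w
proof (induction j arbitrary: w)
  case 0
  then show ?case using v by simp
next
  case (Suc j)
  have a: "(adj c ^^ j) v \<in> V" using Suc.IH[OF Suc.prems] by simp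
  have "inner ((mul c ^^ Suc j) w) v = inner ((mul c ^^ j) (mul c w)) v"
    by (simp only: funpow_Suc_right comp_apply)
  also have "\<dots> = inner (mul c w) ((adj c ^^ j) v)"
    using Suc.IH[OF mul_V[OF c Suc.prems]] by simp
  also have "\<dots> = inner w (adj c ((adj c ^^ j) v))" by (rule inner_adj[OF c a Suc.prems])
  finally show ?case using adj_V[OF c a] by simp
qed

lemma nilpotent_adj:
  assumes c: "c \<in> excited_space"
  shows "nilpotent_operator V (adj c) N"
proof
  have cV: "c \<in> V" using c by (rule excited_V)
  show "subspace V" by (rule subspace_V)
  show "adj c u \<in> V" if "u \<in> V" for u by (rule adj_V[OF cV that])
  show "adj c (u + v) = adj c u + adj c v" if "u \<in> V" "v \<in> V" for u v
    by (rule adj_linear_right(1)[OF cV that])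
  show "adj c (a *\<^sub>R u) = a *\<^sub>R adj c u" if "u \<in> V" for a u
    by (rule adj_linear_right(2)[OF cV that that])
  show "(adj c ^^ Suc N) u = 0" if u: "u \<in> V" for u
  proof (rule V_ortho_zero)
    show "(adj c ^^ Suc N) u \<in> V" using inner_mul_pow[OF cV u u] by blast
    show "inner w ((adj c ^^ Suc N) u) = 0" if "w \<in> V" for w
      using inner_mul_pow[OF cV that u, of "Suc N"] nilpotent_operator.nilpotent[OF nilpotent_mul[OF c] that]
      by simp
  qed
qed

lemma inner_nil_eval:
  assumes c: "c \<in> excited_space" and w: "w \<in> V" and v: "v \<in> V"
  shows "inner (nil_eval N (mul c) F w) v = inner w (nil_eval N (adj c) F v)"
  using inner_mul_pow[OF excited_V[OF c] w v]
  by (simp add: nil_eval_def inner_sum_left inner_sum_right)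

lemma mul_sum_left:
  assumes "\<And>i. i \<in> I \<Longrightarrow> f i \<in> V" "u \<in> V"
  shows "mul (\<Sum>i\<in>I. a i *\<^sub>R f i) u = (\<Sum>i\<in>I. a i *\<^sub>R mul (f i) u)"
  using assms(1)
proof (induction I rule: infinite_finite_induct)
  case (insert i I)
  then have "a i *\<^sub>R f i \<in> V" "(\<Sum>i\<in>I. a i *\<^sub>R f i) \<in> V" by (auto intro!: V_scale V_sum)
  then show ?case
    using insert mul_linear(1)[OF _ _ assms(2) assms(2)] mul_linear(3)[OF _ _ assms(2) assms(2), of "f i" "f i" "a i"]
    by simp
qed (simp_all add: mul_zero assms(2))

lemma mul_pow_unit:
  assumes c: "c \<in> V" and u: "u \<in> V"
  shows "mul ((mul c ^^ j) (e {})) u = (mul c ^^ j) u \<and> (mul c ^^ j) (e {}) \<in> V"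
proof (induction j)
  case 0
  then show ?case using mul_unit[OF u] e_V[OF empty_code] by simp
next
  case (Suc j)
  then have x: "(mul c ^^ j) (e {}) \<in> V" by simp
  have "mul (mul c ((mul c ^^ j) (e {}))) u = mul c (mul ((mul c ^^ j) (e {})) u)"
    by (rule mul_assoc[OF c x u, symmetric])
  then show ?case using Suc mul_V[OF c x] by simp
qed

text \<open>The logarithm of \<open>1 + c\<close> in the algebra, applied to the unit \<open>e {}\<close>.\<close>

definition logarithm :: "'n config l2 \<Rightarrow> 'n config l2" where
  "logarithm c = nil_eval N (mul c) fps_log1 (e {})"

lemma logarithm_excited:
  assumes c: "c \<in> excited_space"
  shows "logarithm c \<in> excited_space"
proof -
  interpret nilpotent_operator V "mul c" N by (rule nilpotent_mul[OF c])
  have "coef (logarithm c) {} = (\<Sum>j\<le>N. fps_nth fps_log1 j * coef ((mul c ^^ j) (e {})) {})"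
    by (simp add: logarithm_def nil_eval_def coef_sum coef_linear)
  also have "\<dots> = 0"
  proof (intro sum.neutral ballI)
    fix j
    show "fps_nth fps_log1 j * coef ((mul c ^^ j) (e {})) {} = 0"
    proof (cases j)
      case 0
      then show ?thesis by (simp add: fps_log1_0)
    next
      case (Suc k)
      have "coef ((mul c ^^ j) (e {})) {} \<noteq> 0 \<longrightarrow> j \<le> card ({} - occupied)"
        using mul_pow_order[OF c e_V[OF empty_code], of j] by blast
      then show ?thesis using Suc by auto
    qed
  qed
  finally show ?thesis
    using nil_eval_S[OF e_V[OF empty_code]] by (simp add: excited_space_def logarithm_def)
qed

text \<open>By associativity, multiplication by a power series in \<open>c\<close> is the same power series in the multiplication by
\<open>c\<close>; hence the exponential of the logarithm can be computed in formal power series.\<close>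

theorem exp_logarithm:
  assumes c: "c \<in> excited_space"
  shows "nil_eval N (mul (logarithm c)) (fps_exp 1) (e {}) = e {} + c"
proof -
  interpret nilpotent_operator V "mul c" N by (rule nilpotent_mul[OF c])
  have cV: "c \<in> V" using c by (rule excited_V)
  have e0: "e {} \<in> V" by (rule e_V[OF empty_code])
  have log_mul: "mul (logarithm c) u = nil_eval N (mul c) fps_log1 u" if u: "u \<in> V" for u
    unfolding logarithm_def nil_eval_def using mul_pow_unit[OF cV u] pow_S[OF e0]
    by (subst mul_sum_left) (auto simp: u)
  have log_pow: "(mul (logarithm c) ^^ j) (e {}) = nil_eval N (mul c) (fps_log1 ^ j) (e {})" for j
  proof (induction j)
    case 0
    then show ?case by (simp add: nil_eval_1)
  next
    case (Suc j)
    then show ?case by (simp add: log_mul nil_eval_S e0 nil_eval_mult)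
  qed
  have "nil_eval N (mul (logarithm c)) (fps_exp 1) (e {})
      = (\<Sum>j\<le>N. \<Sum>m\<le>N. (fps_nth (fps_exp 1) j * fps_nth (fps_log1 ^ j) m) *\<^sub>R (mul c ^^ m) (e {}))"
    unfolding nil_eval_def[of N "mul (logarithm c)"] log_pow
    by (simp add: nil_eval_def scaleR_sum_right)
  also have "\<dots> = (\<Sum>m\<le>N. (\<Sum>j\<le>N. fps_nth (fps_exp 1) j * fps_nth (fps_log1 ^ j) m) *\<^sub>R (mul c ^^ m) (e {}))"
    unfolding scaleR_sum_left by (rule sum.swap)
  also have "\<dots> = (\<Sum>m\<le>N. fps_nth (1 + fps_X) m *\<^sub>R (mul c ^^ m) (e {}))"
  proof (rule sum.cong[OF refl])
    fix m assume "m \<in> {..N}"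
    then have "(\<Sum>j\<le>N. fps_nth (fps_exp 1) j * fps_nth (fps_log1 ^ j) m)
        = (\<Sum>j\<in>{0..m}. fps_nth (fps_exp 1) j * fps_nth (fps_log1 ^ j) m)"
      using startsby_zero_power_prefix[OF fps_log1_0] by (intro sum.mono_neutral_right) auto
    also have "\<dots> = fps_nth (1 + fps_X) m"
      unfolding fps_exp_compose_log1[symmetric] fps_compose_nth ..
    finally show "(\<Sum>j\<le>N. fps_nth (fps_exp 1) j * fps_nth (fps_log1 ^ j) m) *\<^sub>R (mul c ^^ m) (e {})
        = fps_nth (1 + fps_X) m *\<^sub>R (mul c ^^ m) (e {})" by simp
  qed
  also have "\<dots> = (\<Sum>m\<in>{0, 1}. fps_nth (1 + fps_X) m *\<^sub>R (mul c ^^ m) (e {}))"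
    using card_occupied by (intro sum.mono_neutral_right) (auto simp: Suc_le_eq)
  also have "\<dots> = e {} + c" by (simp add: mul_unit(2)[OF cV])
  finally show ?thesis .
qed

section \<open>The equivalence of the three problems\<close>

lemma inner_e0: "v \<in> V \<Longrightarrow> inner v (e {}) = coef v {}"
  by (simp add: coef_def empty_code)

lemma excited_decomposition:
  assumes "v \<in> V" shows "v - coef v {} *\<^sub>R e {} \<in> excited_space"
  using assms empty_code
  by (auto simp: excited_space_def coef_linear coef_e intro!: V_diff V_scale e_V)

lemma exp_cluster_eq:
  assumes t: "t \<in> amplitudes TYPE('n) K \<phi>"
  shows "exp_cluster K \<phi> t (e {}) = nil_eval N (mul (state_of t)) (fps_exp 1) (e {})"
proof -
  have tau: "state_of t \<in> V" using t by (simp add: amplitudes_iff)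
  have "exp_cluster K \<phi> t (e {}) = nil_eval N (cluster K \<phi> t) (fps_exp 1) (e {})"
    by (simp add: exp_cluster_def exp_nilpotent_eq card_occupied)
  also have "\<dots> = nil_eval N (mul (state_of t)) (fps_exp 1) (e {})"
    by (rule nil_eval_cong_on[where S = V]) (use cluster_eq_mul[OF t] mul_V[OF tau] e_V[OF empty_code] in auto)
  finally show ?thesis .
qed

lemma exp_neg_cluster_dual_eq:
  assumes t: "t \<in> amplitudes TYPE('n) K \<phi>" and v: "v \<in> V"
  shows "exp_neg_cluster_dual K \<phi> t F v = F (nil_eval N (adj (state_of t)) (fps_exp (- 1)) v)"
proof -
  have tau: "state_of t \<in> V" using t by (simp add: amplitudes_iff)
  interpret nilpotent_operator V "adj (state_of t)" N by (rule nilpotent_adj[OF state_of_excited[OF t]])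
  have "exp_nilpotent N (\<lambda>u. - l2_adjoint_on V (cluster K \<phi> t) u) v
      = exp_nilpotent N (\<lambda>u. - adj (state_of t) u) v"
    unfolding exp_nilpotent_eq adjoint_cluster[OF t]
    by (rule nil_eval_cong_on[where S = V]) (use v A_S subspace_neg[OF subspace_V] in auto)
  then show ?thesis
    using exp_nilpotent_minus[OF v] by (simp add: exp_neg_cluster_dual_def card_occupied V_def)
qed

lemma cluster_reference:
  assumes "t \<in> amplitudes TYPE('n) K \<phi>"
  shows "cluster K \<phi> t (e {}) = state_of t"
  using assms cluster_eq_mul[OF assms e_V[OF empty_code]] mul_unit(2)[of "state_of t"]
  by (simp add: amplitudes_iff)

lemma excited_space_iff_cluster:
  "(\<forall>s\<in>amplitudes TYPE('n) K \<phi>. R (cluster K \<phi> s (e {}))) \<longleftrightarrow> (\<forall>v\<in>excited_space. R v)"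
proof
  assume *: "\<forall>s\<in>amplitudes TYPE('n) K \<phi>. R (cluster K \<phi> s (e {}))"
  show "\<forall>v\<in>excited_space. R v"
  proof
    fix v assume "v \<in> excited_space"
    then obtain s where "s \<in> amplitudes TYPE('n) K \<phi>" "state_of s = v" using excited_space_amplitudes by blast
    then show "R v" using * cluster_reference by metis
  qed
qed (auto simp: cluster_reference state_of_excited)

lemma full_CC_iff:
  "full_CC K \<phi> H \<Psi> t \<longleftrightarrow> t \<in> amplitudes TYPE('n) K \<phi> \<and>
    \<Psi> = nil_eval N (mul (state_of t)) (fps_exp 1) (e {}) \<and>
    (\<forall>v\<in>excited_space. H \<Psi> (nil_eval N (adj (state_of t)) (fps_exp (- 1)) v) = 0)"
proof (cases "t \<in> amplitudes TYPE('n) K \<phi> \<and> \<Psi> = nil_eval N (mul (state_of t)) (fps_exp 1) (e {})")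
  case True
  then have t: "t \<in> amplitudes TYPE('n) K \<phi>" and \<Psi>: "exp_cluster K \<phi> t (e {}) = \<Psi>"
    by (simp_all add: exp_cluster_eq)
  show ?thesis
    unfolding full_CC_def Let_def reference_e \<Psi>
      excited_space_iff_cluster[where R = "\<lambda>v. exp_neg_cluster_dual K \<phi> t (H \<Psi>) v = 0"]
    using True by (auto simp: exp_neg_cluster_dual_eq[OF t] excited_V)
next
  case False
  then show ?thesis by (auto simp: full_CC_def Let_def reference_e exp_cluster_eq)
qed

lemma CC_energy_eq:
  assumes "full_CC K \<phi> H \<Psi> t"
  shows "CC_energy K \<phi> H t = H \<Psi> (nil_eval N (adj (state_of t)) (fps_exp (- 1)) (e {}))"
  using assms exp_cluster_eq[of t] exp_neg_cluster_dual_eq[OF _ e_V[OF empty_code]]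
  unfolding full_CC_iff by (simp add: CC_energy_def Let_def reference_e)

lemma full_CI_iff:
  "full_CI K \<phi> H \<Psi> c \<longleftrightarrow> c \<in> amplitudes TYPE('n) K \<phi> \<and> \<Psi> = e {} + state_of c \<and>
    (\<forall>v\<in>excited_space. H \<Psi> v = H \<Psi> (e {}) * inner \<Psi> v)"
proof (cases "c \<in> amplitudes TYPE('n) K \<phi> \<and> \<Psi> = e {} + state_of c")
  case True
  then have \<Psi>: "e {} + cluster K \<phi> c (e {}) = \<Psi>" by (simp add: cluster_reference)
  show ?thesis
    unfolding full_CI_def CI_energy_def Let_def reference_e \<Psi>
      excited_space_iff_cluster[where R = "\<lambda>v. H \<Psi> v = H \<Psi> (e {}) * inner \<Psi> v"]
    using True by auto
next
  case False
  then show ?thesis by (auto simp: full_CI_def Let_def reference_e cluster_reference)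
qed

lemma CI_energy_eq:
  assumes "full_CI K \<phi> H \<Psi> c"
  shows "CI_energy K \<phi> H c = H \<Psi> (e {})"
  using assms cluster_reference[of c] unfolding full_CI_iff
  by (simp add: CI_energy_def Let_def reference_e)

context
  fixes H :: "'n config l2 \<Rightarrow> 'n config l2 \<Rightarrow> real" and \<Psi> :: "'n config l2"
  assumes H: "linear_on_subspace V (H \<Psi>)" and \<Psi>V: "\<Psi> \<in> V" and \<Psi>1: "inner \<Psi> (e {}) = 1"
begin

lemma H_linear: "u \<in> V \<Longrightarrow> v \<in> V \<Longrightarrow> H \<Psi> (a *\<^sub>R u + b *\<^sub>R v) = a * H \<Psi> u + b * H \<Psi> v"
  using H by (simp add: linear_on_subspace_def)

lemma residual_excited: "\<Psi> - e {} \<in> excited_space"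
  using excited_decomposition[OF \<Psi>V] \<Psi>1 inner_e0[OF \<Psi>V] by simp

text \<open>The exponential moves to the left factor, where it takes \<open>\<Psi>\<close> back to the reference determinant.\<close>

lemma eigen_CC_pairing:
  assumes E: "\<forall>\<Phi>\<in>V. H \<Psi> \<Phi> = E * inner \<Psi> \<Phi>"
    and c: "c \<in> excited_space" and \<Psi>: "\<Psi> = nil_eval N (mul c) (fps_exp 1) (e {})" and v: "v \<in> V"
  shows "H \<Psi> (nil_eval N (adj c) (fps_exp (- 1)) v) = E * inner (e {}) v"
proof -
  have e0: "e {} \<in> V" by (rule e_V[OF empty_code])
  have "inner \<Psi> (nil_eval N (adj c) (fps_exp (- 1)) v) = inner (nil_eval N (mul c) (fps_exp (- 1)) \<Psi>) v"
    using inner_nil_eval[OF c \<Psi>V v] by simp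
  also have "nil_eval N (mul c) (fps_exp (- 1)) \<Psi> = e {}"
    unfolding \<Psi> by (rule nilpotent_operator.nil_eval_exp_inverse[OF nilpotent_mul[OF c] e0])
  finally show ?thesis
    using E nilpotent_operator.nil_eval_S[OF nilpotent_adj[OF c] v] by simp
qed

text \<open>The adjoint exponential is onto, so every \<open>\<Phi>\<close> can be tested; the reference component of its preimage is \<open>\<langle>\<Psi>, \<Phi>\<rangle>\<close>.\<close>

lemma CC_imp_eigen:
  assumes CC: "full_CC K \<phi> H \<Psi> t"
  shows "\<forall>\<Phi>\<in>V. H \<Psi> \<Phi> = CC_energy K \<phi> H t * inner \<Psi> \<Phi>"
proof
  fix \<Phi> assume \<Phi>: "\<Phi> \<in> V"
  let ?c = "state_of t"
  have c: "?c \<in> excited_space" and \<Psi>: "\<Psi> = nil_eval N (mul ?c) (fps_exp 1) (e {})"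
    and z: "\<And>v. v \<in> excited_space \<Longrightarrow> H \<Psi> (nil_eval N (adj ?c) (fps_exp (- 1)) v) = 0"
    using CC state_of_excited unfolding full_CC_iff by blast+
  interpret nilpotent_operator V "adj ?c" N by (rule nilpotent_adj[OF c])
  let ?D = "nil_eval N (adj ?c) (fps_exp (- 1))"
  have e0: "e {} \<in> V" by (rule e_V[OF empty_code])
  \<comment> \<open>The preimage of \<open>\<Phi>\<close> under the adjoint of the inverse exponential.\<close>
  define \<Phi>' where "\<Phi>' = nil_eval N (adj ?c) (fps_exp 1) \<Phi>"
  have \<Phi>': "\<Phi>' \<in> V" unfolding \<Phi>'_def by (rule nil_eval_S[OF \<Phi>])
  define k where "k = coef \<Phi>' {}"
  have k: "k = inner \<Psi> \<Phi>"
  proof -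
    have "k = inner (e {}) \<Phi>'" using inner_e0[OF \<Phi>'] by (simp add: k_def inner_commute)
    also have "\<dots> = inner \<Psi> \<Phi>" unfolding \<Phi>'_def \<Psi> by (rule inner_nil_eval[OF c e0 \<Phi>, symmetric])
    finally show ?thesis .
  qed
  define v where "v = \<Phi>' - k *\<^sub>R e {}"
  have v: "v \<in> excited_space" unfolding v_def k_def by (rule excited_decomposition[OF \<Phi>'])
  have "\<Phi> = ?D \<Phi>'" unfolding \<Phi>'_def by (rule nil_eval_exp_inverse[OF \<Phi>, symmetric])
  also have "\<Phi>' = k *\<^sub>R e {} + v" by (simp add: v_def)
  also have "?D (k *\<^sub>R e {} + v) = k *\<^sub>R ?D (e {}) + 1 *\<^sub>R ?D v"
    using nil_eval_linear(1)[OF V_scale[OF e0] excited_V[OF v]] nil_eval_linear(2)[OF e0] by simp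
  finally have "H \<Psi> \<Phi> = H \<Psi> (k *\<^sub>R ?D (e {}) + 1 *\<^sub>R ?D v)"
    by (rule arg_cong)
  also have "\<dots> = k * H \<Psi> (?D (e {})) + 1 * H \<Psi> (?D v)"
    by (rule H_linear[OF nil_eval_S[OF e0] nil_eval_S[OF excited_V[OF v]]])
  finally show "H \<Psi> \<Phi> = CC_energy K \<phi> H t * inner \<Psi> \<Phi>"
    using z[OF v] by (simp add: CC_energy_eq[OF CC] k mult.commute)
qed

lemma eigen_imp_CC:
  assumes E: "\<forall>\<Phi>\<in>V. H \<Psi> \<Phi> = E * inner \<Psi> \<Phi>"
  shows "\<exists>t. full_CC K \<phi> H \<Psi> t"
proof -
  let ?c = "logarithm (\<Psi> - e {})"
  have c: "?c \<in> excited_space" by (rule logarithm_excited[OF residual_excited])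
  have \<Psi>: "\<Psi> = nil_eval N (mul ?c) (fps_exp 1) (e {})" using exp_logarithm[OF residual_excited] by simp
  obtain t where t: "t \<in> amplitudes TYPE('n) K \<phi>" "state_of t = ?c"
    using excited_space_amplitudes[OF c] by blast
  have "H \<Psi> (nil_eval N (adj ?c) (fps_exp (- 1)) v) = 0" if v: "v \<in> excited_space" for v
    using eigen_CC_pairing[OF E c \<Psi> excited_V[OF v]] v inner_e0[OF excited_V[OF v]]
    by (simp add: excited_space_def inner_commute)
  then have "full_CC K \<phi> H \<Psi> t" unfolding full_CC_iff t(2) using t(1) \<Psi> by blast
  then show ?thesis by (rule exI[of _ t])
qed

lemma eigen_CC_energy:
  assumes E: "\<forall>\<Phi>\<in>V. H \<Psi> \<Phi> = E * inner \<Psi> \<Phi>" and CC: "full_CC K \<phi> H \<Psi> t"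
  shows "E = CC_energy K \<phi> H t"
proof -
  have "E * inner \<Psi> (e {}) = CC_energy K \<phi> H t * inner \<Psi> (e {})"
    using E CC_imp_eigen[OF CC] e_V[OF empty_code] by metis
  then show ?thesis by (simp add: \<Psi>1)
qed

lemma CI_imp_eigen:
  assumes CI: "full_CI K \<phi> H \<Psi> c"
  shows "\<forall>\<Phi>\<in>V. H \<Psi> \<Phi> = CI_energy K \<phi> H c * inner \<Psi> \<Phi>"
proof
  fix \<Phi> assume \<Phi>: "\<Phi> \<in> V"
  have e0: "e {} \<in> V" by (rule e_V[OF empty_code])
  define k where "k = coef \<Phi> {}"
  define v where "v = \<Phi> - k *\<^sub>R e {}"
  have v: "v \<in> excited_space" unfolding v_def k_def by (rule excited_decomposition[OF \<Phi>])
  have dec: "\<Phi> = k *\<^sub>R e {} + 1 *\<^sub>R v" by (simp add: v_def)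
  have "H \<Psi> \<Phi> = k * H \<Psi> (e {}) + 1 * H \<Psi> v"
    by (subst dec) (rule H_linear[OF e0 excited_V[OF v]])
  also have "H \<Psi> v = H \<Psi> (e {}) * inner \<Psi> v" using CI v unfolding full_CI_iff by blast
  also have "inner \<Psi> v = inner \<Psi> \<Phi> - k" by (simp add: v_def inner_diff_right \<Psi>1)
  finally show "H \<Psi> \<Phi> = CI_energy K \<phi> H c * inner \<Psi> \<Phi>"
    by (simp add: CI_energy_eq[OF CI] algebra_simps)
qed

lemma eigen_imp_CI:
  assumes E: "\<forall>\<Phi>\<in>V. H \<Psi> \<Phi> = E * inner \<Psi> \<Phi>"
  shows "\<exists>c. full_CI K \<phi> H \<Psi> c"
proof -
  obtain c where c: "c \<in> amplitudes TYPE('n) K \<phi>" "state_of c = \<Psi> - e {}"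
    using excited_space_amplitudes[OF residual_excited] by blast
  have "H \<Psi> (e {}) = E" using E e_V[OF empty_code] \<Psi>1 by simp
  then have "full_CI K \<phi> H \<Psi> c" unfolding full_CI_iff using c E excited_V by simp
  then show ?thesis by (rule exI[of _ c])
qed

lemma eigen_CI_energy:
  assumes E: "\<forall>\<Phi>\<in>V. H \<Psi> \<Phi> = E * inner \<Psi> \<Phi>" and CI: "full_CI K \<phi> H \<Psi> c"
  shows "E = CI_energy K \<phi> H c"
  using E e_V[OF empty_code] \<Psi>1 by (simp add: CI_energy_eq[OF CI])

end

end

theorem theorem4p4:
  fixes K :: enat
    and \<phi> :: "nat \<Rightarrow> (real^3) l2"
    and H :: "('n::{finite,linorder}) config l2 \<Rightarrow> 'n config l2 \<Rightarrow> real"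
    and \<Psi> :: "'n config l2"
  assumes "enat CARD('n) \<le> K"
    and "\<forall>p\<in>orbitals K. \<phi> p \<in> H1"
    and "\<forall>p\<in>orbitals K. \<forall>q\<in>orbitals K. inner (\<phi> p) (\<phi> q) = (if p = q then 1 else 0)"
    and "bounded_operator_to_dual (H1K K \<phi>) H"
    and "\<Psi> \<in> H1K K \<phi>"
    and "inner \<Psi> (slater \<phi> (ref_state CARD('n))) = 1"
  shows "((\<exists>E. \<forall>\<Phi>\<in>H1K K \<phi>. H \<Psi> \<Phi> = E * inner \<Psi> \<Phi>) \<longleftrightarrow> (\<exists>t. full_CC K \<phi> H \<Psi> t)) \<and>
    ((\<exists>E. \<forall>\<Phi>\<in>H1K K \<phi>. H \<Psi> \<Phi> = E * inner \<Psi> \<Phi>) \<longleftrightarrow> (\<exists>c. full_CI K \<phi> H \<Psi> c)) \<and>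
    (\<forall>E. (\<forall>\<Phi>\<in>H1K K \<phi>. H \<Psi> \<Phi> = E * inner \<Psi> \<Phi>) \<longrightarrow>
      (\<forall>t. full_CC K \<phi> H \<Psi> t \<longrightarrow> E = CC_energy K \<phi> H t) \<and>
      (\<forall>c. full_CI K \<phi> H \<Psi> c \<longrightarrow> E = CI_energy K \<phi> H c))"
proof -
  interpret slater_basis K \<phi> "TYPE('n)" "ref_state CARD('n)"
    by standard (use assms(1-3) in auto)
  have VH: "H1K K \<phi> = V" by (simp add: V_def)
  have lin: "linear_on_subspace V (H \<Psi>)"
    using assms(4,5) unfolding VH by (auto simp: bounded_operator_to_dual_def dual_space_def)
  have \<Psi>: "\<Psi> \<in> V" using assms(5) by (simp add: VH)
  have \<Psi>1: "inner \<Psi> (e {}) = 1" using assms(6) by (simp add: reference_e)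
  note facts = lin \<Psi> \<Psi>1
  show ?thesis
    unfolding VH
    using CC_imp_eigen[of H \<Psi>, OF facts] eigen_imp_CC[of H \<Psi>, OF facts] eigen_CC_energy[of H \<Psi>, OF facts]
      CI_imp_eigen[of H \<Psi>, OF facts] eigen_imp_CI[of H \<Psi>, OF facts] eigen_CI_energy[of H \<Psi>, OF facts]
    by (intro conjI iffI allI impI) blast+
qed

end
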